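(* Let $S$ be a simply connected Riemann surface. To every harmonic map $f\colon S\to S^3$ one can associate an $H$-surface $X\colon S\to\mathbb{R}^3$ satisfying $$X_{xx}+X_{yy}=-2\,X_x\times X_y,\qquad(\ast)$$ and vice versa: every harmonic map $f\colon S\to S^3$ has an associated map $X\colon S\to\mathbb{R}^3$ satisfying $(\ast)$, and every $X\colon S\to\mathbb{R}^3$ satisfying $(\ast)$ is associated to some harmonic map $f\colon S\to S^3$. Moreover, the harmonic map $f$ is non-conformal if and only if the associated $H$-surface $X$ has non-vanishing holomorphic differential $\langle X_z,X_z\rangle\,dz^2$, where $z=x+iy$.
   Context: $S^3$ is the set of unit quaternions in $\mathbb{H}=\mathbb{R}^4$ and $\mathbb{R}^3$ is identified with the imaginary quaternions (basis $e_1,e_2,e_3$ with $e_1^2=e_2^2=e_3^2=e_1e_2e_3=-1$), so that $\alpha\beta=-\langle\alpha,\beta\rangle+\alpha\times\beta$ for imaginary $\alpha,\beta$. $\langle\,,\rangle$ is extended complex-bilinearly. In a local complex coordinate $z=x+iy$ on $S$, $f\colon S\to S^3\subset\mathbb{R}^4$ is harmonic if $f_{z\bar z}=-\langle f_z,f_{\bar z}\rangle f$; then $\langle f_z,f_z\rangle dz^2$ is holomorphic, and $f$ is non-conformal if it is non-zero. Write $f_x=f\alpha$, $f_y=f\beta$ with $\alpha,\beta$ imaginary-quaternion valued. A smooth map $X\colon S\to\mathbb{R}^3$ is an $H$-surface (with constant $H$) if $X_{xx}+X_{yy}=2H\,X_x\times X_y$; this condition does not depend on the complex coordinate, and $\langle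 X_z,X_z\rangle dz^2$ is then holomorphic. ($H$-surfaces need not be conformal.) $f$ and $X$ are called associated if, in every local complex coordinate $z=x+iy$, $X_x=\beta$ and $X_y=-\alpha$. "Non-zero" and "non-vanishing" for the two quadratic differentials are understood in the same sense (e.g. not identically zero, or nowhere zero, for both). *)

theory Defs
  imports "HOL-Analysis.Analysis"
begin

section \<open>Riemann surfaces\<close>

type_synonym 'a chart = "'a set \<times> ('a \<Rightarrow> complex)"

definition chart_inv :: "'a chart \<Rightarrow> complex \<Rightarrow> 'a" where
  "chart_inv c = inv_into (fst c) (snd c)"

definition chart_image :: "'a chart \<Rightarrow> complex set" where
  "chart_image c = snd c ` fst c"

definition complex_chart :: "('a::topological_space) chart \<Rightarrow> bool" where
  "complex_chart c \<longleftrightarrow> open (fst c) \<and> open (chart_image c) \<and>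
     homeomorphism (fst c) (chart_image c) (snd c) (chart_inv c)"

definition transition :: "'a chart \<Rightarrow> 'a chart \<Rightarrow> complex \<Rightarrow> complex" where
  "transition c d = snd d \<circ> chart_inv c"

definition compatible :: "'a chart \<Rightarrow> 'a chart \<Rightarrow> bool" where
  "compatible c d \<longleftrightarrow>
     transition c d holomorphic_on snd c ` (fst c \<inter> fst d) \<and>
     transition d c holomorphic_on snd d ` (fst c \<inter> fst d)"

text \<open>The surface is the whole type, its Hausdorff topology that of the class \<open>t2_space\<close>; \<open>A\<close> is
  any holomorphic atlas. Second countability is not required (it follows, by Rado's theorem).\<close>

definition riemann_surface :: "('a::t2_space) chart set \<Rightarrow> bool" where
  "riemann_surface A \<longleftrightarrow> connected (UNIV :: 'a set) \<and>
     (\<forall>c\<in>A. complex_chart c) \<and> (\<forall>c\<in>A. \<forall>d\<in>A. compatible c d) \<and> (\<Union>c\<in>A. fst c) = UNIV"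

text \<open>The local complex coordinates are the charts of the maximal atlas containing \<open>A\<close>.\<close>

definition local_coordinate :: "('a::t2_space) chart set \<Rightarrow> 'a chart \<Rightarrow> bool" where
  "local_coordinate A c \<longleftrightarrow> complex_chart c \<and> (\<forall>d\<in>A. compatible c d)"

definition in_coord :: "'a chart \<Rightarrow> ('a \<Rightarrow> 'b) \<Rightarrow> complex \<Rightarrow> 'b" where
  "in_coord c F = F \<circ> chart_inv c"


section \<open>Smooth maps and derivatives in a coordinate \<open>z = x + iy\<close>\<close>

text \<open>Used on open sets only, where it means continuous partial derivatives up to order \<open>n\<close>.\<close>

fun n_times_differentiable_on ::
  "nat \<Rightarrow> 'a::real_normed_vector set \<Rightarrow> ('a \<Rightarrow> 'b::real_normed_vector) \<Rightarrow> bool" where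
  "n_times_differentiable_on 0 U g \<longleftrightarrow> continuous_on U g"
| "n_times_differentiable_on (Suc n) U g \<longleftrightarrow> (\<forall>x\<in>U. g differentiable (at x)) \<and>
     (\<forall>v. n_times_differentiable_on n U (\<lambda>x. frechet_derivative g (at x) v))"

definition smooth_on :: "'a::real_normed_vector set \<Rightarrow> ('a \<Rightarrow> 'b::real_normed_vector) \<Rightarrow> bool" where
  "smooth_on U g \<longleftrightarrow> (\<forall>n. n_times_differentiable_on n U g)"

definition smooth_map :: "('a::t2_space) chart set \<Rightarrow> ('a \<Rightarrow> 'b::real_normed_vector) \<Rightarrow> bool" where
  "smooth_map A F \<longleftrightarrow> (\<forall>c. local_coordinate A c \<longrightarrow> smooth_on (chart_image c) (in_coord c F))"

definition dx :: "(complex \<Rightarrow> 'b::real_normed_vector) \<Rightarrow> complex \<Rightarrow> 'b" where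
  "dx g w = frechet_derivative g (at w) 1"

definition dy :: "(complex \<Rightarrow> 'b::real_normed_vector) \<Rightarrow> complex \<Rightarrow> 'b" where
  "dy g w = frechet_derivative g (at w) \<i>"

definition cvec :: "real ^ 'n \<Rightarrow> complex ^ 'n" where
  "cvec v = (\<chi> i. complex_of_real (v $ i))"

definition cdot :: "complex ^ 'n \<Rightarrow> complex ^ 'n \<Rightarrow> complex" where
  "cdot u v = (\<Sum>i\<in>UNIV. u $ i * v $ i)"

definition dz :: "(complex \<Rightarrow> complex ^ 'n) \<Rightarrow> complex \<Rightarrow> complex ^ 'n" where
  "dz g w = (1 / 2) *s (dx g w - \<i> *s dy g w)"

definition dzbar :: "(complex \<Rightarrow> complex ^ 'n) \<Rightarrow> complex \<Rightarrow> complex ^ 'n" where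
  "dzbar g w = (1 / 2) *s (dx g w + \<i> *s dy g w)"


section \<open>Quaternions\<close>

text \<open>\<open>\<bbbH> = \<real>\<^sup>4\<close>, with the real part as first component.\<close>

type_synonym quat = "real ^ 4"

definition qre :: "quat \<Rightarrow> real" where
  "qre q = q $ 1"

definition qim :: "quat \<Rightarrow> real ^ 3" where
  "qim q = vector [q $ 2, q $ 3, q $ 4]"

definition quat :: "real \<Rightarrow> real ^ 3 \<Rightarrow> quat" where
  "quat a u = vector [a, u $ 1, u $ 2, u $ 3]"

definition imq :: "real ^ 3 \<Rightarrow> quat" where
  "imq u = quat 0 u"

definition qmult :: "quat \<Rightarrow> quat \<Rightarrow> quat" (infixl \<open>\<odot>\<close> 70) where
  "p \<odot> q = quat (qre p * qre q - qim p \<bullet> qim q)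
             (qre p *\<^sub>R qim q + qre q *\<^sub>R qim p + cross3 (qim p) (qim q))"

lemma vector_4 [simp]:
  "(vector [a, b, c, d] :: 'b::zero ^ 4) $ 1 = a"
  "(vector [a, b, c, d] :: 'b ^ 4) $ 2 = b"
  "(vector [a, b, c, d] :: 'b ^ 4) $ 3 = c"
  "(vector [a, b, c, d] :: 'b ^ 4) $ 4 = d"
  unfolding vector_def by simp_all

lemma imq_mult: "imq a \<odot> imq b = quat (- (a \<bullet> b)) (cross3 a b)"
  by (simp add: qmult_def imq_def quat_def qre_def qim_def cross3_def inner_vec_def sum_3)

lemma quaternion_relations:
  "imq (axis 1 1) \<odot> imq (axis 1 1) = quat (- 1) 0"
  "imq (axis 2 1) \<odot> imq (axis 2 1) = quat (- 1) 0"
  "imq (axis 3 1) \<odot> imq (axis 3 1) = quat (- 1) 0"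
  "imq (axis 1 1) \<odot> imq (axis 2 1) \<odot> imq (axis 3 1) = quat (- 1) 0"
  by (simp_all add: qmult_def imq_def quat_def qre_def qim_def cross3_def inner_vec_def sum_3
        axis_def vec_eq_iff forall_4)

lemma qmult_assoc: "p \<odot> q \<odot> r = p \<odot> (q \<odot> r)"
  by (simp add: qmult_def quat_def qre_def qim_def cross3_def inner_vec_def sum_3
        vec_eq_iff forall_4 algebra_simps)


section \<open>Harmonic maps, H-surfaces and their quadratic differentials\<close>

definition harmonic_map :: "('a::t2_space) chart set \<Rightarrow> ('a \<Rightarrow> quat) \<Rightarrow> bool" where
  "harmonic_map A f \<longleftrightarrow> (\<forall>p. norm (f p) = 1) \<and> smooth_map A f \<and>
     (\<forall>c. local_coordinate A c \<longrightarrow> (\<forall>w\<in>chart_image c.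
        let F = cvec \<circ> in_coord c f
        in dzbar (dz F) w = - cdot (dz F w) (dzbar F w) *s F w))"

definition H_surface :: "('a::t2_space) chart set \<Rightarrow> real \<Rightarrow> ('a \<Rightarrow> real ^ 3) \<Rightarrow> bool" where
  "H_surface A H X \<longleftrightarrow> smooth_map A X \<and>
     (\<forall>c. local_coordinate A c \<longrightarrow> (\<forall>w\<in>chart_image c.
        let Y = in_coord c X
        in dx (dx Y) w + dy (dy Y) w = (2 * H) *\<^sub>R cross3 (dx Y w) (dy Y w)))"

definition associated ::
  "('a::t2_space) chart set \<Rightarrow> ('a \<Rightarrow> quat) \<Rightarrow> ('a \<Rightarrow> real ^ 3) \<Rightarrow> bool" where
  "associated A f X \<longleftrightarrow> (\<forall>c. local_coordinate A c \<longrightarrow>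
     (\<exists>\<alpha> \<beta> :: complex \<Rightarrow> real ^ 3. \<forall>w\<in>chart_image c.
        dx (in_coord c f) w = in_coord c f w \<odot> imq (\<alpha> w) \<and>
        dy (in_coord c f) w = in_coord c f w \<odot> imq (\<beta> w) \<and>
        dx (in_coord c X) w = \<beta> w \<and>
        dy (in_coord c X) w = - \<alpha> w))"

text \<open>A quadratic differential \<open>Q dz\<^sup>2\<close> is given by its coefficient in each local coordinate.\<close>

definition holomorphic_quadratic_differential ::
  "('a::t2_space) chart set \<Rightarrow> ('a chart \<Rightarrow> complex \<Rightarrow> complex) \<Rightarrow> bool" where
  "holomorphic_quadratic_differential A Q \<longleftrightarrow>
     (\<forall>c. local_coordinate A c \<longrightarrow> Q c holomorphic_on chart_image c) \<and>
     (\<forall>c d. local_coordinate A c \<and> local_coordinate A d \<longrightarrow>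
        (\<forall>p\<in>fst c \<inter> fst d.
           Q c (snd c p) = Q d (snd d p) * (deriv (transition c d) (snd c p))\<^sup>2))"

definition not_identically_zero ::
  "('a::t2_space) chart set \<Rightarrow> ('a chart \<Rightarrow> complex \<Rightarrow> complex) \<Rightarrow> bool" where
  "not_identically_zero A Q \<longleftrightarrow> (\<exists>c. local_coordinate A c \<and> (\<exists>w\<in>chart_image c. Q c w \<noteq> 0))"

definition nowhere_zero ::
  "('a::t2_space) chart set \<Rightarrow> ('a chart \<Rightarrow> complex \<Rightarrow> complex) \<Rightarrow> bool" where
  "nowhere_zero A Q \<longleftrightarrow> (\<forall>c. local_coordinate A c \<longrightarrow> (\<forall>w\<in>chart_image c. Q c w \<noteq> 0))"

text \<open>The coefficient of \<open>\<langle>F\<^sub>z, F\<^sub>z\<rangle> dz\<^sup>2\<close>.\<close>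

definition hopf_differential :: "('a \<Rightarrow> real ^ 'n) \<Rightarrow> 'a chart \<Rightarrow> complex \<Rightarrow> complex" where
  "hopf_differential F c w =
     cdot (dz (cvec \<circ> in_coord c F) w) (dz (cvec \<circ> in_coord c F) w)"

text \<open>The two readings of ``non-conformal'': the differential is non-zero as a differential, or
  at every point.\<close>

definition nonconformal :: "('a::t2_space) chart set \<Rightarrow> ('a \<Rightarrow> quat) \<Rightarrow> bool" where
  "nonconformal A f \<longleftrightarrow> not_identically_zero A (hopf_differential f)"

definition nowhere_conformal :: "('a::t2_space) chart set \<Rightarrow> ('a \<Rightarrow> quat) \<Rightarrow> bool" where
  "nowhere_conformal A f \<longleftrightarrow> nowhere_zero A (hopf_differential f)"

end

theory Submission
  imports Defs
begin

text \<open>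
  Write \<open>f\<^sub>x = f \<alpha>\<close> and \<open>f\<^sub>y = f \<beta>\<close>. In coordinates, \<open>f\<close> is harmonic iff \<open>\<alpha>\<^sub>x + \<beta>\<^sub>y = 0\<close>, i.e. iff
  \<open>\<beta> dx - \<alpha> dy\<close> is closed, and the integrability condition \<open>f\<^sub>x\<^sub>y = f\<^sub>y\<^sub>x\<close> reads
  \<open>\<alpha>\<^sub>y - \<beta>\<^sub>x = 2 \<alpha> \<times> \<beta>\<close>. With \<open>X\<^sub>x = \<beta>\<close> and \<open>X\<^sub>y = -\<alpha>\<close> the roles are exchanged: the first condition
  is \<open>X\<^sub>x\<^sub>y = X\<^sub>y\<^sub>x\<close>, the second is the H-surface equation. So each map yields a flat linear system
  \<open>du = u (\<alpha> dx + \<beta> dy)\<close>, respectively \<open>dX = \<beta> dx - \<alpha> dy\<close>, for the other. Such a system has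
  unique local solutions with a given value at a point (Picard iteration plus flatness), and by
  monodromy these extend to a simply connected surface. Finally
  \<open>\<langle>X\<^sub>z, X\<^sub>z\<rangle> = - \<langle>f\<^sub>z, f\<^sub>z\<rangle>\<close>, because \<open>\<langle>f \<alpha>, f \<beta>\<rangle> = \<langle>\<alpha>, \<beta>\<rangle>\<close> for unit \<open>f\<close>.
\<close>

section \<open>Monodromy for local solutions\<close>

text \<open>Both directions are instances of one theorem, \<open>parallel_section\<close>, for
  systems \<open>du = u (\<alpha> dx + \<beta> dy)\<close> with a bounded bilinear product. For the
  passage to \<open>f\<close> the product is right multiplication by imaginary quaternions; a closed
  form is integrated through an auxiliary product for which flatness reduces to closedness. That the
  second system is global rests on conformality: a coordinate change acts on
  \<open>(\<alpha>, \<beta>)\<close> through multiplication by a complex number, which commutes with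
  the quarter turn to \<open>(\<beta>, -\<alpha>)\<close>, so this pair is again a 1-form. The
  constraint \<open>|f| = 1\<close> is not built into the system: it holds at one point and
  propagates, because the squared norm has zero derivative. Two obstacles shape the rest.
  Integration along a broken path gives only one of the two equations, so flatness has to be
  exploited before \<open>u\<close> is known to be differentiable in \<open>x\<close>. And
  continuation must not depend on the path; for this, solutions are treated as an abstract sheaf
  whose sections are determined by one value on small sets, which is all that the locale below
  records.\<close>

locale local_solutions =
  fixes sol :: "('a::topological_space \<Rightarrow> 'v) \<Rightarrow> 'a \<Rightarrow> bool"
    and solvable :: "'a set \<Rightarrow> bool"
  assumes sol_cong: "open W \<Longrightarrow> p \<in> W \<Longrightarrow> (\<And>q. q \<in> W \<Longrightarrow> f q = g q) \<Longrightarrow> sol f p \<Longrightarrow> sol g p"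
    and solvable_basis: "open W \<Longrightarrow> p \<in> W \<Longrightarrow> \<exists>U. p \<in> U \<and> U \<subseteq> W \<and> solvable U"
    and solvable_open: "solvable U \<Longrightarrow> open U"
    and solvable_path_connected: "solvable U \<Longrightarrow> path_connected U"
    and solvable_exists: "solvable U \<Longrightarrow> q \<in> U \<Longrightarrow> \<exists>u. u q = v \<and> (\<forall>x\<in>U. sol u x)"
    and solvable_unique: "solvable U \<Longrightarrow> q \<in> U \<Longrightarrow> (\<And>x. x \<in> U \<Longrightarrow> sol u x) \<Longrightarrow>
      (\<And>x. x \<in> U \<Longrightarrow> sol u' x) \<Longrightarrow> u q = u' q \<Longrightarrow> x \<in> U \<Longrightarrow> u x = u' x"
begin

text \<open>A solution along \<open>k\<close>, i.e. a section over \<open>T\<close> of the sheaf of solutions pulled back by \<open>k\<close>.\<close>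

definition sol_along :: "('t::topological_space \<Rightarrow> 'a) \<Rightarrow> 't set \<Rightarrow> ('t \<Rightarrow> 'v) \<Rightarrow> bool" where
  "sol_along k T g \<longleftrightarrow> (\<forall>t\<in>T. \<exists>U u N. k t \<in> U \<and> open U \<and> (\<forall>x\<in>U. sol u x) \<and>
     open N \<and> t \<in> N \<and> (\<forall>s\<in>N \<inter> T. k s \<in> U \<and> g s = u (k s)))"

text \<open>Every point of \<open>T\<close> may serve as base point with any prescribed value.
  Gluing needs this freedom: the second piece is started in the overlap with the value already
  reached on the first.\<close>

definition sol_along_exists :: "('t::topological_space \<Rightarrow> 'a) \<Rightarrow> 't set \<Rightarrow> bool" where
  "sol_along_exists k T \<longleftrightarrow> (\<forall>t\<in>T. \<forall>v. \<exists>g. sol_along k T g \<and> g t = v)"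

lemma sol_alongE:
  assumes "sol_along k T g" "t \<in> T"
  obtains U u N where "k t \<in> U" "open U" "\<And>x. x \<in> U \<Longrightarrow> sol u x" "open N" "t \<in> N"
    "\<And>s. s \<in> N \<Longrightarrow> s \<in> T \<Longrightarrow> k s \<in> U" "\<And>s. s \<in> N \<Longrightarrow> s \<in> T \<Longrightarrow> g s = u (k s)"
  using assms unfolding sol_along_def by (metis IntI)

lemma sol_along_cong:
  assumes "sol_along k T g" "\<And>t. t \<in> T \<Longrightarrow> k t = k' t" "\<And>t. t \<in> T \<Longrightarrow> g t = g' t"
  shows "sol_along k' T g'"
  using assms unfolding sol_along_def by (metis IntD2)

lemma sol_along_compose:
  assumes g: "sol_along k T g" and j: "continuous_on T' j" "j ` T' \<subseteq> T"
  shows "sol_along (k \<circ> j) T' (g \<circ> j)"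
  unfolding sol_along_def
proof
  fix t assume t: "t \<in> T'"
  then have "j t \<in> T" using j by auto
  from sol_alongE[OF g this] obtain U u N where *: "k (j t) \<in> U" "open U" "\<And>x. x \<in> U \<Longrightarrow> sol u x"
    "open N" "j t \<in> N" "\<And>s. s \<in> N \<Longrightarrow> s \<in> T \<Longrightarrow> k s \<in> U" "\<And>s. s \<in> N \<Longrightarrow> s \<in> T \<Longrightarrow> g s = u (k s)"
    by metis
  obtain N' where N': "open N'" "t \<in> N'" "\<And>s. s \<in> T' \<Longrightarrow> s \<in> N' \<Longrightarrow> j s \<in> N"
    using j(1) t *(4,5) unfolding continuous_on_topological by metis
  show "\<exists>U u N. (k \<circ> j) t \<in> U \<and> open U \<and> (\<forall>x\<in>U. sol u x) \<and>
     open N \<and> t \<in> N \<and> (\<forall>s\<in>N \<inter> T'. (k \<circ> j) s \<in> U \<and> (g \<circ> j) s = u ((k \<circ> j) s))"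
    using * N' j(2) by (intro exI[of _ U] exI[of _ u] exI[of _ N']) auto
qed

lemma sol_along_common_nbhd:
  assumes k: "continuous_on T k" and t: "t \<in> T" and U: "open U1" "open U2" "k t \<in> U1" "k t \<in> U2"
  obtains U N where "solvable U" "k t \<in> U" "U \<subseteq> U1" "U \<subseteq> U2" "open N" "t \<in> N"
    "\<And>s. s \<in> T \<Longrightarrow> s \<in> N \<Longrightarrow> k s \<in> U"
proof -
  obtain U where U: "solvable U" "k t \<in> U" "U \<subseteq> U1 \<inter> U2"
    using solvable_basis[of "U1 \<inter> U2" "k t"] U by auto
  moreover obtain N where "open N" "t \<in> N" "\<And>s. s \<in> T \<Longrightarrow> s \<in> N \<Longrightarrow> k s \<in> U"
    using k t U solvable_open[OF U(1)] unfolding continuous_on_topological by metis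
  ultimately show ?thesis using that by blast
qed

text \<open>Agreement is a locally constant property of \<open>t\<close>: near \<open>t\<close> both
  sections come from solutions on one common solvable set, where these agree everywhere or
  nowhere.\<close>

lemma sol_along_unique:
  assumes k: "continuous_on T k" and T: "connected T"
    and g: "sol_along k T g1" "sol_along k T g2" and t0: "t0 \<in> T" "g1 t0 = g2 t0" and t: "t \<in> T"
  shows "g1 t = g2 t"
proof -
  have "(g1 t0 = g2 t0) = (g1 t = g2 t)"
  proof (rule connected_local_const[OF T t0(1) t, where f = "\<lambda>t. g1 t = g2 t"], safe)
    fix t assume t: "t \<in> T"
    obtain U1 u1 N1 where 1: "k t \<in> U1" "open U1" "\<And>x. x \<in> U1 \<Longrightarrow> sol u1 x"
      "open N1" "t \<in> N1" "\<And>s. s \<in> N1 \<Longrightarrow> s \<in> T \<Longrightarrow> g1 s = u1 (k s)"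
      using sol_alongE[OF g(1) t] by metis
    obtain U2 u2 N2 where 2: "k t \<in> U2" "open U2" "\<And>x. x \<in> U2 \<Longrightarrow> sol u2 x"
      "open N2" "t \<in> N2" "\<And>s. s \<in> N2 \<Longrightarrow> s \<in> T \<Longrightarrow> g2 s = u2 (k s)"
      using sol_alongE[OF g(2) t] by metis
    obtain U N where N: "solvable U" "k t \<in> U" "U \<subseteq> U1" "U \<subseteq> U2" "open N" "t \<in> N"
      "\<And>s. s \<in> T \<Longrightarrow> s \<in> N \<Longrightarrow> k s \<in> U"
      using sol_along_common_nbhd[OF k t 1(2) 2(2) 1(1) 2(1)] by metis
    have "(u1 x = u2 x) = (u1 y = u2 y)" if "x \<in> U" "y \<in> U" for x y
      using solvable_unique[OF N(1), of _ u1 u2] 1(3) 2(3) N(3,4) that by blast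
    then have "(g1 t = g2 t) = (g1 s = g2 s)" if "s \<in> N \<inter> N1 \<inter> N2" "s \<in> T" for s
      using that t N 1 2 by auto
    moreover have "open (N \<inter> N1 \<inter> N2)" "t \<in> N \<inter> N1 \<inter> N2" using N 1 2 by auto
    ultimately show "\<forall>\<^sub>F s in at t within T. (g1 t = g2 t) = (g1 s = g2 s)"
      unfolding eventually_at_topological by blast
  qed
  with t0 show ?thesis by simp
qed

text \<open>At a point of one piece only, the neighbourhood is shrunk to miss the other, closed
  piece. At a common point the two local solutions share the value \<open>g t\<close>, so by
  uniqueness they coincide nearby.\<close>

lemma sol_along_Un:
  assumes k: "continuous_on (T1 \<union> T2) k" and T: "closed T1" "closed T2"
    and g: "sol_along k T1 g" "sol_along k T2 g"
  shows "sol_along k (T1 \<union> T2) g"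
proof -
  have *: "\<exists>U u N. k t \<in> U \<and> open U \<and> (\<forall>x\<in>U. sol u x) \<and>
     open N \<and> t \<in> N \<and> (\<forall>s\<in>N \<inter> (T1 \<union> T2). k s \<in> U \<and> g s = u (k s))"
    if g: "sol_along k T1 g" "closed T2" "t \<in> T1" "t \<notin> T2" for t T1 T2
  proof -
    obtain U1 u1 N1 where "k t \<in> U1" "open U1" "\<And>x. x \<in> U1 \<Longrightarrow> sol u1 x"
      "open N1" "t \<in> N1" "\<And>s. s \<in> N1 \<Longrightarrow> s \<in> T1 \<Longrightarrow> k s \<in> U1"
      "\<And>s. s \<in> N1 \<Longrightarrow> s \<in> T1 \<Longrightarrow> g s = u1 (k s)"
      using sol_alongE[OF g(1,3)] by metis
    then show ?thesis using g
      by (intro exI[of _ U1] exI[of _ u1] exI[of _ "N1 - T2"]) (auto intro: open_Diff)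
  qed
  show ?thesis unfolding sol_along_def
  proof
    fix t assume t: "t \<in> T1 \<union> T2"
    consider "t \<in> T1" "t \<notin> T2" | "t \<in> T2" "t \<notin> T1" | "t \<in> T1" "t \<in> T2" using t by blast
    then show "\<exists>U u N. k t \<in> U \<and> open U \<and> (\<forall>x\<in>U. sol u x) \<and>
     open N \<and> t \<in> N \<and> (\<forall>s\<in>N \<inter> (T1 \<union> T2). k s \<in> U \<and> g s = u (k s))"
    proof cases
      case 3
      obtain U1 u1 N1 where 1: "k t \<in> U1" "open U1" "\<And>x. x \<in> U1 \<Longrightarrow> sol u1 x"
        "open N1" "t \<in> N1" "\<And>s. s \<in> N1 \<Longrightarrow> s \<in> T1 \<Longrightarrow> g s = u1 (k s)"
        using sol_alongE[OF g(1) 3(1)] by metis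
      obtain U2 u2 N2 where 2: "k t \<in> U2" "open U2" "\<And>x. x \<in> U2 \<Longrightarrow> sol u2 x"
        "open N2" "t \<in> N2" "\<And>s. s \<in> N2 \<Longrightarrow> s \<in> T2 \<Longrightarrow> g s = u2 (k s)"
        using sol_alongE[OF g(2) 3(2)] by metis
      obtain U N where N: "solvable U" "k t \<in> U" "U \<subseteq> U1" "U \<subseteq> U2" "open N" "t \<in> N"
        "\<And>s. s \<in> T1 \<union> T2 \<Longrightarrow> s \<in> N \<Longrightarrow> k s \<in> U"
        using sol_along_common_nbhd[OF k t 1(2) 2(2) 1(1) 2(1)] by metis
      have "u1 (k t) = u2 (k t)" using 1 2 3 by metis
      then have "u1 x = u2 x" if "x \<in> U" for x
        using solvable_unique[OF N(1,2), of u1 u2] 1(3) 2(3) N(3,4) that by blast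
      then show ?thesis using 1 2 N solvable_open[OF N(1)]
        by (intro exI[of _ U] exI[of _ u1] exI[of _ "N \<inter> N1 \<inter> N2"]) auto
    next
      case 1 then show ?thesis using *[OF g(1) T(2)] by simp
    next
      case 2 then show ?thesis using *[OF g(2) T(1)] by (simp add: Un_commute)
    qed
  qed
qed

text \<open>The two sections are matched at a single point \<open>s\<close> of the overlap; its
  connectedness and uniqueness spread the agreement over \<open>T1 \<inter> T2\<close>.\<close>

lemma sol_along_exists_Un:
  assumes k: "continuous_on (T1 \<union> T2) k" and T: "closed T1" "closed T2"
    and c: "connected (T1 \<inter> T2)" "T1 \<inter> T2 \<noteq> {}"
    and ex: "sol_along_exists k T1" "sol_along_exists k T2"
  shows "sol_along_exists k (T1 \<union> T2)"
proof -
  \<comment> \<open>Generalised over the two pieces, so that a base point in the second one is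
    covered by exchanging them.\<close>
  have *: "\<exists>g. sol_along k (T1 \<union> T2) g \<and> g t = v"
    if k: "continuous_on (T1 \<union> T2) k" and T: "closed T1" "closed T2"
      and c: "connected (T1 \<inter> T2)" "T1 \<inter> T2 \<noteq> {}"
      and ex: "sol_along_exists k T1" "sol_along_exists k T2" and t: "t \<in> T1" for T1 T2 t v
  proof -
    obtain g1 where g1: "sol_along k T1 g1" "g1 t = v"
      using ex(1) t unfolding sol_along_exists_def by blast
    obtain s where s: "s \<in> T1 \<inter> T2" using c by blast
    obtain g2 where g2: "sol_along k T2 g2" "g2 s = g1 s"
      using ex(2) s unfolding sol_along_exists_def by blast
    have sub: "sol_along k (T1 \<inter> T2) g1" "sol_along k (T1 \<inter> T2) g2"
      using sol_along_compose[OF g1(1), of "T1 \<inter> T2" id] sol_along_compose[OF g2(1), of "T1 \<inter> T2" id]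
      by auto
    have eq: "g1 r = g2 r" if "r \<in> T1" "r \<in> T2" for r
      by (rule sol_along_unique[OF continuous_on_subset[OF k] c(1) sub s g2(2)[symmetric]])
        (use that in auto)
    define g where "g = (\<lambda>t. if t \<in> T1 then g1 t else g2 t)"
    have "sol_along k T1 g" by (rule sol_along_cong[OF g1(1)]) (auto simp: g_def)
    moreover have "sol_along k T2 g" by (rule sol_along_cong[OF g2(1)]) (auto simp: g_def eq)
    ultimately show ?thesis using sol_along_Un[OF k T] t g1(2) g_def by metis
  qed
  show ?thesis
    unfolding sol_along_exists_def
    using *[OF k T c ex] *[of T2 T1] assms by (metis Un_commute Int_commute UnE)
qed

lemma sol_along_exists_small:
  assumes "k ` T \<subseteq> U" "solvable U"
  shows "sol_along_exists k T"
  unfolding sol_along_exists_def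
proof (intro ballI allI)
  fix t v assume "t \<in> T"
  then obtain u where "u (k t) = v" "\<forall>x\<in>U. sol u x"
    using solvable_exists[OF assms(2), of "k t" v] assms(1) by auto
  then show "\<exists>g. sol_along k T g \<and> g t = v"
    using assms solvable_open[OF assms(2)]
    unfolding sol_along_def
    by (intro exI[of _ "u \<circ> k"] conjI ballI exI[of _ U] exI[of _ u] exI[of _ UNIV]) auto
qed

text \<open>Bisection in each variable replaces a grid below the Lebesgue number. Adjacent
  rectangles share an edge, which is connected and non-empty, so existence passes to their
  union.\<close>

lemma sol_along_exists_square:
  fixes h :: "real \<times> real \<Rightarrow> 'a"
  assumes h: "continuous_on ({0..1} \<times> {0..1}) h"
  shows "sol_along_exists h ({0..1} \<times> {0..1})"
proof -
  have glue: "sol_along_exists h (A \<times> B \<union> C \<times> D)"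
    if "A \<times> B \<union> C \<times> D \<subseteq> {0..1} \<times> {0..1}" "closed A" "closed B" "closed C" "closed D"
      "connected (A \<inter> C)" "connected (B \<inter> D)" "A \<inter> C \<noteq> {}" "B \<inter> D \<noteq> {}"
      "sol_along_exists h (A \<times> B)" "sol_along_exists h (C \<times> D)" for A B C D
    by (rule sol_along_exists_Un[OF continuous_on_subset[OF h]])
      (use that in \<open>simp_all add: closed_Times Times_Int_Times connected_Times\<close>)
  \<comment> \<open>The premises inside \<open>P\<close> make it hold trivially outside the unit
    square, since bisection quantifies over all short intervals about a point.\<close>
  define P where "P a b p q \<longleftrightarrow> (0 \<le> p \<and> q \<le> 1 \<and> 0 \<le> a \<and> b \<le> 1 \<longrightarrow> sol_along_exists h ({p..q} \<times> {a..b}))"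
    for a b p q
  have "P 0 1 0 1"
  proof (rule Bolzano[where P = "\<lambda>a b. P a b 0 1"])
    show "(0::real) \<le> 1" by simp
    show "P a c 0 1" if P: "P a b 0 1" "P b c 0 1" and le: "a \<le> b" "b \<le> c" for a b c
    proof (unfold P_def, safe)
      assume 0: "0 \<le> a" "c \<le> 1"
      have "{0..1} \<times> {a..c} = {0..1::real} \<times> {a..b} \<union> {0..1} \<times> {b..c}"
        using ivl_disj_un_two_touch(4)[OF le] by blast
      moreover have "sol_along_exists h ({0..1} \<times> {a..b} \<union> {0..1} \<times> {b..c})"
        by (rule glue) (use 0 le P in \<open>auto simp: P_def\<close>)
      ultimately show "sol_along_exists h ({0..1} \<times> {a..c})" by simp
    qed
    fix y :: real assume y: "0 \<le> y" "y \<le> 1"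
    \<comment> \<open>At fixed height \<open>y\<close> a second bisection runs over the horizontal
      interval. The admissible height \<open>d\<close> of the strip depends on the interval; a union
      takes the smaller of two heights.\<close>
    show "\<exists>d>0. \<forall>a b. a \<le> y \<and> y \<le> b \<and> b - a < d \<longrightarrow> P a b 0 1"
    proof (rule Bolzano[where P = "\<lambda>p q. \<exists>d>0. \<forall>a b. a \<le> y \<and> y \<le> b \<and> b - a < d \<longrightarrow> P a b p q"])
      show "(0::real) \<le> 1" by simp
    next
      fix p q r :: real
      assume "\<exists>d>0. \<forall>a b. a \<le> y \<and> y \<le> b \<and> b - a < d \<longrightarrow> P a b p q"
        "\<exists>d>0. \<forall>a b. a \<le> y \<and> y \<le> b \<and> b - a < d \<longrightarrow> P a b q r"
        and le: "p \<le> q" "q \<le> r"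
      then obtain d1 d2 where d: "d1 > 0" "d2 > 0"
        "\<And>a b. a \<le> y \<Longrightarrow> y \<le> b \<Longrightarrow> b - a < d1 \<Longrightarrow> P a b p q"
        "\<And>a b. a \<le> y \<Longrightarrow> y \<le> b \<Longrightarrow> b - a < d2 \<Longrightarrow> P a b q r"
        by metis
      have "P a b p r" if ab: "a \<le> y" "y \<le> b" "b - a < min d1 d2" for a b
      proof (unfold P_def, safe)
        assume 0: "0 \<le> p" "r \<le> 1" "0 \<le> a" "b \<le> 1"
        have "{p..r} \<times> {a..b} = {p..q} \<times> {a..b} \<union> {q..r} \<times> {a..b}"
          using ivl_disj_un_two_touch(4)[OF le] by blast
        moreover have "P a b p q" "P a b q r" using d ab by auto
        then have "sol_along_exists h ({p..q} \<times> {a..b} \<union> {q..r} \<times> {a..b})"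
          by (intro glue) (use 0 le ab in \<open>auto simp: P_def\<close>)
        ultimately show "sol_along_exists h ({p..r} \<times> {a..b})" by simp
      qed
      then show "\<exists>d>0. \<forall>a b. a \<le> y \<and> y \<le> b \<and> b - a < d \<longrightarrow> P a b p r"
        using d(1,2) by (intro exI[of _ "min d1 d2"]) simp
    next
      fix x :: real assume x: "0 \<le> x" "x \<le> 1"
      obtain U where U: "h (x, y) \<in> U" "solvable U" using solvable_basis[of UNIV "h (x, y)"] by auto
      have "\<exists>B. open B \<and> (x, y) \<in> B \<and> (\<forall>t\<in>{0..1} \<times> {0..1}. t \<in> B \<longrightarrow> h t \<in> U)"
        using h[unfolded continuous_on_topological, rule_format, of "(x, y)" U] x y U
          solvable_open[OF U(2)] by auto
      then obtain e where e: "e > 0" "\<And>t. t \<in> {0..1} \<times> {0..1} \<Longrightarrow> dist t (x, y) < e \<Longrightarrow> h t \<in> U"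
        unfolding open_dist by metis
      \<comment> \<open>Sides shorter than \<open>e / 2\<close> keep the rectangle within distance
        \<open>e\<close> of \<open>(x, y)\<close>, hence its image in one solvable set.\<close>
      have "P a b p q"
        if "a \<le> y" "y \<le> b" "b - a < e / 2" "p \<le> x" "x \<le> q" "q - p < e / 2" for a b p q
        unfolding P_def
      proof (intro impI sol_along_exists_small[OF _ U(2)], safe)
        fix s t assume st: "s \<in> {p..q}" "t \<in> {a..b}" and 0: "0 \<le> p" "q \<le> 1" "0 \<le> a" "b \<le> 1"
        have "dist (s, t) (x, y) \<le> dist s x + dist t y"
          using sqrt_sum_squares_le_sum_abs[of "dist s x" "dist t y"] by (simp add: dist_prod_def)
        also have "\<dots> < e" using st that by (auto simp: dist_real_def)
        finally show "h (s, t) \<in> U" using e st 0 by auto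
      qed
      then show "\<exists>d>0. \<forall>p q. p \<le> x \<and> x \<le> q \<and> q - p < d \<longrightarrow>
        (\<exists>d>0. \<forall>a b. a \<le> y \<and> y \<le> b \<and> b - a < d \<longrightarrow> P a b p q)"
        using e(1) by (intro exI[of _ "e / 2"]) (auto intro!: exI[of _ "e / 2"])
    qed
  qed
  then show ?thesis by (simp add: P_def)
qed

lemma sol_along_path_exists:
  fixes \<gamma> :: "real \<Rightarrow> 'a"
  assumes "path \<gamma>"
  obtains g where "sol_along \<gamma> {0..1} g" "g 0 = v"
proof -
  \<comment> \<open>A path is regarded as a map on the square that ignores the second
    coordinate.\<close>
  have "continuous_on ({0..1} \<times> {0..1}) (\<gamma> \<circ> fst :: real \<times> real \<Rightarrow> 'a)"
    using assms unfolding path_def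
    by (intro continuous_on_compose continuous_intros) (auto intro: continuous_on_subset)
  then obtain g where g: "sol_along (\<gamma> \<circ> fst) ({0..1} \<times> {0..1}) g" "g (0, 0 :: real) = v"
    using sol_along_exists_square[of "\<gamma> \<circ> fst"] unfolding sol_along_exists_def by fastforce
  have "sol_along ((\<gamma> \<circ> fst) \<circ> (\<lambda>t. (t, 0 :: real))) {0..1} (g \<circ> (\<lambda>t. (t, 0)))"
    by (rule sol_along_compose[OF g(1), of "{0..1}" "\<lambda>t. (t, 0)"]) (auto intro!: continuous_intros)
  then show ?thesis using g(2) that[of "g \<circ> (\<lambda>t. (t, 0))"] by (simp add: o_def)
qed

text \<open>Along a constant map only one value of a local solution is seen, so constant functions
  are sections, and by uniqueness the only ones.\<close>

lemma sol_along_const: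
  assumes "sol_along (\<lambda>_. p) T g" "connected T" "s \<in> T" "t \<in> T"
  shows "g s = g t"
proof -
  obtain U where U: "p \<in> U" "solvable U" using solvable_basis[of UNIV p] by auto
  then obtain u where u: "u p = g s" "\<And>x. x \<in> U \<Longrightarrow> sol u x"
    using solvable_exists[OF U(2,1)] by metis
  have "sol_along (\<lambda>_. p) T (\<lambda>_. g s)"
    unfolding sol_along_def using U u solvable_open[OF U(2)]
    by (intro ballI exI[of _ U] exI[of _ u] exI[of _ UNIV]) auto
  from sol_along_unique[OF _ assms(2) this assms(1) assms(3) refl assms(4)] show ?thesis by auto
qed

text \<open>On the square of a free homotopy from \<gamma> to a constant loop, the edges
  \<open>h (t, 0)\<close> and \<open>h (t, 1)\<close> are the same path. At the constant end the
  section has equal values on both, and uniqueness along the common edge carries this equality back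
  to the ends of \<gamma>.\<close>

lemma sol_along_loop:
  assumes sc: "simply_connected (UNIV :: 'a set)"
    and \<gamma>: "path \<gamma>" "pathfinish \<gamma> = pathstart \<gamma>" and g: "sol_along \<gamma> {0..1} g"
  shows "g 0 = g 1"
proof -
  have "homotopic_loops UNIV \<gamma> (\<lambda>_. undefined)"
    using sc \<gamma> unfolding simply_connected_def by (auto simp: path_def pathstart_def pathfinish_def)
  then obtain h where h: "continuous_on ({0..1::real} \<times> {0..1}) h"
    "\<And>x. x \<in> {0..1} \<Longrightarrow> h (0, x) = \<gamma> x" "\<And>x. x \<in> {0..1} \<Longrightarrow> h (1, x) = undefined"
    "\<And>t. t \<in> {0..1} \<Longrightarrow> h (t, 1) = h (t, 0)"
    unfolding homotopic_loops by (auto simp: pathstart_def pathfinish_def)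
  obtain G where G: "sol_along h ({0..1} \<times> {0..1}) G" "G (0, 0) = g 0"
    using sol_along_exists_square[OF h(1)] unfolding sol_along_exists_def by fastforce
  have restr: "sol_along (\<lambda>t. h (j t)) {0..1} (\<lambda>t. G (j t))"
    if "continuous_on {0..1::real} j" "j ` {0..1} \<subseteq> {0..1} \<times> {0..1}" for j
    using sol_along_compose[OF G(1) that] by (simp add: o_def)
  have *: "sol_along \<gamma> {0..1} (\<lambda>t. G (0, t))"
    by (rule sol_along_cong[OF restr[of "\<lambda>t. (0, t)"]]) (auto intro!: continuous_intros simp: h)
  have "sol_along (\<lambda>_. undefined) {0..1} (\<lambda>t. G (1, t))"
    by (rule sol_along_cong[OF restr[of "\<lambda>t. (1, t)"]]) (auto intro!: continuous_intros simp: h)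
  then have end1: "G (1, 0) = G (1, 1)" by (rule sol_along_const) auto
  have bottom: "sol_along (\<lambda>t. h (t, 0)) {0..1} (\<lambda>t. G (t, 0))"
    by (rule restr) (auto intro!: continuous_intros)
  have top: "sol_along (\<lambda>t. h (t, 0)) {0..1} (\<lambda>t. G (t, 1))"
    by (rule sol_along_cong[OF restr[of "\<lambda>t. (t, 1)"]]) (auto intro!: continuous_intros simp: h)
  have cont: "continuous_on {0..1} (\<lambda>t. h (t, 0))"
    by (rule continuous_on_compose2[OF h(1)]) (auto intro!: continuous_intros)
  have "G (0, 0) = G (0, 1)"
    using sol_along_unique[OF cont _ bottom top _ end1, of 0] by auto
  moreover have "g t = G (0, t)" if "t \<in> {0..1}" for t
    using sol_along_unique[OF _ _ g *, of 0 t] \<gamma>(1) G(2) that by (auto simp: path_def)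
  ultimately show ?thesis by simp
qed

lemma sol_along_join:
  fixes \<gamma>1 \<gamma>2 :: "real \<Rightarrow> 'a"
  assumes \<gamma>: "path \<gamma>1" "path \<gamma>2" "\<gamma>1 1 = \<gamma>2 0"
    and g: "sol_along \<gamma>1 {0..1} g1" "sol_along \<gamma>2 {0..1} g2" "g1 1 = g2 0"
  shows "sol_along (\<gamma>1 +++ \<gamma>2) {0..1} (\<lambda>t. if t \<le> 1/2 then g1 (2 * t) else g2 (2 * t - 1))"
proof -
  have "sol_along (\<gamma>1 +++ \<gamma>2) {0..1/2} (\<lambda>t. if t \<le> 1/2 then g1 (2 * t) else g2 (2 * t - 1))"
    by (rule sol_along_cong[OF sol_along_compose[OF g(1), where j = "\<lambda>t. 2 * t"]])
      (auto intro!: continuous_intros simp: joinpaths_def)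
  moreover have "sol_along (\<gamma>1 +++ \<gamma>2) {1/2..1} (\<lambda>t. if t \<le> 1/2 then g1 (2 * t) else g2 (2 * t - 1))"
  proof (rule sol_along_cong[OF sol_along_compose[OF g(2), where j = "\<lambda>t. 2 * t - 1"]])
    fix t :: real assume "t \<in> {1/2..1}"
    \<comment> \<open>At \<open>t = 1/2\<close> the conditional takes the first branch, whose value
      there is \<open>g1 1 = g2 0\<close>.\<close>
    then have "2 * t = 1 \<and> 2 * t - 1 = 0 \<and> t \<le> 1/2 \<or> \<not> t \<le> 1/2" by auto
    then show "(\<gamma>2 \<circ> (\<lambda>t. 2 * t - 1)) t = (\<gamma>1 +++ \<gamma>2) t"
      "(g2 \<circ> (\<lambda>t. 2 * t - 1)) t = (if t \<le> 1/2 then g1 (2 * t) else g2 (2 * t - 1))"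
      using \<gamma>(3) g(3) by (elim disjE conjE; simp only: joinpaths_def o_def if_True if_False)+
  qed (auto intro!: continuous_intros)
  moreover have "continuous_on ({0..1/2} \<union> {1/2..1}) (\<gamma>1 +++ \<gamma>2)"
    unfolding split_01[symmetric]
    using \<gamma> by (auto simp: path_def[symmetric] pathstart_def pathfinish_def)
  ultimately have "sol_along (\<gamma>1 +++ \<gamma>2) ({0..1/2} \<union> {1/2..1}) (\<lambda>t. if t \<le> 1/2 then g1 (2 * t) else g2 (2 * t - 1))"
    by (intro sol_along_Un) auto
  then show ?thesis by (simp only: split_01[symmetric])
qed

text \<open>Analytic continuation: the value at \<open>p\<close> is the end value of the section
  along any path from \<open>p0\<close>, and independence of the path is triviality around
  loops.\<close>

theorem global_solution:
  assumes sc: "simply_connected (UNIV :: 'a set)"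
  obtains F where "F p0 = v0" "\<And>p. sol F p"
proof -
  define R where "R p v \<longleftrightarrow> (\<exists>\<gamma> g. path \<gamma> \<and> \<gamma> 0 = p0 \<and> \<gamma> 1 = p \<and> sol_along \<gamma> {0..1} g \<and>
    g 0 = v0 \<and> g 1 = v)" for p v
  have ex: "\<exists>v. R p v" for p
  proof -
    \<comment> \<open>Simple connectivity relates any two loops, in particular the constant ones at
      \<open>p0\<close> and \<open>p\<close>; the track of their base point under the homotopy joins
      \<open>p0\<close> to \<open>p\<close>.\<close>
    have "homotopic_loops UNIV (\<lambda>_::real. p0) (\<lambda>_. p)"
      using sc unfolding simply_connected_def by (auto simp: path_def pathstart_def pathfinish_def)
    then obtain h where h: "continuous_on ({0..1::real} \<times> {0..1::real}) h" "h (0, 0) = p0" "h (1, 0) = p"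
      unfolding homotopic_loops by auto
    have "path (\<lambda>t. h (t, 0))"
      unfolding path_def by (rule continuous_on_compose2[OF h(1)]) (auto intro!: continuous_intros)
    moreover from this obtain g where "sol_along (\<lambda>t. h (t, 0)) {0..1} g" "g 0 = v0"
      by (rule sol_along_path_exists)
    ultimately show ?thesis using h unfolding R_def by blast
  qed
  have uniq: "v = w" if Rv: "R p v" and Rw: "R p w" for p v w
  proof -
    obtain \<gamma>1 g1 where 1: "path \<gamma>1" "\<gamma>1 0 = p0" "\<gamma>1 1 = p" "sol_along \<gamma>1 {0..1} g1" "g1 0 = v0" "g1 1 = v"
      using Rv unfolding R_def by blast
    obtain \<gamma>2 g2 where 2: "path \<gamma>2" "\<gamma>2 0 = p0" "\<gamma>2 1 = p" "sol_along \<gamma>2 {0..1} g2" "g2 0 = v0" "g2 1 = w"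
      using Rw unfolding R_def by blast
    \<comment> \<open>Backwards along \<open>\<gamma>1\<close> and then along
      \<open>\<gamma>2\<close> is a loop at \<open>p\<close> whose section starts at
      \<open>v\<close> and ends at \<open>w\<close>.\<close>
    have "sol_along (reversepath \<gamma>1) {0..1} (\<lambda>t. g1 (1 - t))"
      by (rule sol_along_cong[OF sol_along_compose[OF 1(4), where j = "\<lambda>t. 1 - t"]])
        (auto intro!: continuous_intros simp: reversepath_def)
    moreover have "path (reversepath \<gamma>1)" using 1 by simp
    moreover have r: "reversepath \<gamma>1 0 = p" "reversepath \<gamma>1 1 = p0"
      using 1 by (simp_all add: reversepath_def)
    ultimately have "sol_along (reversepath \<gamma>1 +++ \<gamma>2) {0..1}
        (\<lambda>t. if t \<le> 1/2 then (\<lambda>t. g1 (1 - t)) (2 * t) else g2 (2 * t - 1))"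
      using 1 2 by (intro sol_along_join) simp_all
    moreover have "path (reversepath \<gamma>1 +++ \<gamma>2)"
      using 1 2 r by (intro path_join_imp) (simp_all add: pathstart_def pathfinish_def)
    moreover have "pathfinish (reversepath \<gamma>1 +++ \<gamma>2) = pathstart (reversepath \<gamma>1 +++ \<gamma>2)"
      using 1 2 by (simp add: pathstart_def pathfinish_def joinpaths_def reversepath_def)
    ultimately show "v = w"
      using 1(6) 2(6) by (auto dest: sol_along_loop[OF sc, rotated 2])
  qed
  define F where "F p = (THE v. R p v)" for p
  have F: "R p v \<longleftrightarrow> v = F p" for p v
    unfolding F_def using ex uniq by (metis the_equality)
  have "R p0 v0"
  proof -
    obtain g where "sol_along (\<lambda>_::real. p0) {0..1} g" "g 0 = v0"
      by (rule sol_along_path_exists[of "\<lambda>_. p0" v0]) (auto simp: path_def)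
    with sol_along_const[OF this(1), of 0 1] show ?thesis
      unfolding R_def by (intro exI[of _ "\<lambda>_. p0"] exI[of _ g]) (auto simp: path_def)
  qed
  then have "F p0 = v0" using F by metis
  moreover have "sol F p" for p
  proof -
    obtain U where U: "p \<in> U" "solvable U" using solvable_basis[of UNIV p] by auto
    obtain u where u: "u p = F p" "\<And>x. x \<in> U \<Longrightarrow> sol u x"
      using solvable_exists[OF U(2,1), of "F p"] by metis
    \<comment> \<open>A path to \<open>p\<close> prolonged inside \<open>U\<close> is continued by
      \<open>u\<close>, so \<open>u\<close> gives the end value at every \<open>q\<close> of
      \<open>U\<close>.\<close>
    have "u q = F q" if q: "q \<in> U" for q
    proof -
      obtain \<gamma> g where 1: "path \<gamma>" "\<gamma> 0 = p0" "\<gamma> 1 = p" "sol_along \<gamma> {0..1} g" "g 0 = v0" "g 1 = F p"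
        using F[of p "F p"] unfolding R_def by blast
      obtain c where c: "path c" "path_image c \<subseteq> U" "c 0 = p" "c 1 = q"
        using solvable_path_connected[OF U(2)] U(1) q
        unfolding path_connected_def pathstart_def pathfinish_def by metis
      have "sol_along c {0..1} (\<lambda>t. u (c t))"
        unfolding sol_along_def using c(2) u(2) solvable_open[OF U(2)]
        by (intro ballI exI[of _ U] exI[of _ u] exI[of _ UNIV]) (auto simp: path_image_def)
      then have "sol_along (\<gamma> +++ c) {0..1} (\<lambda>t. if t \<le> 1/2 then g (2 * t) else (\<lambda>t. u (c t)) (2 * t - 1))"
        using 1 c u by (intro sol_along_join) simp_all
      moreover have "path (\<gamma> +++ c)" using 1 c by (simp add: pathstart_def pathfinish_def)
      ultimately have "R q (u q)" unfolding R_def using 1 c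
        by (intro exI[of _ "\<gamma> +++ c"] exI[of _ "\<lambda>t. if t \<le> 1/2 then g (2 * t) else (\<lambda>t. u (c t)) (2 * t - 1)"]) (auto simp: joinpaths_def)
      then show ?thesis using F by metis
    qed
    then show ?thesis
      using sol_cong[OF solvable_open[OF U(2)] U(1), of u F] u(2) U(1) by auto
  qed
  ultimately show ?thesis using that by blast
qed

end

section \<open>Local solutions of flat linear systems\<close>

text \<open>Takes the place of a Gronwall estimate: a bound that can always be improved to its half
  tends to zero.\<close>

lemma halving_imp_zero:
  fixes D :: "'a \<Rightarrow> 'b::real_normed_vector"
  assumes bound: "\<And>w. w \<in> S \<Longrightarrow> norm (D w) \<le> B"
    and half: "\<And>B. (\<And>w. w \<in> S \<Longrightarrow> norm (D w) \<le> B) \<Longrightarrow> (\<And>w. w \<in> S \<Longrightarrow> norm (D w) \<le> B / 2)"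
    and w: "w \<in> S"
  shows "D w = 0"
proof -
  have "norm (D w) \<le> B * (1 / 2) ^ n" if "w \<in> S" for n w
    using that
  proof (induction n arbitrary: w)
    case (Suc n)
    then show ?case using half[of "B * (1 / 2) ^ n" w] by simp
  qed (use bound in simp)
  moreover have "(\<lambda>n. B * (1 / 2) ^ n) \<longlonglongrightarrow> B * 0"
    by (intro tendsto_mult_left LIMSEQ_power_zero) simp
  ultimately have "norm (D w) \<le> B * 0"
    using w by (intro LIMSEQ_le_const) auto
  then show ?thesis by simp
qed

lemma vector_derivative_bound:
  fixes f :: "real \<Rightarrow> 'a::real_normed_vector"
  assumes "convex S" "\<And>x. x \<in> S \<Longrightarrow> (f has_vector_derivative f' x) (at x)"
    "\<And>x. x \<in> S \<Longrightarrow> norm (f' x) \<le> B" "x \<in> S" "y \<in> S"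
  shows "norm (f x - f y) \<le> B * \<bar>x - y\<bar>"
proof -
  have "norm (f x - f y) \<le> B * norm (x - y)"
  proof (rule differentiable_bound[OF assms(1) _ _ assms(4,5)])
    fix x assume x: "x \<in> S"
    show "(f has_derivative (\<lambda>h. h *\<^sub>R f' x)) (at x within S)"
      using assms(2)[OF x] by (auto simp: has_vector_derivative_def intro: has_derivative_at_withinI)
    show "onorm (\<lambda>h. h *\<^sub>R f' x) \<le> B"
      using assms(3)[OF x] by (intro onorm_le) (simp add: mult_right_mono mult.commute[of "\<bar>_\<bar>"])
  qed
  then show ?thesis by simp
qed

text \<open>The primitive vanishing at \<open>0\<close>, with the variable limit moved into the integrand so that
  both signs of \<open>y\<close> and dependence on parameters are covered.\<close>

definition prim :: "(real \<Rightarrow> 'a::banach) \<Rightarrow> real \<Rightarrow> 'a" where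
  "prim g y = y *\<^sub>R integral {0..1} (\<lambda>t. g (t * y))"

lemma prim_eq:
  assumes S: "convex S" "0 \<in> S" "y \<in> S" and G: "\<And>x. x \<in> S \<Longrightarrow> (G has_vector_derivative g x) (at x)"
  shows "prim g y = G y - G 0"
proof -
  have "((\<lambda>t. G (t * y)) has_vector_derivative y *\<^sub>R g (t * y)) (at t within {0..1})"
    if t: "t \<in> {0..1}" for t
  proof -
    have "t * y \<in> S" using convexD_alt[OF S(1,2,3), of t] t by simp
    from has_vector_derivative_at_within[OF G[OF this]]
    have "(G has_vector_derivative g (t * y)) (at (t * y) within (\<lambda>t. t * y) ` {0..1})" .
    moreover have "((\<lambda>t. t * y) has_vector_derivative y) (at t within {0..1})"
      unfolding has_real_derivative_iff_has_vector_derivative[symmetric]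
      by (auto intro!: derivative_eq_intros)
    ultimately show ?thesis using vector_diff_chain_within unfolding o_def by blast
  qed
  then have *: "((\<lambda>t. y *\<^sub>R g (t * y)) has_integral (G (1 * y) - G (0 * y))) {0..1}"
    by (intro fundamental_theorem_of_calculus) auto
  show ?thesis
    using integral_unique[OF *] by (simp add: prim_def)
qed

lemma prim_has_vector_derivative:
  assumes g: "continuous_on UNIV g"
  shows "(prim g has_vector_derivative g y) (at y)"
proof -
  \<comment> \<open>The interval has 0 and \<open>y\<close> in its interior, and the choice of its
    left end cancels in \<open>G z - G 0\<close>.\<close>
  define N where "N = \<bar>y\<bar> + 1"
  define G where "G z = integral {-N..z} g" for z
  have G: "(G has_vector_derivative g z) (at z)" if "z \<in> {-N<..<N}" for z
  proof -
    have "(G has_vector_derivative g z) (at z within {-N..N})"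
      unfolding G_def using that by (intro integral_has_vector_derivative continuous_on_subset[OF g]) auto
    then show ?thesis using that by (simp add: at_within_Icc_at)
  qed
  have y: "y \<in> {-N<..<N}" by (auto simp: N_def)
  have "prim g z = G z - G 0" if "z \<in> {-N<..<N}" for z
    by (rule prim_eq[OF _ _ that G]) (auto simp: N_def)
  moreover have "((\<lambda>z. G z - G 0) has_vector_derivative g y) (at y)"
    using has_vector_derivative_diff[OF G[OF y] has_vector_derivative_const[of "G 0"]] by simp
  ultimately show ?thesis
    using has_vector_derivative_transform_within_open[OF _ open_greaterThanLessThan y, of "\<lambda>z. G z - G 0" "g y" "prim g"]
    by simp
qed

lemma continuous_on_scaled_segment:
  fixes y :: real
  assumes "\<bar>y\<bar> < r" "continuous_on {-r<..<r} g"
  shows "continuous_on {0..1} (\<lambda>t. g (t * y))" "t \<in> {0..1} \<Longrightarrow> \<bar>t * y\<bar> < r"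
proof -
  show t: "\<bar>t * y\<bar> < r" if "t \<in> {0..1}" for t
    using that assms(1) mult_left_le_one_le[of "\<bar>y\<bar>" t] by (auto simp: abs_mult)
  have "(\<lambda>t. t * y) ` {0..1} \<subseteq> {-r<..<r}"
  proof (rule image_subsetI)
    fix t :: real assume "t \<in> {0..1}"
    from t[OF this] show "t * y \<in> {-r<..<r}" by auto
  qed
  then show "continuous_on {0..1} (\<lambda>t. g (t * y))"
    by (intro continuous_on_compose2[OF assms(2)] continuous_intros)
qed

lemma prim_bound:
  assumes y: "\<bar>y\<bar> < r" and g: "continuous_on {-r<..<r} g" "\<And>t. \<bar>t\<bar> < r \<Longrightarrow> norm (g t) \<le> B"
  shows "norm (prim g y) \<le> \<bar>y\<bar> * B"
proof -
  note c = continuous_on_scaled_segment[OF y g(1)]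
  have "norm (integral {0..1} (\<lambda>t. g (t * y))) \<le> B * (1 - 0)"
    using c g(2) by (intro integral_bound) auto
  then show ?thesis by (simp add: prim_def mult_left_mono)
qed

lemma prim_diff:
  assumes y: "\<bar>y\<bar> < r" and f: "continuous_on {-r<..<r} f" and g: "continuous_on {-r<..<r} g"
  shows "prim (\<lambda>t. f t - g t) y = prim f y - prim g y"
  unfolding prim_def
  using integral_diff[OF integrable_continuous_real integrable_continuous_real,
      OF continuous_on_scaled_segment(1)[OF y f] continuous_on_scaled_segment(1)[OF y g]]
  by (simp add: scaleR_diff_right)

lemma prim_0 [simp]: "prim g 0 = 0"
  unfolding prim_def by (rule scaleR_zero_left)

lemma prim_cong:
  assumes "\<bar>y\<bar> < r" "\<And>t. \<bar>t\<bar> < r \<Longrightarrow> f t = g t"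
  shows "prim f y = prim g y"
proof -
  have "f (t * y) = g (t * y)" if "t \<in> {0..1}" for t
    using assms continuous_on_scaled_segment(2)[OF assms(1) continuous_on_const that] by blast
  then have "integral {0..1} (\<lambda>t. f (t * y)) = integral {0..1} (\<lambda>t. g (t * y))"
    by (rule integral_cong)
  then show ?thesis unfolding prim_def by (rule arg_cong)
qed

text \<open>In \<open>prim\<close> the limits of integration are fixed, so this is the Leibniz rule
  under the integral sign.\<close>

lemma prim_has_vector_derivative_param:
  assumes x: "\<bar>x\<bar> < r" and y: "\<bar>y\<bar> < r"
    and d: "\<And>s y. \<bar>s\<bar> < r \<Longrightarrow> \<bar>y\<bar> < r \<Longrightarrow> ((\<lambda>y. f s y) has_vector_derivative f' s y) (at y)"
    and f: "\<And>y. \<bar>y\<bar> < r \<Longrightarrow> continuous_on {-r<..<r} (\<lambda>s. f s y)"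
    and f': "continuous_on ({-r<..<r} \<times> {-r<..<r}) (\<lambda>(s, y). f' s y)"
  shows "((\<lambda>y. prim (\<lambda>s. f s y) x) has_vector_derivative prim (\<lambda>s. f' s y) x) (at y)"
proof -
  let ?S = "{-r<..<r}"
  have sx: "\<bar>s * x\<bar> < r" if "s \<in> {0..1}" for s
    using continuous_on_scaled_segment(2)[OF x continuous_on_const that] .
  have "((\<lambda>y. integral (cbox 0 1) (\<lambda>s. f (s * x) y)) has_vector_derivative
      integral (cbox 0 1) (\<lambda>s. f' (s * x) y)) (at y within ?S)"
  proof (rule leibniz_rule_vector_derivative)
    show "((\<lambda>y. f (s * x) y) has_vector_derivative f' (s * x) y) (at y within ?S)"
      if "y \<in> ?S" "s \<in> cbox 0 1" for y s
    proof -
      have "\<bar>s * x\<bar> < r" "\<bar>y\<bar> < r" using that sx[of s] by auto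
      then show ?thesis by (rule has_vector_derivative_at_within[OF d])
    qed
    show "(\<lambda>s. f (s * x) y) integrable_on cbox 0 1" if "y \<in> ?S" for y
    proof -
      have "\<bar>y\<bar> < r" using that by auto
      from integrable_continuous_real[OF continuous_on_scaled_segment(1)[OF x f[OF this]]]
      show ?thesis by simp
    qed
    show "continuous_on (?S \<times> cbox 0 1) (\<lambda>(y, s). f' (s * x) y)"
      unfolding case_prod_beta
    proof (rule continuous_on_compose2[OF f'[unfolded case_prod_beta], of _ "\<lambda>z. (snd z * x, fst z)",
          unfolded fst_conv snd_conv])
      show "(\<lambda>z. (snd z * x, fst z)) ` (?S \<times> cbox 0 1) \<subseteq> ?S \<times> ?S"
      proof (rule image_subsetI)
        fix z assume "z \<in> ?S \<times> cbox 0 (1::real)"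
        then have "fst z \<in> ?S" "\<bar>snd z * x\<bar> < r" using sx[of "snd z"] by auto
        then show "(snd z * x, fst z) \<in> ?S \<times> ?S" by auto
      qed
    qed (intro continuous_intros)
  qed (use y in auto)
  moreover have "at y within ?S = at y" using y by (intro at_within_open) auto
  ultimately have "((\<lambda>y. integral {0..1} (\<lambda>s. f (s * x) y)) has_vector_derivative
      integral {0..1} (\<lambda>s. f' (s * x) y)) (at y)"
    by (simp only: box_real)
  from has_vector_derivative_scaleR[OF DERIV_const this, of x] show ?thesis
    by (simp add: prim_def)
qed

lemma continuous_on_prim:
  fixes g :: "'a::topological_space \<Rightarrow> real \<Rightarrow> 'b::banach"
  assumes g: "continuous_on UNIV (\<lambda>(x, t). g x t)" and y: "continuous_on UNIV y"
  shows "continuous_on UNIV (\<lambda>x. prim (g x) (y x))"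
  unfolding prim_def
proof (intro continuous_intros y)
  have "continuous_on (UNIV \<times> cbox 0 1) (\<lambda>(x, t). g x (t * y x))"
    unfolding case_prod_beta
    by (rule continuous_on_compose2[OF g[unfolded case_prod_beta], of _ "\<lambda>z. (fst z, snd z * y (fst z))", simplified])
      (auto intro!: continuous_intros continuous_on_compose2[OF y])
  from integral_continuous_on_param[OF this]
  show "continuous_on UNIV (\<lambda>x. integral {0..1} (\<lambda>t. g x (t * y x)))" by simp
qed

text \<open>Continuity of \<open>q\<close> controls vertical increments on all nearby lines, so an
  \<open>x\<close>-derivative at the single point \<open>w\<close> is enough for total
  differentiability.\<close>

lemma has_derivative_complex_partials:
  fixes u :: "complex \<Rightarrow> 'b::real_normed_vector"
  assumes w: "\<bar>Re w\<bar> < r" "\<bar>Im w\<bar> < r"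
    and p: "((\<lambda>x. u (Complex x (Im w))) has_vector_derivative p) (at (Re w))"
    and q: "\<And>x y. \<bar>x\<bar> < r \<Longrightarrow> \<bar>y\<bar> < r \<Longrightarrow>
      ((\<lambda>y. u (Complex x y)) has_vector_derivative q (Complex x y)) (at y)"
    and cont: "continuous_on {w. \<bar>Re w\<bar> < r \<and> \<bar>Im w\<bar> < r} q"
  shows "(u has_derivative (\<lambda>h. Re h *\<^sub>R p + Im h *\<^sub>R q w)) (at w)"
proof -
  let ?I = "{-r<..<r}"
  have in_I: "x \<in> ?I \<longleftrightarrow> \<bar>x\<bar> < r" for x by auto
  have "((\<lambda>(x, y). u (Complex x y)) has_derivative
      (\<lambda>(tx, ty). tx *\<^sub>R p + blinfun_apply (blinfun_scaleR_left (q (Complex (Re w) (Im w)))) ty))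
      (at (Re w, Im w) within ?I \<times> ?I)"
  proof (rule has_derivative_partialsI)
    show "((\<lambda>x. u (Complex x (Im w))) has_derivative (\<lambda>tx. tx *\<^sub>R p)) (at (Re w) within ?I)"
      using p by (simp add: has_vector_derivative_def has_derivative_at_withinI)
    show "((\<lambda>y. u (Complex x y)) has_derivative blinfun_apply (blinfun_scaleR_left (q (Complex x y))))
        (at y within ?I)" if "x \<in> ?I" "y \<in> ?I" for x y
      using q[of x y] that unfolding in_I
      by (simp add: has_vector_derivative_def has_derivative_at_withinI)
    have "continuous_on (?I \<times> ?I) (\<lambda>(x, y). blinfun_scaleR_left (q (Complex x y)))"
      unfolding case_prod_beta
      by (intro continuous_intros continuous_on_compose2[OF cont]) (auto simp: in_I simp del: greaterThanLessThan_iff)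
    then show "continuous (at (Re w, Im w) within ?I \<times> ?I) (\<lambda>(x, y). blinfun_scaleR_left (q (Complex x y)))"
      using w unfolding continuous_on_eq_continuous_within by (simp add: in_I del: greaterThanLessThan_iff)
  qed (use w in \<open>simp_all only: in_I convex_real_interval\<close>)
  moreover have "at (Re w, Im w) within ?I \<times> ?I = at (Re w, Im w)"
    using w by (intro at_within_open) (simp_all add: in_I open_Times del: greaterThanLessThan_iff)
  ultimately have *: "((\<lambda>(x, y). u (Complex x y)) has_derivative (\<lambda>(tx, ty). tx *\<^sub>R p + ty *\<^sub>R q w))
      (at (Re w, Im w))"
    by simp
  have "((\<lambda>w. (Re w, Im w)) has_derivative (\<lambda>h. (Re h, Im h))) (at w)"
    by (intro bounded_linear_imp_has_derivative bounded_linear_Pair bounded_linear_Re bounded_linear_Im)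
  from has_derivative_compose[OF this *] show ?thesis by simp
qed

text \<open>\<open>flat\<close> is zero curvature: it expresses
  \<open>u\<^sub>x\<^sub>y = u\<^sub>y\<^sub>x\<close> with the first derivatives replaced by the
  system, so only \<open>\<alpha>y\<close> and \<open>\<beta>x\<close> occur. \<open>small\<close>
  makes each iteration contract by 1/2: two integrals over length at most \<open>r\<close>
  contribute the factor \<open>2 * r * K * M\<close>.\<close>

locale flat_square =
  fixes prd :: "'e::banach \<Rightarrow> 'f::real_normed_vector \<Rightarrow> 'e" (infixl "\<star>" 70)
    and \<alpha> \<beta> \<alpha>y \<beta>x :: "complex \<Rightarrow> 'f" and r K M :: real
  assumes bilinear: "bounded_bilinear prd"
    and r: "0 < r" "r \<le> 1" and K: "0 < K" "\<And>u a. norm (u \<star> a) \<le> K * norm u * norm a"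
    and M: "0 \<le> M" and small: "4 * r * K * M \<le> 1"
    and cont: "continuous_on {w. \<bar>Re w\<bar> \<le> r \<and> \<bar>Im w\<bar> \<le> r} \<alpha>"
      "continuous_on {w. \<bar>Re w\<bar> \<le> r \<and> \<bar>Im w\<bar> \<le> r} \<beta>"
    and cont': "continuous_on {w. \<bar>Re w\<bar> < r \<and> \<bar>Im w\<bar> < r} \<alpha>y"
      "continuous_on {w. \<bar>Re w\<bar> < r \<and> \<bar>Im w\<bar> < r} \<beta>x"
    and d\<alpha>: "\<And>x y. \<bar>x\<bar> < r \<Longrightarrow> \<bar>y\<bar> < r \<Longrightarrow>
      ((\<lambda>y. \<alpha> (Complex x y)) has_vector_derivative \<alpha>y (Complex x y)) (at y)"
    and d\<beta>: "\<And>x y. \<bar>x\<bar> < r \<Longrightarrow> \<bar>y\<bar> < r \<Longrightarrow>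
      ((\<lambda>x. \<beta> (Complex x y)) has_vector_derivative \<beta>x (Complex x y)) (at x)"
    and flat: "\<And>u w. \<bar>Re w\<bar> < r \<Longrightarrow> \<bar>Im w\<bar> < r \<Longrightarrow>
      u \<star> \<alpha>y w + u \<star> \<beta> w \<star> \<alpha> w = u \<star> \<beta>x w + u \<star> \<alpha> w \<star> \<beta> w"
    and bound: "\<And>w. \<bar>Re w\<bar> \<le> r \<Longrightarrow> \<bar>Im w\<bar> \<le> r \<Longrightarrow> norm (\<alpha> w) \<le> M"
      "\<And>w. \<bar>Re w\<bar> \<le> r \<Longrightarrow> \<bar>Im w\<bar> \<le> r \<Longrightarrow> norm (\<beta> w) \<le> M"
      "\<And>w. \<bar>Re w\<bar> < r \<Longrightarrow> \<bar>Im w\<bar> < r \<Longrightarrow> norm (\<beta>x w) \<le> M"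
begin

sublocale bounded_bilinear prd by (rule bilinear)

lemma prd_bound: "norm u \<le> B \<Longrightarrow> norm a \<le> C \<Longrightarrow> norm (u \<star> a) \<le> K * B * C"
  by (rule order_trans[OF K(2)], intro mult_mono) (use K(1) order_trans[OF norm_ge_zero, of u B] in auto)

text \<open>Clamping the coordinates extends the coefficients continuously and with the same bound
  to the whole plane, so the iteration can run in the complete space of bounded continuous functions
  on \<open>complex\<close>.\<close>

definition clip :: "real \<Rightarrow> real" where "clip x = max (- r) (min r x)"
definition \<alpha>c :: "complex \<Rightarrow> 'f" where "\<alpha>c w = \<alpha> (Complex (clip (Re w)) (clip (Im w)))"
definition \<beta>c :: "complex \<Rightarrow> 'f" where "\<beta>c w = \<beta> (Complex (clip (Re w)) (clip (Im w)))"

lemma clip_bound: "\<bar>clip x\<bar> \<le> r" using r by (auto simp: clip_def)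
lemma clip_id: "\<bar>x\<bar> \<le> r \<Longrightarrow> clip x = x" by (auto simp: clip_def)
lemma continuous_on_clip [continuous_intros]: "continuous_on S g \<Longrightarrow> continuous_on S (\<lambda>x. clip (g x))"
  unfolding clip_def by (intro continuous_intros)

lemma \<alpha>c_eq: "\<bar>Re w\<bar> \<le> r \<Longrightarrow> \<bar>Im w\<bar> \<le> r \<Longrightarrow> \<alpha>c w = \<alpha> w" by (simp add: \<alpha>c_def clip_id)
lemma \<beta>c_eq: "\<bar>Re w\<bar> \<le> r \<Longrightarrow> \<bar>Im w\<bar> \<le> r \<Longrightarrow> \<beta>c w = \<beta> w" by (simp add: \<beta>c_def clip_id)
lemma \<alpha>c_bound: "norm (\<alpha>c w) \<le> M" unfolding \<alpha>c_def by (intro bound) (simp_all add: clip_bound)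
lemma \<beta>c_bound: "norm (\<beta>c w) \<le> M" unfolding \<beta>c_def by (intro bound) (simp_all add: clip_bound)

lemma continuous_on_ab: "continuous_on UNIV \<alpha>c" "continuous_on UNIV \<beta>c"
  unfolding \<alpha>c_def \<beta>c_def
  by (rule continuous_on_compose2[OF cont(1)] continuous_on_compose2[OF cont(2)];
      auto intro!: continuous_intros simp: clip_bound)+

text \<open>The system as a fixed point equation: integrate along the real axis, then vertically.\<close>

definition picard :: "(complex \<Rightarrow> 'e) \<Rightarrow> complex \<Rightarrow> 'e" where
  "picard u w = prim (\<lambda>s. u (Complex s 0) \<star> \<alpha>c (Complex s 0)) (clip (Re w)) +
     prim (\<lambda>t. u (Complex (clip (Re w)) t) \<star> \<beta>c (Complex (clip (Re w)) t)) (clip (Im w))"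

lemma continuous_on_prd_ab:
  assumes "continuous_on UNIV u"
  shows "continuous_on UNIV (\<lambda>w. u w \<star> \<alpha>c w)" "continuous_on UNIV (\<lambda>w. u w \<star> \<beta>c w)"
  using assms continuous_on_ab by (auto intro!: continuous_on)

lemma continuous_on_line:
  assumes "continuous_on UNIV (p :: complex \<Rightarrow> 'c::topological_space)"
  shows "continuous_on S (\<lambda>s. p (Complex s y))" "continuous_on S (\<lambda>t. p (Complex x t))"
  by (intro continuous_on_compose2[OF assms] continuous_intros; simp)+

lemma continuous_on_picard:
  assumes u: "continuous_on UNIV u" shows "continuous_on UNIV (picard u)"
proof -
  note c = continuous_on_prd_ab[OF u]
  have "continuous_on UNIV (\<lambda>w. prim (\<lambda>s. u (Complex s 0) \<star> \<alpha>c (Complex s 0)) (clip (Re w)))"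
    by (intro continuous_on_prim continuous_intros)
      (auto simp: case_prod_beta intro!: continuous_on_compose2[OF c(1)] continuous_intros)
  moreover have "continuous_on UNIV
      (\<lambda>w. prim (\<lambda>t. u (Complex (clip (Re w)) t) \<star> \<beta>c (Complex (clip (Re w)) t)) (clip (Im w)))"
    by (intro continuous_on_prim continuous_intros)
      (auto simp: case_prod_beta intro!: continuous_on_compose2[OF c(2)] continuous_intros)
  ultimately have "continuous_on UNIV (\<lambda>w. picard u w)"
    unfolding picard_def by (rule continuous_on_add)
  then show ?thesis by simp
qed

lemma prim_prd_bound:
  assumes "continuous_on UNIV c" "continuous_on UNIV d" "\<And>t. norm (c t) \<le> B" "\<And>t. norm (d t) \<le> M"
  shows "norm (prim (\<lambda>t. c t \<star> d t) (clip x)) \<le> r * (K * B * M)"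
proof -
  have B: "0 \<le> B" using assms(3) norm_ge_zero order_trans by blast
  have "norm (prim (\<lambda>t. c t \<star> d t) (clip x)) \<le> \<bar>clip x\<bar> * (K * B * M)"
  proof (rule prim_bound)
    show "\<bar>clip x\<bar> < \<bar>clip x\<bar> + 1" by simp
    show "continuous_on {- (\<bar>clip x\<bar> + 1)<..<\<bar>clip x\<bar> + 1} (\<lambda>t. c t \<star> d t)"
      using assms(1,2) by (auto intro!: continuous_on intro: continuous_on_subset)
  qed (intro prd_bound assms)
  also have "\<dots> \<le> r * (K * B * M)"
    using clip_bound B K M by (intro mult_right_mono) auto
  finally show ?thesis .
qed

lemma picard_bound:
  assumes u: "continuous_on UNIV u" and B: "\<And>w. norm (u w) \<le> B"
  shows "norm (picard u w) \<le> B / 2"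
proof -
  have B0: "0 \<le> B" using B norm_ge_zero order_trans by blast
  have "norm (picard u w) \<le> r * (K * B * M) + r * (K * B * M)"
    unfolding picard_def
    by (intro norm_triangle_le add_mono prim_prd_bound continuous_on_line u continuous_on_ab B \<alpha>c_bound \<beta>c_bound)
  also have "\<dots> = (4 * r * K * M) * B / 2" by simp
  also have "\<dots> \<le> 1 * B / 2" using small B0 by (intro divide_right_mono mult_right_mono) auto
  finally show ?thesis by simp
qed

lemma picard_diff:
  assumes u: "continuous_on UNIV u" "continuous_on UNIV u'"
  shows "picard u w - picard u' w = picard (\<lambda>w. u w - u' w) w"
proof -
  have *: "prim (\<lambda>t. (f t - g t)) y = prim f y - prim g y"
    if "continuous_on UNIV f" "continuous_on UNIV g" for f g :: "real \<Rightarrow> 'e" and y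
    by (rule prim_diff[of y "\<bar>y\<bar> + 1"]) (use that in \<open>auto intro: continuous_on_subset\<close>)
  show ?thesis
    unfolding picard_def diff_left
    by (simp add: * continuous_on_line continuous_on_prd_ab[OF u(1)] continuous_on_prd_ab[OF u(2)]
      continuous_on_line[where p = "\<lambda>w. u w \<star> \<alpha>c w" for u] continuous_on_line[where p = "\<lambda>w. u w \<star> \<beta>c w" for u])
qed

text \<open>Banach's fixed point theorem: \<open>picard\<close> respects differences, so
  \<open>picard_bound\<close> applied to a difference is the contraction estimate.\<close>

lemma picard_fixed_point: "\<exists>u. continuous_on UNIV u \<and> bounded (range u) \<and> (\<forall>w. u w = v + picard u w)"
proof -
  define T where "T u = Bcontfun (\<lambda>w. v + picard (apply_bcontfun u) w)" for u
  have T: "apply_bcontfun (T u) w = v + picard (apply_bcontfun u) w" for u w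
  proof -
    obtain B where B: "norm (apply_bcontfun u w) \<le> B" for w
      using bounded_apply_bcontfun[of u] unfolding bounded_iff by blast
    have "norm (v + picard (apply_bcontfun u) w) \<le> norm v + B / 2" for w
      using picard_bound[OF continuous_on_apply_bcontfun B] by (intro norm_triangle_le add_left_mono)
    then have "bounded (range (\<lambda>w. v + picard (apply_bcontfun u) w))"
      unfolding bounded_iff by blast
    then have "(\<lambda>w. v + picard (apply_bcontfun u) w) \<in> bcontfun"
      unfolding bcontfun_def by (auto intro!: continuous_intros continuous_on_picard[unfolded fun_eq_iff])
    then show ?thesis unfolding T_def by (simp add: Bcontfun_inverse)
  qed
  have "dist (T u) (T u') \<le> (1 / 2) * dist u u'" for u u'
  proof (rule dist_bound)
    fix w
    have "norm (picard (\<lambda>w. apply_bcontfun u w - apply_bcontfun u' w) w) \<le> dist u u' / 2"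
      by (rule picard_bound) (use dist_bounded[of u _ u'] in \<open>auto intro!: continuous_intros simp: dist_norm\<close>)
    then show "dist (apply_bcontfun (T u) w) (apply_bcontfun (T u') w) \<le> (1 / 2) * dist u u'"
      unfolding T dist_norm by (simp add: picard_diff)
  qed
  then obtain u where "T u = u"
    using banach_fix_type[of "1 / 2" T] by auto
  then show ?thesis
    using T[of u] by (intro exI[of _ "apply_bcontfun u"] conjI allI continuous_on_apply_bcontfun
      bounded_apply_bcontfun) simp_all
qed

text \<open>Only \<open>u\<^sub>y = u \<star> \<beta>\<close> is immediate. By flatness the integrated defect \<open>D\<close> of the equation
  \<open>u\<^sub>x = u \<star> \<alpha>\<close> satisfies \<open>D\<^sub>y = D \<star> \<beta> - \<integral> D \<star> \<beta>\<^sub>x dx\<close>, so it vanishes on a small square.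
  Differentiability of \<open>u\<close> with respect to \<open>x\<close> comes out as a consequence.\<close>

lemma solution_exists:
  obtains u where "u 0 = v" "\<And>w. \<bar>Re w\<bar> < r \<Longrightarrow> \<bar>Im w\<bar> < r \<Longrightarrow>
    (u has_derivative (\<lambda>h. Re h *\<^sub>R (u w \<star> \<alpha> w) + Im h *\<^sub>R (u w \<star> \<beta> w))) (at w)"
proof -
  obtain u where "continuous_on UNIV u" "bounded (range u)" "\<forall>w. u w = v + picard u w"
    using picard_fixed_point[of v] by blast
  then obtain N where u: "continuous_on UNIV u" "\<And>w. norm (u w) \<le> N" "\<And>w. u w = v + picard u w"
    unfolding bounded_iff by blast
  define p where "p w = u w \<star> \<alpha>c w" for w
  define q where "q w = u w \<star> \<beta>c w" for w
  have pq: "continuous_on UNIV p" "continuous_on UNIV q"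
    unfolding p_def q_def by (rule continuous_on_prd_ab[OF u(1)])+
  have eq: "u (Complex x y) = v + prim (\<lambda>s. p (Complex s 0)) x + prim (\<lambda>t. q (Complex x t)) y"
    if "\<bar>x\<bar> \<le> r" "\<bar>y\<bar> \<le> r" for x y
    using u(3)[of "Complex x y"] that by (simp add: picard_def p_def q_def clip_id)
  have u0: "u 0 = v" using eq[of 0 0] r by (simp add: zero_complex.code)
  define S where "S = {-r<..<r}"
  have S: "open S" "convex S" "0 \<in> S" "\<And>x. x \<in> S \<longleftrightarrow> \<bar>x\<bar> < r"
    using r by (auto simp: S_def)
  have uy: "((\<lambda>y. u (Complex x y)) has_vector_derivative q (Complex x y)) (at y)"
    if "\<bar>x\<bar> < r" "\<bar>y\<bar> < r" for x y
  proof (rule has_vector_derivative_transform_within_open[OF _ S(1)])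
    have "((\<lambda>y. (v + prim (\<lambda>s. p (Complex s 0)) x) + prim (\<lambda>t. q (Complex x t)) y)
        has_vector_derivative 0 + q (Complex x y)) (at y)"
      by (intro has_vector_derivative_add has_vector_derivative_const prim_has_vector_derivative
        continuous_on_line pq)
    then show "((\<lambda>y. v + prim (\<lambda>s. p (Complex s 0)) x + prim (\<lambda>t. q (Complex x t)) y)
        has_vector_derivative q (Complex x y)) (at y)" by simp
  qed (use that eq S(4) in auto)
  define p' where "p' w = u w \<star> \<alpha>y w + q w \<star> \<alpha> w" for w
  have p': "((\<lambda>y. p (Complex s y)) has_vector_derivative p' (Complex s y)) (at y)"
    if "\<bar>s\<bar> < r" "\<bar>y\<bar> < r" for s y
  proof (rule has_vector_derivative_transform_within_open[OF _ S(1)])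
    show "((\<lambda>y. u (Complex s y) \<star> \<alpha> (Complex s y)) has_vector_derivative p' (Complex s y)) (at y)"
      unfolding p'_def by (rule has_vector_derivative[OF uy[OF that] d\<alpha>[OF that]])
  qed (use that S(4) in \<open>auto simp: p_def \<alpha>c_eq\<close>)
  have interior: "{w. \<bar>Re w\<bar> < r \<and> \<bar>Im w\<bar> < r} \<subseteq> {w. \<bar>Re w\<bar> \<le> r \<and> \<bar>Im w\<bar> \<le> r}" by auto
  have cont_p': "continuous_on {w. \<bar>Re w\<bar> < r \<and> \<bar>Im w\<bar> < r} p'"
    unfolding p'_def
    by (intro continuous_intros continuous_on continuous_on_subset[OF u(1)] continuous_on_subset[OF pq(2)]
      cont' continuous_on_subset[OF cont(1) interior]) auto
  have cont_line: "continuous_on {-r<..<r} (\<lambda>s. c (Complex s y))"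
    if "continuous_on {w. \<bar>Re w\<bar> < r \<and> \<bar>Im w\<bar> < r} c" "\<bar>y\<bar> < r" for c :: "complex \<Rightarrow> 'c::topological_space" and y
    by (rule continuous_on_compose2[OF that(1)]) (use that(2) in \<open>auto intro!: continuous_intros\<close>)
  define D where "D x y = u (Complex x y) - u (Complex 0 y) - prim (\<lambda>s. p (Complex s y)) x" for x y
  define D' where "D' x y = D x y \<star> \<beta> (Complex x y) - prim (\<lambda>s. D s y \<star> \<beta>x (Complex s y)) x" for x y
  \<comment> \<open>\<open>u\<close> is not yet known to be differentiable in \<open>x\<close>, but
    \<open>W = u - D\<close> is, with derivative \<open>p\<close>. Differentiating
    \<open>W \<star> \<beta>\<close> in place of \<open>u \<star> \<beta>\<close> leaves a remainder
    that involves \<open>D\<close> only.\<close>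
  define W where "W x y = u (Complex 0 y) + prim (\<lambda>s. p (Complex s y)) x" for x y
  have cont_prim_p: "continuous_on UNIV (\<lambda>x. prim (\<lambda>s. p (Complex s y)) x)" for y
    by (rule continuous_on_vector_derivative, rule has_vector_derivative_at_within,
      rule prim_has_vector_derivative, rule continuous_on_line(1)[OF pq(1)])
  have cont_D: "continuous_on T (\<lambda>x. D x y)" and cont_W: "continuous_on T (\<lambda>x. W x y)" for y T
    unfolding D_def W_def
    by (intro continuous_intros continuous_on_line u(1) continuous_on_subset[OF cont_prim_p]; simp)+
  have D': "((\<lambda>y. D x y) has_vector_derivative D' x y) (at y)" if xy: "\<bar>x\<bar> < r" "\<bar>y\<bar> < r" for x y
  proof -
    have "((\<lambda>y. prim (\<lambda>s. p (Complex s y)) x) has_vector_derivative prim (\<lambda>s. p' (Complex s y)) x) (at y)"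
    proof (rule prim_has_vector_derivative_param[OF xy p'])
      show "continuous_on ({-r<..<r} \<times> {-r<..<r}) (\<lambda>(s, y). p' (Complex s y))"
        unfolding case_prod_beta
        by (rule continuous_on_compose2[OF cont_p']) (auto intro!: continuous_intros)
    qed (auto intro: continuous_on_line pq)
    then have 1: "((\<lambda>y. D x y) has_vector_derivative
        q (Complex x y) - q (Complex 0 y) - prim (\<lambda>s. p' (Complex s y)) x) (at y)"
      unfolding D_def using xy r by (intro has_vector_derivative_diff uy) auto
    define g where "g s = W s y \<star> \<beta>x (Complex s y) + p (Complex s y) \<star> \<beta> (Complex s y)" for s
    have e1: "prim g x = W x y \<star> \<beta> (Complex x y) - W 0 y \<star> \<beta> (Complex 0 y)"
    proof (rule prim_eq[OF S(2,3)])
      show "x \<in> S" using xy S by simp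
      fix s assume "s \<in> S"
      then have "\<bar>s\<bar> < r" by (simp add: S(4))
      moreover have "((\<lambda>x. W x y) has_vector_derivative 0 + p (Complex s y)) (at s)"
        unfolding W_def by (intro has_vector_derivative_add has_vector_derivative_const
          prim_has_vector_derivative continuous_on_line pq)
      ultimately show "((\<lambda>s. W s y \<star> \<beta> (Complex s y)) has_vector_derivative g s) (at s)"
        unfolding g_def using has_vector_derivative[OF _ d\<beta>[OF _ xy(2)]] by fastforce
    qed
    have e2: "W 0 y = u (Complex 0 y)" by (simp add: W_def)
    have e3: "W x y = u (Complex x y) - D x y" by (simp add: W_def D_def)
    have e4: "prim (\<lambda>s. p' (Complex s y) - g s) x = prim (\<lambda>s. p' (Complex s y)) x - prim g x"
    proof (rule prim_diff[OF xy(1)])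
      show "continuous_on {-r<..<r} (\<lambda>s. p' (Complex s y))" by (rule cont_line[OF cont_p' xy(2)])
      show "continuous_on {-r<..<r} g"
        unfolding g_def
        by (intro continuous_intros continuous_on cont_W cont_line xy cont'
          continuous_on_subset[OF cont(2) interior] continuous_on_line pq)
    qed
    have e5: "prim (\<lambda>s. p' (Complex s y) - g s) x = prim (\<lambda>s. D s y \<star> \<beta>x (Complex s y)) x"
    proof (rule prim_cong[OF xy(1)])
      fix s assume s: "\<bar>s\<bar> < r"
      \<comment> \<open>Flatness turns \<open>p'\<close> into
        \<open>u \<star> \<beta>x + p \<star> \<beta>\<close>; subtracting \<open>g\<close> replaces
        \<open>u\<close> by \<open>u - W = D\<close>.\<close>
      have "u (Complex s y) = W s y + D s y" by (simp add: W_def D_def)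
      then show "p' (Complex s y) - g s = D s y \<star> \<beta>x (Complex s y)"
        using flat[of "Complex s y" "u (Complex s y)"] s xy
        by (simp add: p'_def g_def p_def q_def \<alpha>c_eq \<beta>c_eq add_left algebra_simps)
    qed
    have e6: "q (Complex x y) = u (Complex x y) \<star> \<beta> (Complex x y)"
      "q (Complex 0 y) = u (Complex 0 y) \<star> \<beta> (Complex 0 y)"
      using xy r by (simp_all add: q_def \<beta>c_eq)
    have "prim (\<lambda>s. p' (Complex s y)) x = prim g x + prim (\<lambda>s. D s y \<star> \<beta>x (Complex s y)) x"
      using e4 e5 by (simp add: algebra_simps)
    then have "q (Complex x y) - q (Complex 0 y) - prim (\<lambda>s. p' (Complex s y)) x = D' x y"
      unfolding D'_def e1 e2 e3 e6 by (simp add: diff_left algebra_simps)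
    with 1 show ?thesis by simp
  qed
  \<comment> \<open>On the real axis the fixed point equation is itself the integrated equation for
    \<open>u\<^sub>x\<close>.\<close>
  have D0: "D x 0 = 0" if "\<bar>x\<bar> < r" for x
    using eq[of x 0] u0 that r by (simp add: D_def zero_complex.code)
  have half: "norm (D x y) \<le> B / 2" if B: "\<And>x y. \<bar>x\<bar> < r \<Longrightarrow> \<bar>y\<bar> < r \<Longrightarrow> norm (D x y) \<le> B"
    and xy: "\<bar>x\<bar> < r" "\<bar>y\<bar> < r" for x y B
  proof -
    have B0: "0 \<le> B" using B[OF xy] norm_ge_zero order_trans by blast
    \<comment> \<open>Each term of \<open>D'\<close> is at most \<open>K * B * M\<close>, with
      \<open>r \<le> 1\<close> used for the integral; over a height below \<open>r\<close> this
      gives the factor \<open>2 * r * K * M \<le> 1/2\<close>.\<close>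
    have "norm (D' x y) \<le> 2 * (K * B * M)" if y: "\<bar>y\<bar> < r" for y
    proof -
      have "norm (prim (\<lambda>s. D s y \<star> \<beta>x (Complex s y)) x) \<le> \<bar>x\<bar> * (K * B * M)"
      proof (rule prim_bound[OF xy(1)])
        show "continuous_on {-r<..<r} (\<lambda>s. D s y \<star> \<beta>x (Complex s y))"
          by (intro continuous_on cont_D cont_line cont' y)
      qed (use y in \<open>auto intro!: prd_bound B bound\<close>)
      also have "\<dots> \<le> 1 * (K * B * M)"
        using xy r B0 K M by (intro mult_right_mono) auto
      finally have "norm (prim (\<lambda>s. D s y \<star> \<beta>x (Complex s y)) x) \<le> K * B * M" by simp
      moreover have "norm (D x y \<star> \<beta> (Complex x y)) \<le> K * B * M"
        using xy y by (intro prd_bound B bound) auto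
      ultimately show ?thesis unfolding D'_def
        using norm_triangle_ineq4[of "D x y \<star> \<beta> (Complex x y)" "prim (\<lambda>s. D s y \<star> \<beta>x (Complex s y)) x"]
        by linarith
    qed
    then have "norm (D x y - D x 0) \<le> 2 * (K * B * M) * \<bar>y - 0\<bar>"
      by (intro vector_derivative_bound[OF S(2), of "\<lambda>y. D x y" "\<lambda>y. D' x y"]) (use D' xy S in auto)
    also have "\<dots> \<le> 2 * (K * B * M) * r"
      using xy K M B0 by (intro mult_left_mono) auto
    also have "\<dots> = (4 * r * K * M) * B / 2" by simp
    also have "\<dots> \<le> 1 * B / 2" using small B0 by (intro divide_right_mono mult_right_mono) auto
    finally show ?thesis using D0[OF xy(1)] by simp
  qed
  have D_zero: "D x y = 0" if xy: "\<bar>x\<bar> < r" "\<bar>y\<bar> < r" for x y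
  proof -
    have "norm (D x y) \<le> 2 * N + K * N * M" if "\<bar>x\<bar> < r" "\<bar>y\<bar> < r" for x y
    proof -
      have "norm (prim (\<lambda>s. p (Complex s y)) x) \<le> \<bar>x\<bar> * (K * N * M)"
        by (rule prim_bound[OF that(1)]) (auto simp: p_def intro!: prd_bound u \<alpha>c_bound
          continuous_on_line[of "\<lambda>w. u w \<star> \<alpha>c w"] continuous_on_prd_ab)
      also have "\<dots> \<le> 1 * (K * N * M)"
        using that r K M order_trans[OF norm_ge_zero u(2)] by (intro mult_right_mono) auto
      finally show ?thesis unfolding D_def
        using norm_triangle_ineq4[of "u (Complex x y) - u (Complex 0 y)" "prim (\<lambda>s. p (Complex s y)) x"]
          norm_triangle_ineq4[of "u (Complex x y)" "u (Complex 0 y)"] u(2)[of "Complex x y"] u(2)[of "Complex 0 y"]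
        by linarith
    qed
    then have "case_prod D (x, y) = 0"
      by (intro halving_imp_zero[where S = "{(x, y). \<bar>x\<bar> < r \<and> \<bar>y\<bar> < r}"]) (use half xy in auto)
    then show ?thesis by simp
  qed
  have ux: "((\<lambda>x. u (Complex x y)) has_vector_derivative p (Complex x y)) (at x)"
    if xy: "\<bar>x\<bar> < r" "\<bar>y\<bar> < r" for x y
  proof (rule has_vector_derivative_transform_within_open[OF _ S(1)])
    have "((\<lambda>x. u (Complex 0 y) + prim (\<lambda>s. p (Complex s y)) x) has_vector_derivative 0 + p (Complex x y)) (at x)"
      by (intro has_vector_derivative_add has_vector_derivative_const prim_has_vector_derivative
        continuous_on_line pq)
    then show "((\<lambda>x. u (Complex 0 y) + prim (\<lambda>s. p (Complex s y)) x) has_vector_derivative p (Complex x y)) (at x)"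
      by simp
    show "u (Complex 0 y) + prim (\<lambda>s. p (Complex s y)) x = u (Complex x y)" if "x \<in> S" for x
      using D_zero[of x y] xy that by (simp add: D_def S(4) algebra_simps)
  qed (use xy S in simp)
  have "(u has_derivative (\<lambda>h. Re h *\<^sub>R (u w \<star> \<alpha> w) + Im h *\<^sub>R (u w \<star> \<beta> w))) (at w)"
    if w: "\<bar>Re w\<bar> < r" "\<bar>Im w\<bar> < r" for w
  proof -
    have "(u has_derivative (\<lambda>h. Re h *\<^sub>R p w + Im h *\<^sub>R q w)) (at w)"
      using ux[OF w] by (intro has_derivative_complex_partials[OF w _ uy continuous_on_subset[OF pq(2)]]) simp_all
    moreover have "p w = u w \<star> \<alpha> w" "q w = u w \<star> \<beta> w"
      unfolding p_def q_def
      by (simp_all only: \<alpha>c_eq[OF less_imp_le less_imp_le, OF w] \<beta>c_eq[OF less_imp_le less_imp_le, OF w])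
    ultimately show ?thesis by simp
  qed
  from that[OF u0 this] show ?thesis .
qed

end

section \<open>Flat systems on open subsets of the plane\<close>

definition parallel_at ::
  "('e::real_normed_vector \<Rightarrow> 'f \<Rightarrow> 'e) \<Rightarrow> (complex \<Rightarrow> 'f) \<Rightarrow> (complex \<Rightarrow> 'f) \<Rightarrow> (complex \<Rightarrow> 'e) \<Rightarrow> complex \<Rightarrow> bool" where
  "parallel_at prd \<alpha> \<beta> u w \<longleftrightarrow>
     (u has_derivative (\<lambda>h. Re h *\<^sub>R prd (u w) (\<alpha> w) + Im h *\<^sub>R prd (u w) (\<beta> w))) (at w)"

lemma differentiable_has_dx_dy:
  assumes "g differentiable (at w)"
  shows "(g has_derivative (\<lambda>h. Re h *\<^sub>R dx g w + Im h *\<^sub>R dy g w)) (at w)"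
proof -
  have d: "(g has_derivative frechet_derivative g (at w)) (at w)"
    using assms frechet_derivative_works by blast
  interpret bounded_linear "frechet_derivative g (at w)" using d by (rule has_derivative_bounded_linear)
  have "frechet_derivative g (at w) h = Re h *\<^sub>R dx g w + Im h *\<^sub>R dy g w" for h
  proof -
    have "h = Re h *\<^sub>R 1 + Im h *\<^sub>R \<i>" by (simp add: complex_eq_iff)
    then have "frechet_derivative g (at w) h = frechet_derivative g (at w) (Re h *\<^sub>R 1 + Im h *\<^sub>R \<i>)"
      by simp
    then show ?thesis by (simp only: add scaleR dx_def dy_def)
  qed
  then have "frechet_derivative g (at w) = (\<lambda>h. Re h *\<^sub>R dx g w + Im h *\<^sub>R dy g w)" by (rule ext)
  then show ?thesis using d by simp
qed

lemma has_derivative_imp_dx_dy: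
  assumes "(g has_derivative (\<lambda>h. Re h *\<^sub>R a + Im h *\<^sub>R b)) (at w)"
  shows "dx g w = a" "dy g w = b"
  using frechet_derivative_at[OF assms, symmetric] by (simp_all add: dx_def dy_def)

lemma vector_derivative_dx_dy:
  assumes "g differentiable (at (q + Complex x y))"
  shows "((\<lambda>y. g (q + Complex x y)) has_vector_derivative dy g (q + Complex x y)) (at y)"
    "((\<lambda>x. g (q + Complex x y)) has_vector_derivative dx g (q + Complex x y)) (at x)"
proof -
  note d = differentiable_has_dx_dy[OF assms]
  have "((\<lambda>y. q + Complex x y) has_derivative (\<lambda>h. Complex 0 h)) (at y)"
    unfolding Complex_eq by (auto intro!: derivative_eq_intros)
  from has_derivative_compose[OF this d]
  show "((\<lambda>y. g (q + Complex x y)) has_vector_derivative dy g (q + Complex x y)) (at y)"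
    by (simp add: has_vector_derivative_def)
  have "((\<lambda>x. q + Complex x y) has_derivative (\<lambda>h. Complex h 0)) (at x)"
    unfolding Complex_eq by (auto intro!: derivative_eq_intros)
  from has_derivative_compose[OF this d]
  show "((\<lambda>x. g (q + Complex x y)) has_vector_derivative dx g (q + Complex x y)) (at x)"
    by (simp add: has_vector_derivative_def)
qed

text \<open>The last clause is zero curvature. It is tested on every \<open>u\<close> because
  \<open>prd\<close> is only bilinear: the coefficients have no product among themselves.\<close>

definition flat_system ::
  "('e::real_normed_vector \<Rightarrow> 'f::real_normed_vector \<Rightarrow> 'e) \<Rightarrow> complex set \<Rightarrow> (complex \<Rightarrow> 'f) \<Rightarrow> (complex \<Rightarrow> 'f) \<Rightarrow> bool" where
  "flat_system prd U \<alpha> \<beta> \<longleftrightarrow>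
     (\<forall>w\<in>U. \<alpha> differentiable (at w) \<and> \<beta> differentiable (at w)) \<and>
     continuous_on U (dy \<alpha>) \<and> continuous_on U (dx \<beta>) \<and>
     (\<forall>u. \<forall>w\<in>U. prd u (dy \<alpha> w) + prd (prd u (\<beta> w)) (\<alpha> w) =
        prd u (dx \<beta> w) + prd (prd u (\<alpha> w)) (\<beta> w))"

text \<open>One ball has to serve every base point \<open>q\<close> in it, since continuation
  restarts at arbitrary points. The system is therefore solved on a square about \<open>q\<close>
  that contains the whole ball.\<close>

lemma flat_system_local_solutions:
  fixes prd :: "'e::banach \<Rightarrow> 'f::real_normed_vector \<Rightarrow> 'e"
  assumes bil: "bounded_bilinear prd" and U: "open U" "p \<in> U" and flat: "flat_system prd U \<alpha> \<beta>"
  obtains r where "0 < r" "ball p r \<subseteq> U"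
    "\<forall>q\<in>ball p r. \<forall>v. \<exists>u. u q = v \<and> (\<forall>w\<in>ball p r. parallel_at prd \<alpha> \<beta> u w)"
    "\<forall>q\<in>ball p r. \<forall>u u'. (\<forall>w\<in>ball p r. parallel_at prd \<alpha> \<beta> u w \<and> parallel_at prd \<alpha> \<beta> u' w) \<longrightarrow>
      u q = u' q \<longrightarrow> (\<forall>w\<in>ball p r. u w = u' w)"
proof -
  interpret bounded_bilinear prd by (rule bil)
  obtain K where K: "0 < K" "\<And>u a. norm (prd u a) \<le> K * norm u * norm a"
    using pos_bounded by (metis mult.commute mult.assoc)
  obtain R where R: "0 < R" "cball p R \<subseteq> U" using U open_contains_cball by blast
  have diff: "\<alpha> differentiable (at w)" "\<beta> differentiable (at w)" if "w \<in> cball p R" for w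
    using flat that R(2) unfolding flat_system_def by blast+
  have c: "continuous_on (cball p R) \<alpha>" "continuous_on (cball p R) \<beta>"
    by (auto intro!: continuous_at_imp_continuous_on differentiable_imp_continuous_within diff)
  have c': "continuous_on (cball p R) (dy \<alpha>)" "continuous_on (cball p R) (dx \<beta>)"
    using flat R(2) unfolding flat_system_def by (auto intro: continuous_on_subset)
  have ex_bound: "\<exists>M. \<forall>w\<in>cball p R. norm (g w) \<le> M" if "continuous_on (cball p R) g" for g :: "complex \<Rightarrow> 'f"
    using compact_imp_bounded[OF compact_continuous_image[OF that compact_cball]] unfolding bounded_iff by auto
  obtain M1 M2 M3 where M123: "\<forall>w\<in>cball p R. norm (\<alpha> w) \<le> M1" "\<forall>w\<in>cball p R. norm (\<beta> w) \<le> M2"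
    "\<forall>w\<in>cball p R. norm (dx \<beta> w) \<le> M3"
    using ex_bound[OF c(1)] ex_bound[OF c(2)] ex_bound[OF c'(2)] by blast
  define M where "M = max 1 (max M1 (max M2 M3))"
  have M: "1 \<le> M" "\<And>w. w \<in> cball p R \<Longrightarrow> norm (\<alpha> w) \<le> M" "\<And>w. w \<in> cball p R \<Longrightarrow> norm (\<beta> w) \<le> M"
    "\<And>w. w \<in> cball p R \<Longrightarrow> norm (dx \<beta> w) \<le> M"
    using M123 unfolding M_def by fastforce+
  \<comment> \<open>The square about \<open>q\<close> has half-width \<open>2 * r\<close>, the
    diameter of the ball; it stays in \<open>cball p R\<close> because
    \<open>r + 4 * r \<le> R\<close>. The last bound is the smallness condition for half-width
    \<open>2 * r\<close>.\<close>
  define r where "r = min (1 / 2) (min (R / 5) (1 / (8 * K * M)))"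
  have "0 < K * M" using K M by simp
  then have r: "0 < r" "2 * r \<le> 1" "5 * r \<le> R" "4 * (2 * r) * K * M \<le> 1"
  proof -
    assume KM: "0 < K * M"
    show "0 < r" using R KM K M unfolding r_def by simp
    show "2 * r \<le> 1" "5 * r \<le> R" unfolding r_def by linarith+
    have "r \<le> 1 / (8 * K * M)" unfolding r_def by linarith
    then have "r * (8 * (K * M)) \<le> 1 / (8 * K * M) * (8 * (K * M))" using KM by (intro mult_right_mono) auto
    also have "\<dots> = 1" using K(1) M(1) by simp
    finally show "4 * (2 * r) * K * M \<le> 1" by (simp add: mult_ac)
  qed
  have sub: "ball p r \<subseteq> cball p R" using r by (auto simp: subset_iff)
  have ex: "\<exists>u. u q = v \<and> (\<forall>w\<in>ball p r. parallel_at prd \<alpha> \<beta> u w)" if q: "q \<in> ball p r" for q v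
  proof -
    have in_cball: "q + w \<in> cball p R" if w: "\<bar>Re w\<bar> \<le> 2 * r" "\<bar>Im w\<bar> \<le> 2 * r" for w
    proof -
      have "cmod w \<le> 4 * r" using cmod_le[of w] w by linarith
      moreover have "dist p (q + w) \<le> dist p q + cmod w"
        using norm_triangle_ineq4[of "p - q" w] by (simp add: dist_norm algebra_simps)
      moreover have "dist p q < r" using q by simp
      ultimately show ?thesis using r(3) by simp
    qed
    interpret flat_square prd "\<lambda>w. \<alpha> (q + w)" "\<lambda>w. \<beta> (q + w)" "\<lambda>w. dy \<alpha> (q + w)" "\<lambda>w. dx \<beta> (q + w)" "2 * r" K M
    proof (unfold_locales)
      show "0 < 2 * r" "2 * r \<le> 1" "4 * (2 * r) * K * M \<le> 1" "0 < K" "0 \<le> M" using r K M by auto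
      show "norm (prd u a) \<le> K * norm u * norm a" for u a by (rule K)
      show "norm (\<alpha> (q + w)) \<le> M" "norm (\<beta> (q + w)) \<le> M" if "\<bar>Re w\<bar> \<le> 2 * r" "\<bar>Im w\<bar> \<le> 2 * r" for w
        by (rule M(2,3)[OF in_cball[OF that]])+
      show "norm (dx \<beta> (q + w)) \<le> M" if "\<bar>Re w\<bar> < 2 * r" "\<bar>Im w\<bar> < 2 * r" for w
        by (rule M(4)[OF in_cball]) (use that in linarith)+
      show "prd u (dy \<alpha> (q + w)) + prd (prd u (\<beta> (q + w))) (\<alpha> (q + w)) =
          prd u (dx \<beta> (q + w)) + prd (prd u (\<alpha> (q + w))) (\<beta> (q + w))"
        if "\<bar>Re w\<bar> < 2 * r" "\<bar>Im w\<bar> < 2 * r" for u w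
      proof -
        have "q + w \<in> cball p R" by (rule in_cball) (use that in linarith)+
        then show ?thesis using flat R(2) unfolding flat_system_def by blast
      qed
      show "continuous_on {w. \<bar>Re w\<bar> \<le> 2 * r \<and> \<bar>Im w\<bar> \<le> 2 * r} (\<lambda>w. \<alpha> (q + w))"
        "continuous_on {w. \<bar>Re w\<bar> \<le> 2 * r \<and> \<bar>Im w\<bar> \<le> 2 * r} (\<lambda>w. \<beta> (q + w))"
        by (rule continuous_on_compose2[OF c(1)] continuous_on_compose2[OF c(2)],
            intro continuous_intros, use in_cball in blast)+
      have "q + w \<in> cball p R" if "w \<in> {w. \<bar>Re w\<bar> < 2 * r \<and> \<bar>Im w\<bar> < 2 * r}" for w
        by (rule in_cball) (use that in simp_all)
      then show "continuous_on {w. \<bar>Re w\<bar> < 2 * r \<and> \<bar>Im w\<bar> < 2 * r} (\<lambda>w. dy \<alpha> (q + w))"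
        "continuous_on {w. \<bar>Re w\<bar> < 2 * r \<and> \<bar>Im w\<bar> < 2 * r} (\<lambda>w. dx \<beta> (q + w))"
        by - (rule continuous_on_compose2[OF c'(1)] continuous_on_compose2[OF c'(2)],
            intro continuous_intros, blast)+
      show "((\<lambda>y. \<alpha> (q + Complex x y)) has_vector_derivative dy \<alpha> (q + Complex x y)) (at y)"
        "((\<lambda>x. \<beta> (q + Complex x y)) has_vector_derivative dx \<beta> (q + Complex x y)) (at x)"
        if "\<bar>x\<bar> < 2 * r" "\<bar>y\<bar> < 2 * r" for x y
        by (intro vector_derivative_dx_dy diff in_cball, use that in simp, use that in simp)+
    qed
    obtain u where u: "u 0 = v" "\<And>w. \<bar>Re w\<bar> < 2 * r \<Longrightarrow> \<bar>Im w\<bar> < 2 * r \<Longrightarrow>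
      (u has_derivative (\<lambda>h. Re h *\<^sub>R prd (u w) (\<alpha> (q + w)) + Im h *\<^sub>R prd (u w) (\<beta> (q + w)))) (at w)"
      by (rule solution_exists[of v]) (rule that; assumption)
    have "parallel_at prd \<alpha> \<beta> (\<lambda>w. u (w - q)) w" if w: "w \<in> ball p r" for w
    proof -
      have "cmod (w - q) \<le> dist p w + dist p q"
        using norm_triangle_ineq4[of "p - q" "p - w"] by (simp add: dist_norm)
      also have "\<dots> < 2 * r" using w q by simp
      finally have "\<bar>Re (w - q)\<bar> < 2 * r" "\<bar>Im (w - q)\<bar> < 2 * r"
        using abs_Re_le_cmod[of "w - q"] abs_Im_le_cmod[of "w - q"] by linarith+
      note d = u(2)[OF this]
      have "((\<lambda>w. w - q) has_derivative (\<lambda>h. h)) (at w)" by (auto intro!: derivative_eq_intros)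
      from has_derivative_compose[OF this d] show ?thesis by (simp add: parallel_at_def)
    qed
    with u(1) show ?thesis by (intro exI[of _ "\<lambda>w. u (w - q)"]) simp
  qed
  have uniq: "u w = u' w" if q: "q \<in> ball p r" and w: "w \<in> ball p r" and eq: "u q = u' q"
    and u: "\<And>w. w \<in> ball p r \<Longrightarrow> parallel_at prd \<alpha> \<beta> u w"
    and u': "\<And>w. w \<in> ball p r \<Longrightarrow> parallel_at prd \<alpha> \<beta> u' w" for u u' q w
  proof -
    \<comment> \<open>By bilinearity the difference solves the same system, and it vanishes at
      \<open>q\<close>. On the compact segment it has a bound \<open>B\<close>, and its derivative
      is at most \<open>2 * K * B * M\<close> over a length of at most \<open>2 * r\<close>.\<close>
    define D where "D w = u w - u' w" for w
    define L where "L w h = Re h *\<^sub>R prd (D w) (\<alpha> w) + Im h *\<^sub>R prd (D w) (\<beta> w)" for w h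
    have D: "(D has_derivative L w) (at w)" if "w \<in> ball p r" for w
      using has_derivative_diff[OF u[OF that, unfolded parallel_at_def] u'[OF that, unfolded parallel_at_def]]
      unfolding D_def L_def diff_left by (simp add: algebra_simps)
    let ?S = "closed_segment q w"
    have S: "?S \<subseteq> ball p r" using q w by (simp add: closed_segment_subset)
    have "continuous_on ?S D"
      using D S by (intro continuous_at_imp_continuous_on) (blast intro: has_derivative_continuous)
    then have "bounded (D ` ?S)"
      by (rule compact_imp_bounded[OF compact_continuous_image[OF _ compact_segment]])
    then obtain B where "\<And>z. z \<in> ?S \<Longrightarrow> norm (D z) \<le> B"
      unfolding bounded_iff by blast
    moreover have "norm (D z) \<le> B / 2" if B: "\<And>z. z \<in> ?S \<Longrightarrow> norm (D z) \<le> B" and z: "z \<in> ?S" for z B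
    proof -
      have B0: "0 \<le> B" using B[OF z] norm_ge_zero order_trans by blast
      have "norm (D z - D q) \<le> (2 * K * B * M) * norm (z - q)"
      proof (rule differentiable_bound[of ?S])
        fix z assume z: "z \<in> ?S"
        then have zb: "z \<in> ball p r" "z \<in> cball p R" using S sub by auto
        show "(D has_derivative L z) (at z within ?S)" using D[OF zb(1)] by (rule has_derivative_at_withinI)
        have "norm (prd (D z) c) \<le> K * B * M" if "norm c \<le> M" for c
          by (rule order_trans[OF K(2)], intro mult_mono) (use that K(1) B[OF z] B0 in auto)
        note b = this[OF M(2)[OF zb(2)]] this[OF M(3)[OF zb(2)]]
        show "onorm (L z) \<le> 2 * K * B * M"
        proof (rule onorm_le)
          fix h
          have "norm (L z h) \<le> \<bar>Re h\<bar> * norm (prd (D z) (\<alpha> z)) + \<bar>Im h\<bar> * norm (prd (D z) (\<beta> z))"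
            unfolding L_def by (rule norm_triangle_le) simp
          also have "\<dots> \<le> cmod h * (K * B * M) + cmod h * (K * B * M)"
            by (intro add_mono mult_mono b abs_Re_le_cmod abs_Im_le_cmod) auto
          finally show "norm (L z h) \<le> 2 * K * B * M * norm h" by (simp add: algebra_simps)
        qed
      qed (use z in auto)
      also have "\<dots> \<le> (2 * K * B * M) * (2 * r)"
      proof (rule mult_left_mono)
        have "norm (z - q) \<le> dist p z + dist p q"
          using norm_triangle_ineq4[of "p - q" "p - z"] by (simp add: dist_norm)
        moreover have "dist p z < r" "dist p q < r" using z S q by auto
        ultimately show "norm (z - q) \<le> 2 * r" by linarith
        show "0 \<le> 2 * K * B * M" using K M B0 by simp
      qed
      also have "\<dots> = (4 * (2 * r) * K * M) * B / 2" by simp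
      also have "\<dots> \<le> 1 * B / 2" using r(4) B0 by (intro divide_right_mono mult_right_mono) auto
      finally show ?thesis using eq by (simp add: D_def)
    qed
    ultimately have "D w = 0" by (rule halving_imp_zero[of ?S]) auto
    then show ?thesis by (simp add: D_def)
  qed
  show ?thesis
  proof (rule that[of r])
    show "ball p r \<subseteq> U" using sub R(2) by blast
  qed (use r(1) ex uniq in blast)+
qed

section \<open>Parallel sections on a surface\<close>

lemma complex_chartD:
  assumes "complex_chart c"
  shows "open (fst c)" "open (chart_image c)" "continuous_on (fst c) (snd c)"
    "continuous_on (chart_image c) (chart_inv c)"
    "p \<in> fst c \<Longrightarrow> snd c p \<in> chart_image c" "p \<in> fst c \<Longrightarrow> chart_inv c (snd c p) = p"
    "w \<in> chart_image c \<Longrightarrow> chart_inv c w \<in> fst c" "w \<in> chart_image c \<Longrightarrow> snd c (chart_inv c w) = w"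
  using assms unfolding complex_chart_def homeomorphism_def by auto

lemma chart_open_image:
  assumes c: "complex_chart c" and W: "open W" "W \<subseteq> fst c"
  shows "open (snd c ` W)"
proof -
  have "snd c ` W = chart_image c \<inter> chart_inv c -` W"
    using complex_chartD[OF c] W by (force simp: image_iff)
  then show ?thesis
    using continuous_open_preimage[OF complex_chartD(4,2)[OF c] W(1)] by simp
qed

lemma local_coordinate_chart: "local_coordinate A c \<Longrightarrow> complex_chart c"
  by (simp add: local_coordinate_def)

lemma atlas_local_coordinate: "riemann_surface A \<Longrightarrow> c \<in> A \<Longrightarrow> local_coordinate A c"
  by (simp add: local_coordinate_def riemann_surface_def)

lemma riemann_surface_chart:
  assumes "riemann_surface A" obtains c where "c \<in> A" "local_coordinate A c" "p \<in> fst c"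
proof -
  have "p \<in> (\<Union>c\<in>A. fst c)" using assms by (simp add: riemann_surface_def)
  then show ?thesis using that atlas_local_coordinate[OF assms] by blast
qed

text \<open>Local coordinates are by definition compatible only with the charts in \<open>A\<close>,
  so the transition is factored near \<open>p\<close> through a chart of \<open>A\<close>.\<close>

lemma transition_deriv:
  assumes A: "riemann_surface A" and cd: "local_coordinate A c" "local_coordinate A d"
    and p: "p \<in> fst c" "p \<in> fst d"
  shows "(transition c d has_field_derivative deriv (transition c d) (snd c p)) (at (snd c p))"
proof -
  note c = complex_chartD[OF local_coordinate_chart[OF cd(1)]]
  note d = complex_chartD[OF local_coordinate_chart[OF cd(2)]]
  obtain a where a: "a \<in> A" "local_coordinate A a" "p \<in> fst a"
    using riemann_surface_chart[OF A] by blast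
  note a' = complex_chartD[OF local_coordinate_chart[OF a(2)]]
  let ?W = "fst c \<inter> fst d \<inter> fst a"
  have N: "open (snd c ` ?W)"
    using c(1) d(1) a'(1) by (intro chart_open_image[OF local_coordinate_chart[OF cd(1)]]) auto
  have "transition c a holomorphic_on snd c ` ?W"
    using cd(1) a(1) unfolding local_coordinate_def compatible_def
    by (blast intro: holomorphic_on_subset)
  moreover have "transition a d holomorphic_on transition c a ` snd c ` ?W"
  proof (rule holomorphic_on_subset)
    show "transition a d holomorphic_on snd a ` (fst d \<inter> fst a)"
      using cd(2) a(1) unfolding local_coordinate_def compatible_def by blast
    show "transition c a ` snd c ` ?W \<subseteq> snd a ` (fst d \<inter> fst a)"
      using c(6) by (auto simp: transition_def)
  qed
  ultimately have "transition a d \<circ> transition c a holomorphic_on snd c ` ?W"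
    by (rule holomorphic_on_compose)
  moreover have "(transition a d \<circ> transition c a) w = transition c d w" if "w \<in> snd c ` ?W" for w
    using that c(6) a'(6) by (auto simp: transition_def)
  ultimately have "transition c d holomorphic_on snd c ` ?W"
    by (rule holomorphic_transform)
  moreover have "snd c p \<in> snd c ` ?W" using p a by blast
  ultimately show ?thesis
    using holomorphic_derivI[OF _ N] by blast
qed

text \<open>Chain rule: the real differential is precomposed with multiplication by \<phi>, and the
  signs in the conclusion are those of \<open>Re (\<phi> * h)\<close> and
  \<open>Im (\<phi> * h)\<close>.\<close>

lemma in_coord_change:
  assumes A: "riemann_surface A" and cd: "local_coordinate A c" "local_coordinate A d"
    and p: "p \<in> fst c" "p \<in> fst d"
    and u: "(in_coord c u has_derivative (\<lambda>h. Re h *\<^sub>R a + Im h *\<^sub>R b)) (at (snd c p))"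
    and \<phi>: "\<phi> = deriv (transition d c) (snd d p)"
  shows "(in_coord d u has_derivative
    (\<lambda>h. Re h *\<^sub>R (Re \<phi> *\<^sub>R a + Im \<phi> *\<^sub>R b) + Im h *\<^sub>R (Re \<phi> *\<^sub>R b - Im \<phi> *\<^sub>R a))) (at (snd d p))"
proof -
  note c = complex_chartD[OF local_coordinate_chart[OF cd(1)]]
  note d = complex_chartD[OF local_coordinate_chart[OF cd(2)]]
  let ?W = "fst c \<inter> fst d"
  have N: "open (snd d ` ?W)"
    using c(1) d(1) by (intro chart_open_image[OF local_coordinate_chart[OF cd(2)]]) auto
  have eq: "in_coord c u (transition d c w) = in_coord d u w" if "w \<in> snd d ` ?W" for w
    using that c(6) d(6) by (auto simp: transition_def in_coord_def)
  have "(transition d c has_derivative (\<lambda>h. \<phi> * h)) (at (snd d p))"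
    using transition_deriv[OF A cd(2,1) p(2,1)] \<phi> by (simp add: has_field_derivative_def)
  moreover have "(in_coord c u has_derivative (\<lambda>h. Re h *\<^sub>R a + Im h *\<^sub>R b)) (at (transition d c (snd d p)))"
    using u d(6)[OF p(2)] by (simp add: transition_def)
  ultimately have "((\<lambda>w. in_coord c u (transition d c w)) has_derivative
      (\<lambda>h. Re (\<phi> * h) *\<^sub>R a + Im (\<phi> * h) *\<^sub>R b)) (at (snd d p))"
    by (rule has_derivative_compose)
  from has_derivative_transform_within_open[OF this N _ eq]
  have "(in_coord d u has_derivative (\<lambda>h. Re (\<phi> * h) *\<^sub>R a + Im (\<phi> * h) *\<^sub>R b)) (at (snd d p))"
    using p by blast
  then show ?thesis by (simp add: algebra_simps)
qed

lemma parallel_at_cong: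
  assumes "parallel_at prd \<alpha> \<beta> u w" "open V" "w \<in> V" "\<And>z. z \<in> V \<Longrightarrow> u z = u' z"
  shows "parallel_at prd \<alpha> \<beta> u' w"
  using has_derivative_transform_within_open[OF assms(1)[unfolded parallel_at_def] assms(2-4)]
    assms(3,4) by (simp add: parallel_at_def)

lemma flat_system_subset: "flat_system prd U \<alpha> \<beta> \<Longrightarrow> V \<subseteq> U \<Longrightarrow> flat_system prd V \<alpha> \<beta>"
  unfolding flat_system_def using continuous_on_subset by blast

text \<open>\<open>coord_change\<close> says that the pairs are the coefficients of one global
  1-form with values in \<open>'f\<close>.\<close>

locale flat_connection =
  fixes A :: "('a::t2_space) chart set"
    and prd :: "'e::banach \<Rightarrow> 'f::real_normed_vector \<Rightarrow> 'e"
    and \<alpha> \<beta> :: "'a chart \<Rightarrow> complex \<Rightarrow> 'f"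
  assumes surface: "riemann_surface A" and bilinear: "bounded_bilinear prd"
    and flat: "\<And>c. local_coordinate A c \<Longrightarrow> flat_system prd (chart_image c) (\<alpha> c) (\<beta> c)"
    and coord_change: "\<And>c d p \<phi>. local_coordinate A c \<Longrightarrow> local_coordinate A d \<Longrightarrow> p \<in> fst c \<Longrightarrow> p \<in> fst d \<Longrightarrow>
      \<phi> = deriv (transition d c) (snd d p) \<Longrightarrow>
      \<alpha> d (snd d p) = Re \<phi> *\<^sub>R \<alpha> c (snd c p) + Im \<phi> *\<^sub>R \<beta> c (snd c p) \<and>
      \<beta> d (snd d p) = Re \<phi> *\<^sub>R \<beta> c (snd c p) - Im \<phi> *\<^sub>R \<alpha> c (snd c p)"
begin

definition parallel_in :: "'a chart \<Rightarrow> ('a \<Rightarrow> 'e) \<Rightarrow> 'a \<Rightarrow> bool" where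
  "parallel_in c u p \<longleftrightarrow> parallel_at prd (\<alpha> c) (\<beta> c) (in_coord c u) (snd c p)"

definition parallel :: "('a \<Rightarrow> 'e) \<Rightarrow> 'a \<Rightarrow> bool" where
  "parallel u p \<longleftrightarrow> (\<forall>c. local_coordinate A c \<longrightarrow> p \<in> fst c \<longrightarrow> parallel_in c u p)"

definition solvable :: "'a set \<Rightarrow> bool" where
  "solvable U \<longleftrightarrow> open U \<and> path_connected U \<and>
     (\<forall>q\<in>U. \<forall>v. \<exists>u. u q = v \<and> (\<forall>x\<in>U. parallel u x)) \<and>
     (\<forall>q\<in>U. \<forall>u u'. (\<forall>x\<in>U. parallel u x \<and> parallel u' x) \<longrightarrow> u q = u' q \<longrightarrow> (\<forall>x\<in>U. u x = u' x))"

text \<open>Since \<open>prd\<close> is linear in its second argument, the coefficients change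
  exactly as the derivative of \<open>u\<close> does, so a single coordinate decides.\<close>

lemma parallel_in_imp_parallel:
  assumes c: "local_coordinate A c" "p \<in> fst c" and u: "parallel_in c u p"
  shows "parallel u p"
  unfolding parallel_def
proof (intro allI impI)
  fix d assume d: "local_coordinate A d" "p \<in> fst d"
  interpret bounded_bilinear prd by (rule bilinear)
  note cp = complex_chartD(6)[OF local_coordinate_chart[OF c(1)] c(2)]
  note dp = complex_chartD(6)[OF local_coordinate_chart[OF d(1)] d(2)]
  define \<phi> where "\<phi> = deriv (transition d c) (snd d p)"
  have "in_coord c u (snd c p) = u p" "in_coord d u (snd d p) = u p"
    by (simp_all add: in_coord_def cp dp)
  then show "parallel_in d u p"
    using in_coord_change[OF surface c(1) d(1) c(2) d(2) u[unfolded parallel_in_def parallel_at_def] \<phi>_def]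
      coord_change[OF c(1) d(1) c(2) d(2) \<phi>_def]
    by (simp add: parallel_in_def parallel_at_def add_right diff_right scaleR_right)
qed

lemma solvable_basis:
  assumes W: "open W" "p \<in> W" shows "\<exists>U. p \<in> U \<and> U \<subseteq> W \<and> solvable U"
proof -
  obtain c where lc: "local_coordinate A c" and p: "p \<in> fst c"
    using riemann_surface_chart[OF surface] by blast
  note c = complex_chartD[OF local_coordinate_chart[OF lc]]
  let ?V = "snd c ` (W \<inter> fst c)"
  have V: "open ?V" "snd c p \<in> ?V" "?V \<subseteq> chart_image c"
    using chart_open_image[OF local_coordinate_chart[OF lc], of "W \<inter> fst c"] W c(1) p
    by (auto simp: chart_image_def)
  obtain r where r: "0 < r" "ball (snd c p) r \<subseteq> ?V"
    and ex: "\<forall>q\<in>ball (snd c p) r. \<forall>v. \<exists>u. u q = v \<and>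
      (\<forall>w\<in>ball (snd c p) r. parallel_at prd (\<alpha> c) (\<beta> c) u w)"
    and uniq: "\<forall>q\<in>ball (snd c p) r. \<forall>u u'. (\<forall>w\<in>ball (snd c p) r. parallel_at prd (\<alpha> c) (\<beta> c) u w \<and>
      parallel_at prd (\<alpha> c) (\<beta> c) u' w) \<longrightarrow> u q = u' q \<longrightarrow> (\<forall>w\<in>ball (snd c p) r. u w = u' w)"
    by (rule flat_system_local_solutions[OF bilinear V(1,2) flat_system_subset[OF flat[OF lc] V(3)]])
  let ?B = "ball (snd c p) r"
  define U where "U = chart_inv c ` ?B"
  have B: "?B \<subseteq> chart_image c" using r(2) V(3) by blast
  have U_eq: "U = fst c \<inter> snd c -` ?B"
  proof (intro equalityI subsetI)
    fix x assume "x \<in> U"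
    then obtain w where "w \<in> ?B" "x = chart_inv c w" unfolding U_def by blast
    then show "x \<in> fst c \<inter> snd c -` ?B" using B c(7)[of w] c(8)[of w] by auto
  next
    fix x assume "x \<in> fst c \<inter> snd c -` ?B"
    then show "x \<in> U" unfolding U_def using c(6)[of x] by (metis Int_iff imageI vimageE)
  qed
  have U: "open U" "p \<in> U" "U \<subseteq> W" "U \<subseteq> fst c"
  proof -
    show "open U" unfolding U_eq by (rule continuous_open_preimage[OF c(3,1) open_ball])
    show "p \<in> U" unfolding U_eq using p r(1) by simp
    show "U \<subseteq> fst c" unfolding U_eq by (rule Int_lower1)
    show "U \<subseteq> W"
    proof
      fix x assume x: "x \<in> U"
      then have "snd c x \<in> ?B" and xc: "x \<in> fst c" unfolding U_eq by simp_all
      from r(2) this(1) have "snd c x \<in> ?V" by (rule subsetD)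
      then obtain y where y: "y \<in> W" "y \<in> fst c" "snd c x = snd c y" by (elim imageE IntE)
      have "x = y" using c(6)[OF xc] c(6)[OF y(2)] unfolding y(3) by (rule trans[OF sym])
      then show "x \<in> W" using y(1) by (rule ssubst)
    qed
  qed
  have "path_connected U"
    unfolding U_def using continuous_on_subset[OF c(4) B]
    by (intro path_connected_continuous_image convex_imp_path_connected) auto
  moreover have "\<exists>u. u q = v \<and> (\<forall>x\<in>U. parallel u x)" if q: "q \<in> U" for q v
  proof -
    have "snd c q \<in> ?B" using q unfolding U_eq by blast
    with ex obtain u where
      u: "u (snd c q) = v" "\<And>w. w \<in> ?B \<Longrightarrow> parallel_at prd (\<alpha> c) (\<beta> c) u w" by blast
    have "parallel (u \<circ> snd c) x" if x: "x \<in> U" for x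
    proof (rule parallel_in_imp_parallel[OF lc])
      show "x \<in> fst c" using x U by blast
      have xB: "snd c x \<in> ?B" using x unfolding U_eq by blast
      have "u w = in_coord c (u \<circ> snd c) w" if "w \<in> ?B" for w
        using c(8)[OF subsetD[OF B that]] by (simp add: in_coord_def)
      then show "parallel_in c (u \<circ> snd c) x"
        unfolding parallel_in_def by (rule parallel_at_cong[OF u(2)[OF xB] open_ball xB])
    qed
    with u(1) show ?thesis by (intro exI[of _ "u \<circ> snd c"]) auto
  qed
  moreover have "u x = u' x" if q: "q \<in> U" and u: "\<forall>x\<in>U. parallel u x \<and> parallel u' x" and eq: "u q = u' q"
    and x: "x \<in> U" for q u u' x
  proof -
    have "parallel_at prd (\<alpha> c) (\<beta> c) (in_coord c u) w \<and> parallel_at prd (\<alpha> c) (\<beta> c) (in_coord c u') w"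
      if w: "w \<in> ?B" for w
    proof -
      have "chart_inv c w \<in> U" using w by (simp add: U_def)
      then have "parallel_in c u (chart_inv c w)" "parallel_in c u' (chart_inv c w)"
        using u lc U(4) unfolding parallel_def by blast+
      then show ?thesis using c(8) w B by (simp add: parallel_in_def subset_iff)
    qed
    moreover have "snd c q \<in> ?B" "snd c x \<in> ?B" using q x unfolding U_eq by auto
    moreover have "chart_inv c (snd c q) = q" "chart_inv c (snd c x) = x" using c(6) q x U(4) by auto
    ultimately show ?thesis
      using uniq[rule_format, of "snd c q" "in_coord c u" "in_coord c u'" "snd c x"] eq
      by (simp add: in_coord_def)
  qed
  ultimately have "solvable U" unfolding solvable_def using U(1) by blast
  then show ?thesis using U by blast
qed

sublocale local_solutions parallel solvable
proof
  show "parallel g p" if W: "open W" "p \<in> W" and eq: "\<And>q. q \<in> W \<Longrightarrow> f q = g q" and f: "parallel f p" for W p f g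
    unfolding parallel_def parallel_in_def
  proof (intro allI impI)
    fix c assume c: "local_coordinate A c" "p \<in> fst c"
    note c' = complex_chartD[OF local_coordinate_chart[OF c(1)]]
    have V: "open (snd c ` (W \<inter> fst c))"
      using chart_open_image[OF local_coordinate_chart[OF c(1)]] W c' by blast
    have "parallel_at prd (\<alpha> c) (\<beta> c) (in_coord c f) (snd c p)"
      using f c unfolding parallel_def parallel_in_def by blast
    moreover have "snd c p \<in> snd c ` (W \<inter> fst c)" using W(2) c(2) by blast
    moreover have "in_coord c f z = in_coord c g z" if z: "z \<in> snd c ` (W \<inter> fst c)" for z
    proof -
      obtain x where "z = snd c x" "x \<in> W" "x \<in> fst c" using z by blast
      then show ?thesis using eq[of x] c'(6)[of x] by (simp add: in_coord_def)
    qed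
    ultimately show "parallel_at prd (\<alpha> c) (\<beta> c) (in_coord c g) (snd c p)"
      by (rule parallel_at_cong[OF _ V])
  qed
  show "\<exists>U. p \<in> U \<and> U \<subseteq> W \<and> solvable U" if "open W" "p \<in> W" for W p
    using that by (rule solvable_basis)
  show "open U" "path_connected U" if "solvable U" for U
    using that unfolding solvable_def by blast+
  show "\<exists>u. u q = v \<and> (\<forall>x\<in>U. parallel u x)" if "solvable U" "q \<in> U" for U q v
    using that unfolding solvable_def by blast
  show "u x = u' x" if "solvable U" "q \<in> U" "\<And>x. x \<in> U \<Longrightarrow> parallel u x" "\<And>x. x \<in> U \<Longrightarrow> parallel u' x"
    "u q = u' q" "x \<in> U" for U q u u' x
    using that unfolding solvable_def by blast
qed

theorem parallel_section:
  assumes "simply_connected (UNIV :: 'a set)"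
  obtains u where "u p0 = v0"
    "\<And>c w. local_coordinate A c \<Longrightarrow> w \<in> chart_image c \<Longrightarrow> parallel_at prd (\<alpha> c) (\<beta> c) (in_coord c u) w"
proof -
  obtain u where u: "u p0 = v0" "\<And>p. parallel u p" using global_solution[OF assms] by metis
  show ?thesis
  proof (rule that[of u])
    fix c w assume c: "local_coordinate A c" "w \<in> chart_image c"
    note c' = complex_chartD[OF local_coordinate_chart[OF c(1)]]
    show "parallel_at prd (\<alpha> c) (\<beta> c) (in_coord c u) w"
      using u(2)[of "chart_inv c w"] c c'(7,8)[OF c(2)] unfolding parallel_def parallel_in_def by metis
  qed (rule u)
qed

end

section \<open>Calculus of smooth maps\<close>

lemma has_derivative_frechet:
  "(f has_derivative f') (at x) \<Longrightarrow> frechet_derivative f (at x) v = f' v"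
  using frechet_derivative_at by metis

lemma differentiable_cong_open:
  assumes "open U" "x \<in> U" "\<And>y. y \<in> U \<Longrightarrow> f y = g y" "f differentiable (at x)"
  shows "g differentiable (at x)" "frechet_derivative g (at x) = frechet_derivative f (at x)"
proof -
  have "(g has_derivative frechet_derivative f (at x)) (at x)"
    using has_derivative_transform_within_open[OF assms(4)[unfolded frechet_derivative_works] assms(1,2,3)] .
  then show "g differentiable (at x)" "frechet_derivative g (at x) = frechet_derivative f (at x)"
    by (auto simp: differentiable_def has_derivative_frechet)
qed

lemma n_times_differentiable_on_cong:
  assumes "open U" "\<And>x. x \<in> U \<Longrightarrow> f x = g x" "n_times_differentiable_on n U f"
  shows "n_times_differentiable_on n U g"
  using assms(2,3)
proof (induction n arbitrary: f g)
  case 0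
  then show ?case using continuous_on_cong[OF refl, of U f g] by simp
next
  case (Suc n)
  have "f differentiable (at x)" if "x \<in> U" for x using Suc.prems(2) that by simp
  note d = differentiable_cong_open[OF assms(1) _ Suc.prems(1) this]
  have "n_times_differentiable_on n U (\<lambda>x. frechet_derivative g (at x) v)" for v
    by (rule Suc.IH[of "\<lambda>x. frechet_derivative f (at x) v"]) (use d(2) Suc.prems(2) in auto)
  then show ?case using d(1) by simp
qed

lemma n_times_differentiable_on_Suc_imp:
  "n_times_differentiable_on (Suc n) U f \<Longrightarrow> n_times_differentiable_on n U f"
proof (induction n arbitrary: f)
  case 0
  then show ?case
    by (auto intro!: continuous_at_imp_continuous_on differentiable_imp_continuous_within)
next
  case (Suc n)
  then show ?case unfolding n_times_differentiable_on.simps(2)[of "Suc n"] n_times_differentiable_on.simps(2)[of n]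
    by (meson n_times_differentiable_on.simps(2))
qed

lemma n_times_differentiable_on_linear:
  assumes U: "open U" and T: "bounded_linear T"
  shows "n_times_differentiable_on n U f \<Longrightarrow> n_times_differentiable_on n U (\<lambda>x. T (f x))"
proof (induction n arbitrary: f)
  case 0
  then show ?case by (simp add: bounded_linear.continuous_on[OF T])
next
  case (Suc n)
  have d: "((\<lambda>x. T (f x)) has_derivative (\<lambda>v. T (frechet_derivative f (at x) v))) (at x)" if "x \<in> U" for x
    using Suc.prems that by (intro bounded_linear.has_derivative[OF T]) (simp add: frechet_derivative_works[symmetric])
  have "n_times_differentiable_on n U (\<lambda>x. frechet_derivative (\<lambda>x. T (f x)) (at x) v)" for v
    by (rule n_times_differentiable_on_cong[OF U _ Suc.IH[of "\<lambda>x. frechet_derivative f (at x) v"]])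
      (use Suc.prems in \<open>simp_all add: has_derivative_frechet[OF d]\<close>)
  then show ?case using d unfolding n_times_differentiable_on.simps(2) differentiable_def by blast
qed

lemma n_times_differentiable_on_add:
  assumes U: "open U"
  shows "n_times_differentiable_on n U f \<Longrightarrow> n_times_differentiable_on n U g \<Longrightarrow>
    n_times_differentiable_on n U (\<lambda>x. f x + g x)"
proof (induction n arbitrary: f g)
  case 0
  then show ?case by (simp add: continuous_on_add)
next
  case (Suc n)
  have d: "((\<lambda>x. f x + g x) has_derivative
      (\<lambda>v. frechet_derivative f (at x) v + frechet_derivative g (at x) v)) (at x)" if "x \<in> U" for x
    using Suc.prems that by (intro has_derivative_add) (simp_all add: frechet_derivative_works[symmetric])
  have "n_times_differentiable_on n U (\<lambda>x. frechet_derivative (\<lambda>x. f x + g x) (at x) v)" for v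
    by (rule n_times_differentiable_on_cong[OF U _
          Suc.IH[of "\<lambda>x. frechet_derivative f (at x) v" "\<lambda>x. frechet_derivative g (at x) v"]])
      (use Suc.prems in \<open>simp_all add: has_derivative_frechet[OF d]\<close>)
  then show ?case using d unfolding n_times_differentiable_on.simps(2) differentiable_def by blast
qed

lemma n_times_differentiable_on_bilinear:
  assumes U: "open U" and B: "bounded_bilinear B"
  shows "n_times_differentiable_on n U f \<Longrightarrow> n_times_differentiable_on n U g \<Longrightarrow>
    n_times_differentiable_on n U (\<lambda>x. B (f x) (g x))"
proof (induction n arbitrary: f g)
  case 0
  then show ?case by (simp add: bounded_bilinear.continuous_on[OF B])
next
  case (Suc n)
  have d: "((\<lambda>x. B (f x) (g x)) has_derivative
      (\<lambda>v. B (f x) (frechet_derivative g (at x) v) + B (frechet_derivative f (at x) v) (g x))) (at x)" if "x \<in> U" for x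
    using Suc.prems that by (intro bounded_bilinear.FDERIV[OF B]) (simp_all add: frechet_derivative_works[symmetric])
  have "n_times_differentiable_on n U (\<lambda>x. frechet_derivative (\<lambda>x. B (f x) (g x)) (at x) v)" for v
  proof (rule n_times_differentiable_on_cong[OF U])
    \<comment> \<open>Each summand keeps one factor undifferentiated; that factor is lowered from
      order \<open>Suc n\<close> to \<open>n\<close> before the induction hypothesis
      applies.\<close>
    show "n_times_differentiable_on n U
        (\<lambda>x. B (f x) (frechet_derivative g (at x) v) + B (frechet_derivative f (at x) v) (g x))"
      using Suc.prems
      by (intro n_times_differentiable_on_add[OF U] Suc.IH)
        (auto intro: n_times_differentiable_on_Suc_imp simp del: n_times_differentiable_on.simps(2)
          simp: n_times_differentiable_on.simps(2)[THEN iffD1])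
  qed (simp add: has_derivative_frechet[OF d])
  then show ?case using d unfolding n_times_differentiable_on.simps(2) differentiable_def by blast
qed

lemma n_times_differentiable_on_partials:
  assumes U: "open U" and d: "\<And>w. w \<in> U \<Longrightarrow> (u has_derivative (\<lambda>h. Re h *\<^sub>R a w + Im h *\<^sub>R b w)) (at w)"
    and ab: "n_times_differentiable_on n U a" "n_times_differentiable_on n U b"
  shows "n_times_differentiable_on (Suc n) U u"
proof -
  have "n_times_differentiable_on n U (\<lambda>x. frechet_derivative u (at x) v)" for v
  proof (rule n_times_differentiable_on_cong[OF U])
    show "n_times_differentiable_on n U (\<lambda>w. Re v *\<^sub>R a w + Im v *\<^sub>R b w)"
      by (intro n_times_differentiable_on_add n_times_differentiable_on_linear[OF U bounded_linear_scaleR_right] U ab)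
  qed (simp add: has_derivative_frechet[OF d])
  then show ?thesis using d unfolding n_times_differentiable_on.simps(2) differentiable_def by blast
qed

lemma smooth_on_linear:
  "open U \<Longrightarrow> bounded_linear T \<Longrightarrow> smooth_on U f \<Longrightarrow> smooth_on U (\<lambda>x. T (f x))"
  unfolding smooth_on_def by (blast intro: n_times_differentiable_on_linear)

lemma smooth_on_bilinear:
  "open U \<Longrightarrow> bounded_bilinear B \<Longrightarrow> smooth_on U f \<Longrightarrow> smooth_on U g \<Longrightarrow> smooth_on U (\<lambda>x. B (f x) (g x))"
  unfolding smooth_on_def by (blast intro: n_times_differentiable_on_bilinear)

lemma smooth_on_D:
  assumes "smooth_on U g"
  shows "w \<in> U \<Longrightarrow> g differentiable (at w)" "continuous_on U g" "smooth_on U (dx g)" "smooth_on U (dy g)"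
proof -
  have g: "n_times_differentiable_on n U g" for n using assms unfolding smooth_on_def by blast
  show "w \<in> U \<Longrightarrow> g differentiable (at w)" using g[of "Suc 0"] by simp
  show "continuous_on U g" using g[of 0] by simp
  have "n_times_differentiable_on n U (\<lambda>x. frechet_derivative g (at x) v)" for n v using g[of "Suc n"] by simp
  then show "smooth_on U (dx g)" "smooth_on U (dy g)"
    unfolding smooth_on_def dx_def[abs_def] dy_def[abs_def] by blast+
qed

text \<open>Bootstrapping: the partial derivatives of \<open>u\<close> are products of
  \<open>u\<close> with smooth coefficients, so each order of differentiability yields the
  next.\<close>

lemma parallel_smooth:
  assumes U: "open U" and B: "bounded_bilinear prd" and ab: "smooth_on U \<alpha>" "smooth_on U \<beta>"
    and u: "\<And>w. w \<in> U \<Longrightarrow> parallel_at prd \<alpha> \<beta> u w"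
  shows "smooth_on U u"
  unfolding smooth_on_def
proof
  fix n show "n_times_differentiable_on n U u"
  proof (induction n)
    case 0
    have "u differentiable (at w)" if "w \<in> U" for w
      using u[OF that] unfolding parallel_at_def differentiable_def by blast
    then show ?case
      by (auto intro!: continuous_at_imp_continuous_on differentiable_imp_continuous_within)
  next
    case (Suc n)
    show ?case
      by (rule n_times_differentiable_on_partials[OF U u[unfolded parallel_at_def]])
        (use ab[unfolded smooth_on_def] n_times_differentiable_on_bilinear[OF U B Suc.IH] in blast)+
  qed
qed

lemma smooth_on_partials:
  assumes U: "open U" and d: "\<And>w. w \<in> U \<Longrightarrow> (u has_derivative (\<lambda>h. Re h *\<^sub>R a w + Im h *\<^sub>R b w)) (at w)"
    and ab: "smooth_on U a" "smooth_on U b"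
  shows "smooth_on U u"
  using n_times_differentiable_on_Suc_imp[OF n_times_differentiable_on_partials[OF U d]] ab
  unfolding smooth_on_def by blast

lemma dx_dy_cong:
  assumes "open U" "w \<in> U" "\<And>z. z \<in> U \<Longrightarrow> f z = g z" "f differentiable (at w)"
  shows "dx g w = dx f w" "dy g w = dy f w"
  using differentiable_cong_open(2)[OF assms] by (simp_all add: dx_def dy_def)

lemma dx_dy_linear:
  assumes "bounded_linear T" "g differentiable (at w)"
  shows "dx (\<lambda>z. T (g z)) w = T (dx g w)" "dy (\<lambda>z. T (g z)) w = T (dy g w)"
  using has_derivative_frechet[OF bounded_linear.has_derivative[OF assms(1) assms(2)[unfolded frechet_derivative_works]]]
  by (simp_all add: dx_def dy_def)

lemma dx_dy_bilinear:
  assumes "bounded_bilinear B" "f differentiable (at w)" "g differentiable (at w)"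
  shows "dx (\<lambda>z. B (f z) (g z)) w = B (f w) (dx g w) + B (dx f w) (g w)"
    "dy (\<lambda>z. B (f z) (g z)) w = B (f w) (dy g w) + B (dy f w) (g w)"
  using has_derivative_frechet[OF bounded_bilinear.FDERIV[OF assms(1) assms(2,3)[unfolded frechet_derivative_works]]]
  by (simp_all add: dx_def dy_def)

text \<open>Both sides have the same integral \<open>\<partial>\<^sub>y g(x, 0) - \<partial>\<^sub>y g(0, 0)\<close> over every short horizontal segment.\<close>

lemma mixed_partials:
  fixes g :: "complex \<Rightarrow> 'b::banach"
  assumes U: "open U" "w \<in> U" and g: "smooth_on U g"
  shows "dy (dx g) w = dx (dy g) w"
proof -
  note g1 = smooth_on_D[OF g] note gx = smooth_on_D[OF g1(3)] note gy = smooth_on_D[OF g1(4)]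
  obtain R where R: "0 < R" "ball w R \<subseteq> U" using U open_contains_ball by blast
  define r where "r = R / 2"
  define S where "S = {-r<..<r}"
  have S: "convex S" "0 \<in> S" "0 < r" using R(1) by (auto simp: S_def r_def)
  have inU: "w + Complex x y \<in> U" if "\<bar>x\<bar> < r" "\<bar>y\<bar> < r" for x y
  proof -
    have "cmod (Complex x y) < R" using cmod_le[of "Complex x y"] that by (simp add: r_def)
    then show ?thesis using R(2) by (auto simp: dist_norm)
  qed
  have cont: "continuous_on {-r<..<r} (\<lambda>s. k (w + Complex s y))"
    if "continuous_on U k" "\<bar>y\<bar> < r" for k :: "complex \<Rightarrow> 'b" and y
  proof (rule continuous_on_compose2[OF that(1)])
    show "(\<lambda>s. w + Complex s y) ` {-r<..<r} \<subseteq> U"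
    proof (rule image_subsetI)
      fix s assume "s \<in> {-r<..<r}"
      then have "\<bar>s\<bar> < r" by auto
      then show "w + Complex s y \<in> U" using that(2) by (rule inU)
    qed
  qed (intro continuous_intros)
  define k where "k s = dy (dx g) (w + Complex s 0) - dx (dy g) (w + Complex s 0)" for s
  have cont_k: "continuous_on {-r<..<r} k"
    unfolding k_def using S(3) by (intro continuous_on_diff cont smooth_on_D(2)[OF gx(4)] smooth_on_D(2)[OF gy(3)]) simp_all
  have k: "prim k x = 0" if x: "\<bar>x\<bar> < r" for x
  proof -
    have xS: "x \<in> S" using x by (auto simp: S_def)
    have S_abs: "\<bar>s\<bar> < r" if "s \<in> S" for s using that by (auto simp: S_def)
    have eq: "g (w + Complex x y) - g (w + Complex 0 y) = prim (\<lambda>s. dx g (w + Complex s y)) x" if "y \<in> S" for y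
      by (rule prim_eq[OF S(1,2) xS, symmetric]) (intro vector_derivative_dx_dy g1 inU S_abs that)
    have "((\<lambda>y. g (w + Complex x y) - g (w + Complex 0 y)) has_vector_derivative
        dy g (w + Complex x 0) - dy g (w + Complex 0 0)) (at 0)"
      using S(3) x by (intro has_vector_derivative_diff vector_derivative_dx_dy g1 inU) auto
    from has_vector_derivative_transform_within_open[OF this _ S(2) eq]
    have "((\<lambda>y. prim (\<lambda>s. dx g (w + Complex s y)) x) has_vector_derivative
        dy g (w + Complex x 0) - dy g (w + Complex 0 0)) (at 0)"
      by (simp add: S_def)
    moreover have "((\<lambda>y. prim (\<lambda>s. dx g (w + Complex s y)) x) has_vector_derivative
        prim (\<lambda>s. dy (dx g) (w + Complex s 0)) x) (at 0)"
    proof (rule prim_has_vector_derivative_param[OF x])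
      show "\<bar>0\<bar> < r" using S(3) by simp
      show "((\<lambda>y. dx g (w + Complex s y)) has_vector_derivative dy (dx g) (w + Complex s y)) (at y)"
        if "\<bar>s\<bar> < r" "\<bar>y\<bar> < r" for s y
        by (intro vector_derivative_dx_dy gx inU that)
      show "continuous_on {-r<..<r} (\<lambda>s. dx g (w + Complex s y))" if "\<bar>y\<bar> < r" for y
        by (rule cont[OF gx(2) that])
      show "continuous_on ({-r<..<r} \<times> {-r<..<r}) (\<lambda>(s, y). dy (dx g) (w + Complex s y))"
        unfolding case_prod_beta
      proof (rule continuous_on_compose2[OF smooth_on_D(2)[OF gx(4)]])
        show "(\<lambda>z. w + Complex (fst z) (snd z)) ` ({-r<..<r} \<times> {-r<..<r}) \<subseteq> U"
        proof (rule image_subsetI)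
          fix z assume "z \<in> {-r<..<r} \<times> {-r<..<r}"
          then have "\<bar>fst z\<bar> < r" "\<bar>snd z\<bar> < r" by auto
          then show "w + Complex (fst z) (snd z) \<in> U" by (rule inU)
        qed
      qed (intro continuous_intros)
    qed
    ultimately have "prim (\<lambda>s. dy (dx g) (w + Complex s 0)) x = dy g (w + Complex x 0) - dy g (w + Complex 0 0)"
      by (rule vector_derivative_unique_at[rotated])
    moreover have "prim (\<lambda>s. dx (dy g) (w + Complex s 0)) x = dy g (w + Complex x 0) - dy g (w + Complex 0 0)"
      by (rule prim_eq[OF S(1,2) xS]) (intro vector_derivative_dx_dy gy inU, use S_abs S(3) in simp_all)
    moreover have "prim k x = prim (\<lambda>s. dy (dx g) (w + Complex s 0)) x - prim (\<lambda>s. dx (dy g) (w + Complex s 0)) x"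
      unfolding k_def by (rule prim_diff[OF x]) (intro cont smooth_on_D(2)[OF gx(4)] smooth_on_D(2)[OF gy(3)], use S(3) in simp)+
    ultimately show ?thesis by simp
  qed
  \<comment> \<open>Clamping turns \<open>k\<close> into a continuous function on the whole line, as
    required to differentiate \<open>prim\<close>. The derivative at 0 of the vanishing primitive is
    then \<open>k' 0\<close>, the difference of the mixed derivatives at \<open>w\<close>.\<close>
  define k' where "k' s = k (max (- (r / 2)) (min (r / 2) s))" for s
  have "continuous_on UNIV k'"
    unfolding k'_def
    by (rule continuous_on_compose2[OF cont_k]) (use S(3) in \<open>auto intro!: continuous_intros\<close>)
  then have "(prim k' has_vector_derivative k' 0) (at 0)" by (rule prim_has_vector_derivative)
  moreover have "(prim k' has_vector_derivative 0) (at 0)"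
  proof (rule has_vector_derivative_transform_within_open)
    show "((\<lambda>_. 0) has_vector_derivative 0) (at 0)" by (rule has_vector_derivative_const)
    show "0 = prim k' x" if "x \<in> {-(r/2)<..<r/2}" for x
    proof -
      have x: "\<bar>x\<bar> < r / 2" using that by auto
      have "k' t = k t" if "\<bar>t\<bar> < r / 2" for t
      proof -
        have "max (- (r / 2)) (min (r / 2) t) = t" using that by linarith
        then show ?thesis by (simp only: k'_def)
      qed
      from prim_cong[OF x this] k[of x] x show ?thesis by simp
    qed
  qed (use S(3) in auto)
  ultimately have "k' 0 = 0" by (rule vector_derivative_unique_at)
  then show ?thesis using S(3) by (simp add: k'_def k_def zero_complex.code[symmetric])
qed

text \<open>Serves conserved quantities: the second component of the affine system and the squared
  norm of the quaternion solution.\<close>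

lemma zero_derivative_imp_constant:
  assumes A: "riemann_surface (A :: ('a::t2_space) chart set)"
    and k: "\<And>c w. local_coordinate A c \<Longrightarrow> w \<in> chart_image c \<Longrightarrow> (in_coord c k has_derivative (\<lambda>h. 0)) (at w)"
  shows "k p = k q"
proof (rule connected_local_const[where f = k and A = UNIV])
  show "connected (UNIV :: 'a set)" using A by (simp add: riemann_surface_def)
  have "\<forall>\<^sub>F x in at p. k p = k x" for p
  proof -
    obtain c where lc: "local_coordinate A c" and p: "p \<in> fst c"
      using riemann_surface_chart[OF A] by blast
    note c = complex_chartD[OF local_coordinate_chart[OF lc]]
    obtain r where r: "0 < r" "ball (snd c p) r \<subseteq> chart_image c"
      using open_contains_ball[of "chart_image c"] c(2) c(5)[OF p] by blast
    obtain a where a: "\<And>w. w \<in> ball (snd c p) r \<Longrightarrow> in_coord c k w = a"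
      using has_derivative_zero_constant[OF convex_ball, of "snd c p" r "in_coord c k"] k[OF lc] r(2)
        has_derivative_at_withinI by (metis subsetD)
    have "open (fst c \<inter> snd c -` ball (snd c p) r)"
      by (rule continuous_open_preimage[OF c(3,1) open_ball])
    moreover have "k x = a" if "x \<in> fst c \<inter> snd c -` ball (snd c p) r" for x
      using a[of "snd c x"] c(6)[of x] that by (simp add: in_coord_def)
    moreover have "p \<in> fst c \<inter> snd c -` ball (snd c p) r" using p r by simp
    ultimately show ?thesis unfolding eventually_at_topological by metis
  qed
  then show "\<forall>p\<in>UNIV. \<forall>\<^sub>F x in at p within UNIV. k p = k x" by simp
qed auto

section \<open>Quaternions and the harmonic map equation\<close>

text \<open>Imaginary part of the conjugate of \<open>p\<close> times \<open>q\<close>. For unit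
  \<open>p\<close> and \<open>q\<close> orthogonal to \<open>p\<close> it is the \<alpha> with
  \<open>q = p \<alpha>\<close>; being bilinear, it obeys a product rule.\<close>

definition qdiv :: "quat \<Rightarrow> quat \<Rightarrow> real ^ 3" where
  "qdiv p q = qim (quat (qre p) (- qim p) \<odot> q)"

lemmas quat_simps = qmult_def imq_def quat_def qre_def qim_def cross3_def inner_vec_def sum_3 sum_4
  vec_eq_iff forall_3 forall_4

lemma bounded_bilinear_qmult: "bounded_bilinear (\<odot>)"
  by (rule bilinear_conv_bounded_bilinear[THEN iffD1])
    (auto simp: bilinear_def quat_simps algebra_simps intro!: linearI)

lemma bounded_linear_imq: "bounded_linear imq"
  by (rule linear_conv_bounded_linear[THEN iffD1]) (auto simp: quat_simps intro!: linearI)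

lemma bounded_bilinear_qmult_imq: "bounded_bilinear (\<lambda>q a. q \<odot> imq a)"
  using bounded_bilinear.comp[OF bounded_bilinear_qmult bounded_linear_ident bounded_linear_imq] .

lemma bounded_bilinear_qdiv: "bounded_bilinear qdiv"
  by (rule bilinear_conv_bounded_bilinear[THEN iffD1])
    (auto simp: bilinear_def qdiv_def quat_simps algebra_simps intro!: linearI)

lemma qdiv_self: "qdiv q q = 0"
  by (simp add: qdiv_def quat_simps algebra_simps)

text \<open>The conjugate of \<open>q\<close> times \<open>p\<close> has real part
  \<open>q \<bullet> p\<close>. Dropping it and multiplying back by \<open>q\<close> leaves the part
  of \<open>p\<close> orthogonal to \<open>q\<close>, scaled by
  \<open>q \<bullet> q\<close>.\<close>

lemma qmult_imq_qdiv: "q \<odot> imq (qdiv q p) = (q \<bullet> q) *\<^sub>R p - (q \<bullet> p) *\<^sub>R q"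
  by (simp add: qdiv_def quat_simps algebra_simps)

lemma qdiv_qmult_imq: "qdiv (q \<odot> imq a) (q \<odot> imq b) = - (q \<bullet> q) *\<^sub>R cross3 a b"
  by (simp add: qdiv_def quat_simps algebra_simps)

lemma inner_qmult_imq: "(q \<odot> imq a) \<bullet> (q \<odot> imq b) = (q \<bullet> q) * (a \<bullet> b)"
  by (simp add: quat_simps algebra_simps)

lemma inner_qmult_imq_self: "q \<bullet> (q \<odot> imq a) = 0"
  by (simp add: quat_simps algebra_simps)

lemma qmult_imq_imq_self: "q \<odot> imq a \<odot> imq a = - (a \<bullet> a) *\<^sub>R q"
  by (simp add: quat_simps algebra_simps)

text \<open>Origin of the factor 2 in the integrability condition, hence of the value -1 for
  \<open>H\<close>.\<close>

lemma qmult_imq_commutator: "q \<odot> imq a \<odot> imq b - q \<odot> imq b \<odot> imq a = q \<odot> imq (2 *\<^sub>R cross3 a b)"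
  by (simp add: quat_simps algebra_simps)

section \<open>Complexified vectors and Wirtinger derivatives\<close>

lemma bounded_linear_cvec: "bounded_linear (cvec :: real ^ 'n \<Rightarrow> complex ^ 'n)"
  by (rule linear_conv_bounded_linear[THEN iffD1]) (auto simp: cvec_def vec_eq_iff scaleR_conv_of_real[symmetric] intro!: linearI)

lemma cvec_simps:
  "cvec (u + v) = cvec u + cvec v" "cvec (u - v) = cvec u - cvec v" "cvec (- u) = - cvec u"
  "cvec (r *\<^sub>R u) = complex_of_real r *s cvec u"
  by (simp_all add: cvec_def vec_eq_iff)

lemma cdot_cvec: "cdot (cvec u) (cvec v) = complex_of_real (u \<bullet> v)"
  by (simp add: cdot_def cvec_def inner_vec_def)

lemma cdot_linear:
  "cdot (u + v) w = cdot u w + cdot v w" "cdot (u - v) w = cdot u w - cdot v w"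
  "cdot w (u + v) = cdot w u + cdot w v" "cdot w (u - v) = cdot w u - cdot w v"
  "cdot (r *s u) w = r * cdot u w" "cdot u (r *s w) = r * cdot u w"
  by (simp_all add: cdot_def sum.distrib sum_subtractf algebra_simps sum_distrib_left)

lemma dz_cvec:
  assumes "g differentiable (at w)"
  shows "dz (cvec \<circ> g) w = (1 / 2) *s (cvec (dx g w) - \<i> *s cvec (dy g w))"
    "dzbar (cvec \<circ> g) w = (1 / 2) *s (cvec (dx g w) + \<i> *s cvec (dy g w))"
  by (simp_all add: dz_def dzbar_def o_def dx_dy_linear[OF bounded_linear_cvec assms])

lemma hopf_coefficient:
  assumes "in_coord c F differentiable (at w)"
  shows "hopf_differential F c w = (1 / 4) * (complex_of_real (dx (in_coord c F) w \<bullet> dx (in_coord c F) w -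
    dy (in_coord c F) w \<bullet> dy (in_coord c F) w) - 2 * \<i> * complex_of_real (dx (in_coord c F) w \<bullet> dy (in_coord c F) w))"
  by (simp add: hopf_differential_def dz_cvec[OF assms] cdot_linear cdot_cvec inner_commute algebra_simps)

text \<open>The mixed derivatives cancel in \<open>dzbar (dz F)\<close>, which leaves a quarter of
  the Laplacian; the product of the two Wirtinger derivatives is a quarter of
  \<open>|g\<^sub>x|\<^sup>2 + |g\<^sub>y|\<^sup>2\<close>. So the complex equation is a real
  one.\<close>

lemma harmonic_equation_iff:
  fixes g :: "complex \<Rightarrow> real ^ 'n"
  assumes U: "open U" "w \<in> U" and g: "smooth_on U g"
  shows "dzbar (dz (cvec \<circ> g)) w = - cdot (dz (cvec \<circ> g) w) (dzbar (cvec \<circ> g) w) *s (cvec \<circ> g) w \<longleftrightarrow>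
    dx (dx g) w + dy (dy g) w = - (dx g w \<bullet> dx g w + dy g w \<bullet> dy g w) *\<^sub>R g w"
proof -
  note g1 = smooth_on_D[OF g]
  note gx = smooth_on_D(1)[OF g1(3) U(2)] note gy = smooth_on_D(1)[OF g1(4) U(2)]
  have eq: "(1 / 2) *s (cvec (dx g z) - \<i> *s cvec (dy g z)) = dz (cvec \<circ> g) z" if "z \<in> U" for z
    using dz_cvec(1)[OF g1(1)[OF that]] by simp
  \<comment> \<open>\<open>dz\<close> is a real-linear function of the pair of partial derivatives,
    so \<open>dx\<close> and \<open>dy\<close> move through it at once.\<close>
  have lin: "bounded_linear (\<lambda>v :: (real ^ 'n) \<times> (real ^ 'n). (1 / 2) *s (cvec (fst v) - \<i> *s cvec (snd v)))"
    by (rule linear_conv_bounded_linear[THEN iffD1])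
      (auto simp: cvec_def vec_eq_iff scaleR_conv_of_real[where 'a = complex] field_simps intro!: linearI)
  let ?p = "\<lambda>z. (dx g z, dy g z)"
  have p: "(?p has_derivative (\<lambda>h. (Re h *\<^sub>R dx (dx g) w + Im h *\<^sub>R dy (dx g) w,
      Re h *\<^sub>R dx (dy g) w + Im h *\<^sub>R dy (dy g) w))) (at w)"
    by (intro has_derivative_Pair differentiable_has_dx_dy gx gy)
  then have pd: "?p differentiable (at w)" unfolding differentiable_def by blast
  have "dx ?p w = (dx (dx g) w, dx (dy g) w)" "dy ?p w = (dy (dx g) w, dy (dy g) w)"
    using has_derivative_frechet[OF p] by (simp_all add: dx_def dy_def)
  note 1 = dx_dy_linear[OF lin pd, unfolded this fst_conv snd_conv]
  have d: "(\<lambda>z. (1 / 2) *s (cvec (dx g z) - \<i> *s cvec (dy g z))) differentiable (at w)"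
    using bounded_linear.has_derivative[OF lin p] unfolding differentiable_def by auto
  have 2: "dx (dz (cvec \<circ> g)) w = dx (\<lambda>z. (1 / 2) *s (cvec (dx g z) - \<i> *s cvec (dy g z))) w"
    "dy (dz (cvec \<circ> g)) w = dy (\<lambda>z. (1 / 2) *s (cvec (dx g z) - \<i> *s cvec (dy g z))) w"
    by (rule dx_dy_cong[OF U eq d]; assumption)+
  have "dzbar (dz (cvec \<circ> g)) w = (1 / 4) *s cvec (dx (dx g) w + dy (dy g) w)"
    unfolding dzbar_def 2 1 mixed_partials[OF U g]
    by (simp add: cvec_simps vec_eq_iff algebra_simps)
  moreover have "- cdot (dz (cvec \<circ> g) w) (dzbar (cvec \<circ> g) w) *s (cvec \<circ> g) w =
      (1 / 4) *s cvec (- (dx g w \<bullet> dx g w + dy g w \<bullet> dy g w) *\<^sub>R g w)"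
    unfolding dz_cvec[OF g1(1)[OF U(2)]]
    by (simp add: cdot_linear cdot_cvec cvec_simps vec_eq_iff inner_commute algebra_simps)
  moreover have "(1 / 4) *s cvec u = (1 / 4) *s cvec v \<longleftrightarrow> u = v" for u v :: "real ^ 'n"
    by (simp add: vec_eq_iff cvec_def)
  ultimately show ?thesis by simp
qed

section \<open>The correspondence\<close>

lemma has_derivative_zero_of_parallel:
  assumes "\<And>a. T (prd (u w) a) = 0" "bounded_linear T" "parallel_at prd \<alpha> \<beta> u w"
  shows "((\<lambda>z. T (u z)) has_derivative (\<lambda>h. 0)) (at w)"
  using bounded_linear.has_derivative[OF assms(2) assms(3)[unfolded parallel_at_def]] assms(1)
  by (simp add: linear_simps[OF assms(2)])

text \<open>The primitive of a closed form as a parallel section: \<open>(X, s)\<close> with \<open>dX = s \<omega>\<close> and \<open>ds = 0\<close>.\<close>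

definition affine_prd :: "'v::real_normed_vector \<times> real \<Rightarrow> 'v \<Rightarrow> 'v \<times> real" where
  "affine_prd u a = (snd u *\<^sub>R a, 0)"

lemma bounded_bilinear_affine_prd: "bounded_bilinear (affine_prd :: 'v::real_normed_vector \<times> real \<Rightarrow> 'v \<Rightarrow> 'v \<times> real)"
proof
  show "\<exists>K. \<forall>(u :: 'v \<times> real) (a :: 'v). norm (affine_prd u a) \<le> norm u * norm a * K"
  proof (intro exI allI)
    fix u :: "'v \<times> real" and a :: 'v
    have "norm (affine_prd u a) = \<bar>snd u\<bar> * norm a" by (simp add: affine_prd_def norm_Pair)
    also have "\<dots> \<le> norm u * norm a * 1"
      using mult_right_mono[OF norm_snd_le[of "snd u" "fst u"], of "norm a"] by simp
    finally show "norm (affine_prd u a) \<le> norm u * norm a * 1" .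
  qed
qed (simp_all add: affine_prd_def algebra_simps)

section \<open>From a harmonic map to an H-surface\<close>

lemma in_coord_at:
  assumes "local_coordinate A c" "p \<in> fst c" shows "in_coord c u (snd c p) = u p"
  using complex_chartD(6)[OF local_coordinate_chart[OF assms(1)] assms(2)] by (simp add: in_coord_def)

lemma in_coord_dx_dy_change:
  assumes A: "riemann_surface A" and cd: "local_coordinate A c" "local_coordinate A d"
    and p: "p \<in> fst c" "p \<in> fst d" and u: "in_coord c u differentiable (at (snd c p))"
    and \<phi>: "\<phi> = deriv (transition d c) (snd d p)"
  shows "dx (in_coord d u) (snd d p) = Re \<phi> *\<^sub>R dx (in_coord c u) (snd c p) + Im \<phi> *\<^sub>R dy (in_coord c u) (snd c p)"
    "dy (in_coord d u) (snd d p) = Re \<phi> *\<^sub>R dy (in_coord c u) (snd c p) - Im \<phi> *\<^sub>R dx (in_coord c u) (snd c p)"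
  using has_derivative_imp_dx_dy[OF in_coord_change[OF A cd p differentiable_has_dx_dy[OF u] \<phi>]] by blast+

lemma smooth_map_in_coord:
  "smooth_map A F \<Longrightarrow> local_coordinate A c \<Longrightarrow> smooth_on (chart_image c) (in_coord c F)"
  unfolding smooth_map_def by blast

lemma harmonic_map_coord:
  assumes f: "harmonic_map A f" and c: "local_coordinate A c" and w: "w \<in> chart_image c"
  shows "dx (dx (in_coord c f)) w + dy (dy (in_coord c f)) w = - (dx (in_coord c f) w \<bullet> dx (in_coord c f) w +
    dy (in_coord c f) w \<bullet> dy (in_coord c f) w) *\<^sub>R in_coord c f w"
  using f c w harmonic_equation_iff[OF complex_chartD(2)[OF local_coordinate_chart[OF c]] w smooth_map_in_coord[OF _ c]]
  unfolding harmonic_map_def Let_def by (metis o_apply)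

lemma unit_sphere_tangent:
  assumes g: "\<And>z. g z \<bullet> g z = 1" and d: "g differentiable (at w)"
  shows "g w \<bullet> dx g w = 0" "g w \<bullet> dy g w = 0"
proof -
  have "dx (\<lambda>z. g z \<bullet> g z) w = 0" "dy (\<lambda>z. g z \<bullet> g z) w = 0"
    unfolding g using has_derivative_frechet[OF has_derivative_const] by (simp_all add: dx_def dy_def)
  then show "g w \<bullet> dx g w = 0" "g w \<bullet> dy g w = 0"
    unfolding dx_dy_bilinear[OF bounded_bilinear_inner d d] by (simp_all add: inner_commute)
qed

proposition harmonic_imp_associated:
  fixes A :: "('a::t2_space) chart set"
  assumes A: "riemann_surface A" and sc: "simply_connected (UNIV :: 'a set)" and f: "harmonic_map A f"
  shows "\<exists>X. H_surface A (- 1) X \<and> associated A f X"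
proof -
  interpret qdiv: bounded_bilinear qdiv by (rule bounded_bilinear_qdiv)
  have f1: "f p \<bullet> f p = 1" for p using f by (simp add: harmonic_map_def norm_eq_1)
  then have g1: "in_coord c f w \<bullet> in_coord c f w = 1" for c w by (simp add: in_coord_def)
  \<comment> \<open>These are the \<alpha> and \<beta> of \<open>f\<^sub>x = f \<alpha>\<close> and
    \<open>f\<^sub>y = f \<beta>\<close>, because the derivatives of \<open>f\<close> are tangent to
    the unit sphere.\<close>
  define a where "a c w = qdiv (in_coord c f w) (dx (in_coord c f) w)" for c w
  define b where "b c w = qdiv (in_coord c f w) (dy (in_coord c f) w)" for c w
  have g: "smooth_on (chart_image c) (in_coord c f)" if "local_coordinate A c" for c
    using f that unfolding harmonic_map_def by (blast intro: smooth_map_in_coord)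
  have U: "open (chart_image c)" if "local_coordinate A c" for c
    by (rule complex_chartD(2)[OF local_coordinate_chart[OF that]])
  have smooth: "smooth_on (chart_image c) (a c)" "smooth_on (chart_image c) (b c)" if c: "local_coordinate A c" for c
    unfolding a_def[abs_def] b_def[abs_def]
    using smooth_on_bilinear[OF U[OF c] bounded_bilinear_qdiv g[OF c] smooth_on_D(3)[OF g[OF c]]]
      smooth_on_bilinear[OF U[OF c] bounded_bilinear_qdiv g[OF c] smooth_on_D(4)[OF g[OF c]]] .
  have smooth_neg: "smooth_on (chart_image c) (\<lambda>w. - a c w)" if c: "local_coordinate A c" for c
    by (rule smooth_on_linear[OF U[OF c] _ smooth(1)[OF c]]) (intro bounded_linear_minus bounded_linear_ident)
  have fx: "dx (in_coord c f) w = in_coord c f w \<odot> imq (a c w)"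
    and fy: "dy (in_coord c f) w = in_coord c f w \<odot> imq (b c w)"
    if "local_coordinate A c" "w \<in> chart_image c" for c w
    using unit_sphere_tangent[OF g1 smooth_on_D(1)[OF g[OF that(1)] that(2)]]
    unfolding a_def b_def qmult_imq_qdiv g1 by simp_all
  have neg: "dx (\<lambda>w. - a c w) w = - dx (a c) w" "dy (\<lambda>w. - a c w) w = - dy (a c) w"
    if "local_coordinate A c" "w \<in> chart_image c" for c w
    using dx_dy_linear[OF bounded_linear_minus[OF bounded_linear_ident] smooth_on_D(1)[OF smooth(1)[OF that(1)] that(2)]]
    by simp_all
  have closed: "dx (a c) w + dy (b c) w = 0"
    and curl: "dx (b c) w - dy (a c) w = - 2 *\<^sub>R cross3 (a c w) (b c w)"
    if c: "local_coordinate A c" and w: "w \<in> chart_image c" for c w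
  proof -
    note gs = smooth_on_D[OF g[OF c]]
    note d = gs(1)[OF w] smooth_on_D(1)[OF gs(3) w] smooth_on_D(1)[OF gs(4) w]
    note ab = dx_dy_bilinear[OF bounded_bilinear_qdiv d(1,2)] dx_dy_bilinear[OF bounded_bilinear_qdiv d(1,3)]
    \<comment> \<open>\<open>qdiv\<close> vanishes on equal arguments, which removes the products of
      first derivatives; harmonicity makes the remaining Laplacian a multiple of \<open>f\<close>,
      where \<open>qdiv\<close> vanishes again.\<close>
    have "dx (a c) w + dy (b c) w = qdiv (in_coord c f w) (dx (dx (in_coord c f)) w + dy (dy (in_coord c f)) w)"
      unfolding a_def[abs_def] b_def[abs_def] ab by (simp add: qdiv_self qdiv.add_right)
    also have "\<dots> = 0"
      unfolding harmonic_map_coord[OF f c w] by (simp add: qdiv.scaleR_right qdiv_self)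
    finally show "dx (a c) w + dy (b c) w = 0" .
    \<comment> \<open>The second derivatives cancel by symmetry; the products of first derivatives
      are antisymmetric and add up to twice a cross product.\<close>
    have "dx (b c) w - dy (a c) w = qdiv (dx (in_coord c f) w) (dy (in_coord c f) w) -
        qdiv (dy (in_coord c f) w) (dx (in_coord c f) w)"
      unfolding a_def[abs_def] b_def[abs_def] ab mixed_partials[OF U[OF c] w g[OF c]] by simp
    also have "\<dots> = - 2 *\<^sub>R cross3 (a c w) (b c w)"
      unfolding fx[OF c w] fy[OF c w] qdiv_qmult_imq g1
      using cross_skew[of "b c w" "a c w"] by (simp add: scaleR_2)
    finally show "dx (b c) w - dy (a c) w = - 2 *\<^sub>R cross3 (a c w) (b c w)" .
  qed
  \<comment> \<open>Two affine products in succession vanish, so flatness of the pair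
    \<open>(b, - a)\<close> is the closedness just shown.\<close>
  interpret flat_connection A affine_prd b "\<lambda>c w. - a c w"
  proof (rule flat_connection.intro)
    show "riemann_surface A" by (rule A)
    show "bounded_bilinear affine_prd" by (rule bounded_bilinear_affine_prd)
    show "flat_system affine_prd (chart_image c) (b c) (\<lambda>w. - a c w)" if c: "local_coordinate A c" for c
      unfolding flat_system_def
    proof (intro conjI ballI allI)
      fix w assume w: "w \<in> chart_image c"
      show "b c differentiable at w" "(\<lambda>w. - a c w) differentiable at w"
        using smooth_on_D(1)[OF smooth(2)[OF c] w] smooth_on_D(1)[OF smooth_neg[OF c] w] by blast+
      have "dy (b c) w = - dx (a c) w" using closed[OF c w] by (simp add: eq_neg_iff_add_eq_0 add.commute)
      then show "affine_prd u (dy (b c) w) + affine_prd (affine_prd u (- a c w)) (b c w) =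
          affine_prd u (dx (\<lambda>w. - a c w) w) + affine_prd (affine_prd u (b c w)) (- a c w)" for u
        by (simp add: affine_prd_def neg[OF c w])
    next
      show "continuous_on (chart_image c) (dy (b c))" "continuous_on (chart_image c) (dx (\<lambda>w. - a c w))"
        using smooth_on_D(2)[OF smooth_on_D(4)[OF smooth(2)[OF c]]] smooth_on_D(2)[OF smooth_on_D(3)[OF smooth_neg[OF c]]]
        by blast+
    qed
    fix c d p \<phi> assume cd: "local_coordinate A c" "local_coordinate A d" and p: "p \<in> fst c" "p \<in> fst d"
      and \<phi>: "\<phi> = deriv (transition d c) (snd d p)"
    have "in_coord c f differentiable at (snd c p)"
      by (rule smooth_on_D(1)[OF g[OF cd(1)] complex_chartD(5)[OF local_coordinate_chart[OF cd(1)] p(1)]])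
    from in_coord_dx_dy_change[OF A cd p this \<phi>]
    show "b d (snd d p) = Re \<phi> *\<^sub>R b c (snd c p) + Im \<phi> *\<^sub>R (- a c (snd c p)) \<and>
      - a d (snd d p) = Re \<phi> *\<^sub>R (- a c (snd c p)) - Im \<phi> *\<^sub>R b c (snd c p)"
      unfolding a_def b_def in_coord_at[OF cd(1) p(1)] in_coord_at[OF cd(2) p(2)]
      by (simp add: qdiv.add_right qdiv.diff_right qdiv.scaleR_right)
  qed
  \<comment> \<open>The second component keeps its initial value 1, so the first one satisfies
    \<open>dX = b dx - a dy\<close>. The base point \<open>undefined\<close> is arbitrary.\<close>
  obtain u where u0: "u undefined = (0, 1)"
    and u: "\<And>c w. local_coordinate A c \<Longrightarrow> w \<in> chart_image c \<Longrightarrow>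
      parallel_at affine_prd (b c) (\<lambda>w. - a c w) (in_coord c u) w"
    by (rule parallel_section[OF sc, of undefined "(0, 1)"]) (rule that; assumption)
  have u1: "snd (u p) = 1" for p
  proof -
    have "(in_coord c (\<lambda>p. snd (u p)) has_derivative (\<lambda>h. 0)) (at w)"
      if "local_coordinate A c" "w \<in> chart_image c" for c w
      using has_derivative_zero_of_parallel[OF _ bounded_linear_snd u[OF that]]
      by (simp add: affine_prd_def in_coord_def o_def)
    from zero_derivative_imp_constant[OF A this, of p undefined] show ?thesis by (simp add: u0)
  qed
  define X where "X p = fst (u p)" for p
  have X: "(in_coord c X has_derivative (\<lambda>h. Re h *\<^sub>R b c w + Im h *\<^sub>R (- a c w))) (at w)"
    if "local_coordinate A c" "w \<in> chart_image c" for c w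
  proof -
    have "snd (in_coord c u w) = 1" by (simp add: in_coord_def u1)
    then show ?thesis
      using bounded_linear.has_derivative[OF bounded_linear_fst u[OF that, unfolded parallel_at_def]]
      by (simp add: affine_prd_def X_def in_coord_def o_def)
  qed
  note Xd = has_derivative_imp_dx_dy[OF X]
  have "smooth_map A X"
    unfolding smooth_map_def using smooth_on_partials[OF U X smooth(2) smooth_neg] by blast
  moreover have "dx (dx (in_coord c X)) w + dy (dy (in_coord c X)) w =
      (2 * - 1) *\<^sub>R cross3 (dx (in_coord c X) w) (dy (in_coord c X) w)"
    if c: "local_coordinate A c" and w: "w \<in> chart_image c" for c w
  proof -
    have "dx (dx (in_coord c X)) w = dx (b c) w"
      by (rule dx_dy_cong(1)[OF U[OF c] w _ smooth_on_D(1)[OF smooth(2)[OF c] w]]) (simp add: Xd[OF c])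
    moreover have "dy (dy (in_coord c X)) w = dy (\<lambda>w. - a c w) w"
      by (rule dx_dy_cong(2)[OF U[OF c] w _ smooth_on_D(1)[OF smooth_neg[OF c] w]]) (simp add: Xd[OF c])
    ultimately show ?thesis
      using curl[OF c w] cross_skew[of "a c w" "b c w"] by (simp add: Xd[OF c w] neg[OF c w] cross_minus_right)
  qed
  ultimately have "H_surface A (- 1) X" by (simp add: H_surface_def Let_def)
  moreover have "associated A f X"
    unfolding associated_def using fx fy Xd by (metis minus_minus)
  ultimately show ?thesis by blast
qed

section \<open>From an H-surface to a harmonic map\<close>

lemma H_surface_coord:
  assumes X: "H_surface A H X" and c: "local_coordinate A c" and w: "w \<in> chart_image c"
  shows "smooth_on (chart_image c) (in_coord c X)"
    "dx (dx (in_coord c X)) w + dy (dy (in_coord c X)) w =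
      (2 * H) *\<^sub>R cross3 (dx (in_coord c X) w) (dy (in_coord c X) w)"
  using X c w smooth_map_in_coord[OF _ c] unfolding H_surface_def Let_def by blast+

proposition H_surface_imp_associated:
  fixes A :: "('a::t2_space) chart set"
  assumes A: "riemann_surface A" and sc: "simply_connected (UNIV :: 'a set)" and X: "H_surface A (- 1) X"
  shows "\<exists>f. harmonic_map A f \<and> associated A f X"
proof -
  let ?prd = "\<lambda>q a. q \<odot> imq a"
  interpret prd: bounded_bilinear ?prd by (rule bounded_bilinear_qmult_imq)
  define a where "a c w = - dy (in_coord c X) w" for c w
  define b where "b c w = dx (in_coord c X) w" for c w
  have U: "open (chart_image c)" if "local_coordinate A c" for c
    by (rule complex_chartD(2)[OF local_coordinate_chart[OF that]])
  have Y: "smooth_on (chart_image c) (in_coord c X)" if "local_coordinate A c" for c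
    using X that unfolding H_surface_def by (blast intro: smooth_map_in_coord)
  have neg: "bounded_linear (\<lambda>v. - v :: real ^ 3)"
    by (intro bounded_linear_minus bounded_linear_ident)
  have smooth: "smooth_on (chart_image c) (a c)" "smooth_on (chart_image c) (b c)" if c: "local_coordinate A c" for c
    unfolding a_def[abs_def] b_def[abs_def]
    using smooth_on_linear[OF U[OF c] neg smooth_on_D(4)[OF Y[OF c]]] smooth_on_D(3)[OF Y[OF c]] by simp_all
  have da: "dx (a c) w = - dx (dy (in_coord c X)) w" "dy (a c) w = - dy (dy (in_coord c X)) w"
    if "local_coordinate A c" "w \<in> chart_image c" for c w
    unfolding a_def[abs_def]
    using dx_dy_linear[OF neg smooth_on_D(1)[OF smooth_on_D(4)[OF Y[OF that(1)]] that(2)]] by simp_all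
  have db: "b c = dx (in_coord c X)" for c by (rule ext) (simp add: b_def)
  have closed: "dx (a c) w + dy (b c) w = 0" if "local_coordinate A c" "w \<in> chart_image c" for c w
    using mixed_partials[OF U[OF that(1)] that(2) Y[OF that(1)]] by (simp add: da[OF that] db)
  have curl: "dx (b c) w - dy (a c) w = 2 *\<^sub>R cross3 (b c w) (a c w)"
    if "local_coordinate A c" "w \<in> chart_image c" for c w
    using H_surface_coord(2)[OF X that] by (simp add: da[OF that] db a_def cross_minus_right)
  interpret flat_connection A ?prd a b
  proof (rule flat_connection.intro)
    show "riemann_surface A" by (rule A)
    show "bounded_bilinear ?prd" by (rule bounded_bilinear_qmult_imq)
    show "flat_system ?prd (chart_image c) (a c) (b c)" if c: "local_coordinate A c" for c
      unfolding flat_system_def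
    proof (intro conjI ballI allI)
      fix w assume w: "w \<in> chart_image c"
      show "a c differentiable at w" "b c differentiable at w"
        using smooth_on_D(1)[OF smooth(1)[OF c] w] smooth_on_D(1)[OF smooth(2)[OF c] w] by blast+
      fix u
      have "dx (b c) w = dy (a c) w + 2 *\<^sub>R cross3 (b c w) (a c w)"
        using curl[OF c w] by (simp add: algebra_simps)
      then show "u \<odot> imq (dy (a c) w) + u \<odot> imq (b c w) \<odot> imq (a c w) =
          u \<odot> imq (dx (b c) w) + u \<odot> imq (a c w) \<odot> imq (b c w)"
        using qmult_imq_commutator[of u "b c w" "a c w"] by (simp add: prd.add_right algebra_simps)
    next
      show "continuous_on (chart_image c) (dy (a c))" "continuous_on (chart_image c) (dx (b c))"
        using smooth_on_D(2)[OF smooth_on_D(4)[OF smooth(1)[OF c]]] smooth_on_D(2)[OF smooth_on_D(3)[OF smooth(2)[OF c]]]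
        by blast+
    qed
    fix c d p \<phi> assume cd: "local_coordinate A c" "local_coordinate A d" and p: "p \<in> fst c" "p \<in> fst d"
      and \<phi>: "\<phi> = deriv (transition d c) (snd d p)"
    have "in_coord c X differentiable at (snd c p)"
      by (rule smooth_on_D(1)[OF Y[OF cd(1)] complex_chartD(5)[OF local_coordinate_chart[OF cd(1)] p(1)]])
    from in_coord_dx_dy_change[OF A cd p this \<phi>]
    show "a d (snd d p) = Re \<phi> *\<^sub>R a c (snd c p) + Im \<phi> *\<^sub>R b c (snd c p) \<and>
      b d (snd d p) = Re \<phi> *\<^sub>R b c (snd c p) - Im \<phi> *\<^sub>R a c (snd c p)"
      unfolding a_def b_def by simp
  qed
  \<comment> \<open>Any unit quaternion would do as initial value; the norm is conserved because
    \<open>q \<odot> imq a\<close> is orthogonal to \<open>q\<close>.\<close>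
  obtain f where f0: "f undefined = quat 1 0"
    and f: "\<And>c w. local_coordinate A c \<Longrightarrow> w \<in> chart_image c \<Longrightarrow>
      parallel_at ?prd (a c) (b c) (in_coord c f) w"
    by (rule parallel_section[OF sc, of undefined "quat 1 0"]) (rule that; assumption)
  have f1: "f p \<bullet> f p = 1" for p
  proof -
    have "(in_coord c (\<lambda>p. f p \<bullet> f p) has_derivative (\<lambda>h. 0)) (at w)"
      if "local_coordinate A c" "w \<in> chart_image c" for c w
    proof -
      note d = f[OF that, unfolded parallel_at_def]
      show ?thesis
        using has_derivative_inner[OF d d]
        by (simp add: in_coord_def o_def inner_add_right inner_add_left inner_qmult_imq_self
          inner_commute[of "_ \<odot> _" "f _"])
    qed
    from zero_derivative_imp_constant[OF A this, of p undefined] show ?thesis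
      by (simp add: f0 quat_def inner_vec_def sum_4)
  qed
  have g1: "in_coord c f w \<bullet> in_coord c f w = 1" for c w by (simp add: in_coord_def f1)
  have fx: "dx (in_coord c f) w = in_coord c f w \<odot> imq (a c w)"
    and fy: "dy (in_coord c f) w = in_coord c f w \<odot> imq (b c w)"
    if "local_coordinate A c" "w \<in> chart_image c" for c w
    using has_derivative_imp_dx_dy[OF f[OF that, unfolded parallel_at_def]] by blast+
  have g: "smooth_on (chart_image c) (in_coord c f)" if c: "local_coordinate A c" for c
    by (rule parallel_smooth[OF U[OF c] bounded_bilinear_qmult_imq smooth[OF c] f[OF c]])
  have "dx (dx (in_coord c f)) w + dy (dy (in_coord c f)) w = - (dx (in_coord c f) w \<bullet> dx (in_coord c f) w +
    dy (in_coord c f) w \<bullet> dy (in_coord c f) w) *\<^sub>R in_coord c f w"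
    if c: "local_coordinate A c" and w: "w \<in> chart_image c" for c w
  proof -
    let ?g = "in_coord c f"
    have gw: "?g differentiable at w" and aw: "a c differentiable at w" and bw: "b c differentiable at w"
      using smooth_on_D(1)[OF g[OF c] w] smooth_on_D(1)[OF smooth(1)[OF c] w] smooth_on_D(1)[OF smooth(2)[OF c] w]
      by blast+
    have diff: "(\<lambda>z. ?g z \<odot> imq (a c z)) differentiable at w" "(\<lambda>z. ?g z \<odot> imq (b c z)) differentiable at w"
      using prd.FDERIV[OF gw[unfolded frechet_derivative_works] aw[unfolded frechet_derivative_works]]
        prd.FDERIV[OF gw[unfolded frechet_derivative_works] bw[unfolded frechet_derivative_works]]
      unfolding differentiable_def by blast+
    have "dx (dx ?g) w = dx (\<lambda>z. ?g z \<odot> imq (a c z)) w"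
      by (rule dx_dy_cong(1)[OF U[OF c] w _ diff(1)]) (simp add: fx[OF c])
    also have "\<dots> = ?g w \<odot> imq (dx (a c) w) - (a c w \<bullet> a c w) *\<^sub>R ?g w"
      unfolding dx_dy_bilinear(1)[OF bounded_bilinear_qmult_imq gw aw] fx[OF c w] qmult_imq_imq_self by simp
    finally have xx: "dx (dx ?g) w = ?g w \<odot> imq (dx (a c) w) - (a c w \<bullet> a c w) *\<^sub>R ?g w" .
    have "dy (dy ?g) w = dy (\<lambda>z. ?g z \<odot> imq (b c z)) w"
      by (rule dx_dy_cong(2)[OF U[OF c] w _ diff(2)]) (simp add: fy[OF c])
    also have "\<dots> = ?g w \<odot> imq (dy (b c) w) - (b c w \<bullet> b c w) *\<^sub>R ?g w"
      unfolding dx_dy_bilinear(2)[OF bounded_bilinear_qmult_imq gw bw] fy[OF c w] qmult_imq_imq_self by simp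
    finally have yy: "dy (dy ?g) w = ?g w \<odot> imq (dy (b c) w) - (b c w \<bullet> b c w) *\<^sub>R ?g w" .
    \<comment> \<open>The tangential part of the Laplacian vanishes by closedness; the normal parts
      carry the required coefficient because \<open>|f \<alpha>| = |\<alpha>|\<close> for unit
      \<open>f\<close>.\<close>
    have "?g w \<odot> imq (dx (a c) w) + ?g w \<odot> imq (dy (b c) w) = 0"
      unfolding prd.add_right[symmetric] closed[OF c w] by (rule prd.zero_right)
    then show ?thesis
      unfolding xx yy unfolding fx[OF c w] fy[OF c w] inner_qmult_imq g1 by (simp add: algebra_simps)
  qed
  then have "dzbar (dz (cvec \<circ> in_coord c f)) w =
      - cdot (dz (cvec \<circ> in_coord c f) w) (dzbar (cvec \<circ> in_coord c f) w) *s (cvec \<circ> in_coord c f) w"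
    if "local_coordinate A c" "w \<in> chart_image c" for c w
    using harmonic_equation_iff[OF U[OF that(1)] that(2) g[OF that(1)]] that by blast
  moreover have "norm (f p) = 1" for p using f1 by (simp add: norm_eq_1)
  moreover have "smooth_map A f" unfolding smooth_map_def using g by blast
  ultimately have "harmonic_map A f" unfolding harmonic_map_def Let_def by blast
  moreover have "associated A f X"
    unfolding associated_def
  proof (intro allI impI)
    fix c assume c: "local_coordinate A c"
    show "\<exists>\<alpha> \<beta>. \<forall>w\<in>chart_image c. dx (in_coord c f) w = in_coord c f w \<odot> imq (\<alpha> w) \<and>
        dy (in_coord c f) w = in_coord c f w \<odot> imq (\<beta> w) \<and>
        dx (in_coord c X) w = \<beta> w \<and> dy (in_coord c X) w = - \<alpha> w"
      by (rule exI[of _ "a c"], rule exI[of _ "b c"]) (simp add: fx[OF c] fy[OF c], simp add: a_def b_def)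
  qed
  ultimately show ?thesis by blast
qed

text \<open>Association means \<open>X\<^sub>z = i f\<^sup>-\<^sup>1 f\<^sub>z\<close>.
  Multiplication by a unit quaternion preserves the bilinear product, and \<open>i\<close> squares
  to -1.\<close>

lemma hopf_differential_associated:
  assumes f: "harmonic_map A f" and X: "H_surface A (- 1) X" and fX: "associated A f X"
    and c: "local_coordinate A c" and w: "w \<in> chart_image c"
  shows "hopf_differential f c w = - hopf_differential X c w"
proof -
  obtain \<alpha> \<beta> where *: "dx (in_coord c f) w = in_coord c f w \<odot> imq (\<alpha> w)"
    "dy (in_coord c f) w = in_coord c f w \<odot> imq (\<beta> w)"
    "dx (in_coord c X) w = \<beta> w" "dy (in_coord c X) w = - \<alpha> w"
    using fX c w unfolding associated_def by blast
  have "in_coord c f w \<bullet> in_coord c f w = 1"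
    using f by (simp add: harmonic_map_def norm_eq_1 in_coord_def)
  moreover have "in_coord c f differentiable (at w)"
    using f smooth_on_D(1)[OF smooth_map_in_coord[OF _ c] w] unfolding harmonic_map_def by blast
  moreover have "in_coord c X differentiable (at w)"
    by (rule smooth_on_D(1)[OF H_surface_coord(1)[OF X c w] w])
  ultimately show ?thesis
    by (simp add: hopf_coefficient * inner_qmult_imq inner_commute algebra_simps)
qed

text \<open>The antiholomorphic derivative of the coefficient is half the product of
  \<open>X\<^sub>z\<close> with the Laplacian, which is a multiple of
  \<open>X\<^sub>x \<times> X\<^sub>y\<close> and so orthogonal to both partial derivatives.\<close>

lemma hopf_differential_H_surface:
  assumes A: "riemann_surface A" and X: "H_surface A H X"
  shows "holomorphic_quadratic_differential A (hopf_differential X)"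
  unfolding holomorphic_quadratic_differential_def
proof (intro conjI allI impI ballI)
  fix c assume c: "local_coordinate A c"
  note U = complex_chartD(2)[OF local_coordinate_chart[OF c]]
  show "hopf_differential X c holomorphic_on chart_image c"
  proof (rule holomorphic_onI)
    fix w assume w: "w \<in> chart_image c"
    let ?Y = "in_coord c X"
    note Y = smooth_on_D[OF H_surface_coord(1)[OF X c w]]
    note Yx = smooth_on_D(1)[OF Y(3) w] note Yy = smooth_on_D(1)[OF Y(4) w]
    let ?a = "dx ?Y w" and ?b = "dy ?Y w"
    define Q where "Q z = (1 / 4) * (complex_of_real (dx ?Y z \<bullet> dx ?Y z - dy ?Y z \<bullet> dy ?Y z) -
      2 * \<i> * complex_of_real (dx ?Y z \<bullet> dy ?Y z))" for z
    have lap: "?a \<bullet> (dx (dx ?Y) w + dy (dy ?Y) w) = 0" "?b \<bullet> (dx (dx ?Y) w + dy (dy ?Y) w) = 0"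
      unfolding H_surface_coord(2)[OF X c w] by (simp_all add: dot_cross_self)
    \<comment> \<open>\<open>q\<close> is the \<open>x\<close>-derivative of \<open>Q\<close>;
      holomorphy amounts to \<open>Q\<^sub>y = i Q\<^sub>x\<close>.\<close>
    define q where "q = (1 / 2) * (complex_of_real (?a \<bullet> dx (dx ?Y) w - ?b \<bullet> dx (dy ?Y) w) -
      \<i> * complex_of_real (dx (dx ?Y) w \<bullet> ?b + ?a \<bullet> dx (dy ?Y) w))"
    have "(Q has_derivative (\<lambda>h. q * h)) (at w)"
    proof (rule has_derivative_eq_rhs)
      note dY = differentiable_has_dx_dy[OF Yx] differentiable_has_dx_dy[OF Yy]
      show "(Q has_derivative (\<lambda>h. (1 / 4) * (complex_of_real
          ((?a \<bullet> (Re h *\<^sub>R dx (dx ?Y) w + Im h *\<^sub>R dy (dx ?Y) w) + (Re h *\<^sub>R dx (dx ?Y) w + Im h *\<^sub>R dy (dx ?Y) w) \<bullet> ?a) -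
           (?b \<bullet> (Re h *\<^sub>R dx (dy ?Y) w + Im h *\<^sub>R dy (dy ?Y) w) + (Re h *\<^sub>R dx (dy ?Y) w + Im h *\<^sub>R dy (dy ?Y) w) \<bullet> ?b)) -
          2 * \<i> * complex_of_real (?a \<bullet> (Re h *\<^sub>R dx (dy ?Y) w + Im h *\<^sub>R dy (dy ?Y) w) +
            (Re h *\<^sub>R dx (dx ?Y) w + Im h *\<^sub>R dy (dx ?Y) w) \<bullet> ?b)))) (at w)"
        unfolding Q_def[abs_def]
        by (intro has_derivative_mult_right has_derivative_diff has_derivative_of_real has_derivative_inner dY)
      have "?a \<bullet> dy (dy ?Y) w = - (?a \<bullet> dx (dx ?Y) w)" "?b \<bullet> dy (dy ?Y) w = - (?b \<bullet> dx (dx ?Y) w)"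
        using lap by (simp_all add: inner_add_right)
      then show "(\<lambda>h. (1 / 4) * (complex_of_real
          ((?a \<bullet> (Re h *\<^sub>R dx (dx ?Y) w + Im h *\<^sub>R dy (dx ?Y) w) + (Re h *\<^sub>R dx (dx ?Y) w + Im h *\<^sub>R dy (dx ?Y) w) \<bullet> ?a) -
           (?b \<bullet> (Re h *\<^sub>R dx (dy ?Y) w + Im h *\<^sub>R dy (dy ?Y) w) + (Re h *\<^sub>R dx (dy ?Y) w + Im h *\<^sub>R dy (dy ?Y) w) \<bullet> ?b)) -
          2 * \<i> * complex_of_real (?a \<bullet> (Re h *\<^sub>R dx (dy ?Y) w + Im h *\<^sub>R dy (dy ?Y) w) +
            (Re h *\<^sub>R dx (dx ?Y) w + Im h *\<^sub>R dy (dx ?Y) w) \<bullet> ?b))) = (\<lambda>h. q * h)"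
        unfolding mixed_partials[OF U w H_surface_coord(1)[OF X c w]] q_def
        by (intro ext complex_eqI) (simp_all add: inner_add_left inner_add_right inner_commute field_simps)
    qed
    from has_derivative_transform_within_open[OF this U w]
    have "(hopf_differential X c has_derivative (\<lambda>h. q * h)) (at w)"
      using hopf_coefficient[OF Y(1)] by (simp add: Q_def)
    then show "hopf_differential X c field_differentiable at w within chart_image c"
      using has_field_derivative_at_within unfolding field_differentiable_def has_field_derivative_def[symmetric] by blast
  qed
next
  fix c d p assume cd: "local_coordinate A c \<and> local_coordinate A d" and p: "p \<in> fst c \<inter> fst d"
  then have c: "local_coordinate A c" "p \<in> fst c" and d: "local_coordinate A d" "p \<in> fst d" by auto
  have diff: "in_coord e X differentiable (at (snd e p))" if "local_coordinate A e" "p \<in> fst e" for e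
  proof -
    note w = complex_chartD(5)[OF local_coordinate_chart[OF that(1)] that(2)]
    show ?thesis by (rule smooth_on_D(1)[OF H_surface_coord(1)[OF X that(1) w] w])
  qed
  \<comment> \<open>The change of coordinate multiplies \<open>X\<^sub>z\<close> by the derivative
    of the transition, which therefore enters the quadratic coefficient squared.\<close>
  note change = in_coord_dx_dy_change[OF A d(1) c(1) d(2) c(2) diff[OF d] refl]
  show "hopf_differential X c (snd c p) =
      hopf_differential X d (snd d p) * (deriv (transition c d) (snd c p))\<^sup>2"
    unfolding hopf_coefficient[OF diff[OF c]] hopf_coefficient[OF diff[OF d]] change
    by (intro complex_eqI) (simp_all add: inner_add_left inner_add_right inner_diff_left inner_diff_right
      inner_commute power2_eq_square field_simps)
qed

theorem proposition5p2:
  fixes A :: "('a::t2_space) chart set"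
  assumes "riemann_surface A"
    and "simply_connected (UNIV :: 'a set)"
  shows "(\<forall>f. harmonic_map A f \<longrightarrow> (\<exists>X. H_surface A (- 1) X \<and> associated A f X)) \<and>
    (\<forall>X. H_surface A (- 1) X \<longrightarrow> (\<exists>f. harmonic_map A f \<and> associated A f X)) \<and>
    (\<forall>f X. harmonic_map A f \<and> H_surface A (- 1) X \<and> associated A f X \<longrightarrow>
       (nonconformal A f \<longleftrightarrow>
          holomorphic_quadratic_differential A (hopf_differential X) \<and>
          not_identically_zero A (hopf_differential X)) \<and>
       (nowhere_conformal A f \<longleftrightarrow>
          holomorphic_quadratic_differential A (hopf_differential X) \<and>
          nowhere_zero A (hopf_differential X)))"
proof (intro conjI allI impI)
  fix f assume "harmonic_map A f"
  then show "\<exists>X. H_surface A (- 1) X \<and> associated A f X" by (rule harmonic_imp_associated[OF assms])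
next
  fix X assume "H_surface A (- 1) X"
  then show "\<exists>f. harmonic_map A f \<and> associated A f X" by (rule H_surface_imp_associated[OF assms])
next
  fix f X assume *: "harmonic_map A f \<and> H_surface A (- 1) X \<and> associated A f X"
  then have holo: "holomorphic_quadratic_differential A (hopf_differential X)"
    using hopf_differential_H_surface[OF assms(1)] by blast
  have zero: "hopf_differential f c w \<noteq> 0 \<longleftrightarrow> hopf_differential X c w \<noteq> 0"
    if "local_coordinate A c" "w \<in> chart_image c" for c w
    using hopf_differential_associated[OF _ _ _ that] * by (metis neg_equal_0_iff_equal)
  show "nonconformal A f \<longleftrightarrow> holomorphic_quadratic_differential A (hopf_differential X) \<and>
      not_identically_zero A (hopf_differential X)"
    unfolding nonconformal_def not_identically_zero_def using holo zero by blast
  show "nowhere_conformal A f \<longleftrightarrow> holomorphic_quadratic_differential A (hopf_differential X) \<and>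
      nowhere_zero A (hopf_differential X)"
    unfolding nowhere_conformal_def nowhere_zero_def using holo zero by blast
qed

end
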